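(* Let $\mathcal{K}_1,\mathcal{K}_2$ be complex Hilbert spaces, let $\mathcal{H}=\mathcal{K}_1\oplus\mathcal{K}_2$, and let $P:\mathcal{H}\to\mathcal{K}_1$ be the canonical projection. For $j=1,2$ let $A_j$ be a bounded selfadjoint operator on $\mathcal{K}_j$. Let $\varphi\in\mathcal{H}$ be such that $\varphi_1=P\varphi\in\mathcal{K}_1$ is a cyclic vector for $A_1$ and $\varphi_2=(1-P)\varphi\in\mathcal{K}_2$ is a cyclic vector for $A_2$. Let $\lambda\in\mathbb{R}\setminus\{0\}$. Then the bounded selfadjoint operator $$C=A_1\oplus A_2+\lambda\,\langle\varphi,\cdot\,\rangle\,\varphi$$ on $\mathcal{H}$ has simple singular spectrum.
   Context: Inner products are linear in the second argument, so $\langle\varphi,\cdot\,\rangle\varphi$ is the operator $u\mapsto\langle\varphi,u\rangle\varphi$. A vector $\varphi$ is cyclic for a bounded selfadjoint operator $A$ on a Hilbert space if the linear span of $\{A^n\varphi : n\ge 0\}$ is dense in that space. For a selfadjoint operator $C$ on $\mathcal{H}$, the singular subspace $\mathcal{H}_{\mathrm{s}}$ is the closed, $C$-invariant subspace of vectors $\psi$ whose spectral measure $\mu_\psi^C$ is singular with respect to Lebesgue measure on $\mathbb{R}$ (so it includes both the pure point and the singular continuous parts). $C$ has simple singular spectrum if the restriction of $C$ to $\mathcal{H}_{\mathrm{s}}$ has multiplicity one, i.e. has a cyclic vector in $\mathcal{H}_{\mathrm{s}}$ (the case $\mathcal{H}_{\mathrm{s}}=\{0\}$ being allowed). *)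

theory Defs
  imports "HOL-Analysis.Analysis"
begin

section \<open>Complex Hilbert spaces\<close>

text \<open>
  The real structure inherited from \<^class>\<open>real_inner\<close> and \<^class>\<open>banach\<close> is the restriction
  of the complex one; in particular the norm is
  \<open>norm x = sqrt (inner x x) = sqrt (Re (cinner x x))\<close>.
\<close>

class complex_hilbert_space = real_inner + banach +
  fixes scaleC :: "complex \<Rightarrow> 'a \<Rightarrow> 'a" (infixr \<open>*\<^sub>C\<close> 75)
    and cinner :: "'a \<Rightarrow> 'a \<Rightarrow> complex"
  assumes scaleC_add_right: "a *\<^sub>C (x + y) = a *\<^sub>C x + a *\<^sub>C y"
    and scaleC_add_left: "(a + b) *\<^sub>C x = a *\<^sub>C x + b *\<^sub>C x"
    and scaleC_scaleC: "a *\<^sub>C b *\<^sub>C x = (a * b) *\<^sub>C x"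
    and scaleC_one: "1 *\<^sub>C x = x"
    and scaleR_eq_scaleC: "r *\<^sub>R x = complex_of_real r *\<^sub>C x"
    and cinner_commute: "cinner x y = cnj (cinner y x)"
    and cinner_add_right: "cinner x (y + z) = cinner x y + cinner x z"
    and cinner_scaleC_right: "cinner x (a *\<^sub>C y) = a * cinner x y"
    and inner_eq_Re_cinner: "inner x y = Re (cinner x y)"

global_interpretation complex_vector:
  vector_space "scaleC :: complex \<Rightarrow> 'a \<Rightarrow> 'a::complex_hilbert_space"
  by unfold_locales (simp_all add: scaleC_add_right scaleC_add_left scaleC_scaleC scaleC_one)

instantiation prod :: (complex_hilbert_space, complex_hilbert_space) complex_hilbert_space
begin

definition scaleC_prod where
  "scaleC_prod a x = (a *\<^sub>C fst x, a *\<^sub>C snd x)"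

definition cinner_prod where
  "cinner_prod x y = cinner (fst x) (fst y) + cinner (snd x) (snd y)"

instance
proof
  fix x y z :: "'a \<times> 'b" and a b :: complex and r :: real
  show "a *\<^sub>C (x + y) = a *\<^sub>C x + a *\<^sub>C y" "(a + b) *\<^sub>C x = a *\<^sub>C x + b *\<^sub>C x"
    "a *\<^sub>C b *\<^sub>C x = (a * b) *\<^sub>C x" "1 *\<^sub>C x = x"
    by (simp_all add: scaleC_prod_def scaleC_add_right scaleC_add_left scaleC_scaleC scaleC_one)
  show "r *\<^sub>R x = complex_of_real r *\<^sub>C x"
    by (simp add: scaleC_prod_def scaleR_prod_def scaleR_eq_scaleC)
  show "cinner x y = cnj (cinner y x)"
    unfolding cinner_prod_def using cinner_commute[of "fst x"] cinner_commute[of "snd x"]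
    by simp
  show "cinner x (y + z) = cinner x y + cinner x z" "cinner x (a *\<^sub>C y) = a * cinner x y"
    by (simp_all add: cinner_prod_def scaleC_prod_def cinner_add_right cinner_scaleC_right
        distrib_left)
  show "inner x y = Re (cinner x y)"
    by (simp add: cinner_prod_def inner_prod_def inner_eq_Re_cinner)
qed

end


section \<open>Bounded selfadjoint operators and cyclic vectors\<close>

definition bounded_selfadjoint :: "('a::complex_hilbert_space \<Rightarrow> 'a) \<Rightarrow> bool" where
  "bounded_selfadjoint A \<longleftrightarrow>
     bounded_linear A \<and> (\<forall>c x. A (c *\<^sub>C x) = c *\<^sub>C A x) \<and>
     (\<forall>x y. cinner (A x) y = cinner x (A y))"

text \<open>
  For an \<open>A\<close>-invariant closed subspace \<open>S\<close> and \<open>\<phi> \<in> S\<close> this says that the linear span of the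
  orbit of \<open>\<phi>\<close> is dense in \<open>S\<close>. Conversely the equation forces \<open>\<phi> \<in> S\<close> and \<open>S\<close> closed.
\<close>

definition cyclic_vector_on ::
    "'a::complex_hilbert_space set \<Rightarrow> ('a \<Rightarrow> 'a) \<Rightarrow> 'a \<Rightarrow> bool" where
  "cyclic_vector_on S A \<phi> \<longleftrightarrow>
     closure (complex_vector.span (range (\<lambda>n::nat. (A ^^ n) \<phi>))) = S"

abbreviation cyclic_vector :: "('a::complex_hilbert_space \<Rightarrow> 'a) \<Rightarrow> 'a \<Rightarrow> bool" where
  "cyclic_vector \<equiv> cyclic_vector_on UNIV"


section \<open>Spectral measures\<close>

definition orthogonal_projection :: "('a::complex_hilbert_space \<Rightarrow> 'a) \<Rightarrow> bool" where
  "orthogonal_projection P \<longleftrightarrow> bounded_selfadjoint P \<and> P \<circ> P = P"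

definition bounded_pvm :: "(real set \<Rightarrow> 'a::complex_hilbert_space \<Rightarrow> 'a) \<Rightarrow> bool" where
  "bounded_pvm E \<longleftrightarrow>
     (\<forall>B\<in>sets borel. orthogonal_projection (E B)) \<and>
     E {} = (\<lambda>x. 0) \<and>
     (\<exists>a. E {-a<..<a} = id) \<and>
     (\<forall>B\<in>sets borel. \<forall>B'\<in>sets borel. E (B \<inter> B') = E B \<circ> E B') \<and>
     (\<forall>F :: nat \<Rightarrow> real set. range F \<subseteq> sets borel \<longrightarrow> disjoint_family F \<longrightarrow>
        (\<forall>x. (\<lambda>n. E (F n) x) sums E (\<Union>n. F n) x))"

text \<open>The scalar measure \<open>B \<mapsto> \<langle>\<psi>, E(B) \<psi>\<rangle>\<close>; these numbers are real and nonnegative.\<close>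

definition pvm_measure ::
    "(real set \<Rightarrow> 'a::complex_hilbert_space \<Rightarrow> 'a) \<Rightarrow> 'a \<Rightarrow> real measure" where
  "pvm_measure E \<psi> = measure_of UNIV (sets borel) (\<lambda>B. ennreal (Re (cinner \<psi> (E B \<psi>))))"

text \<open>
  \<open>C = \<integral> x dE(x)\<close> in the weak sense. By polarization it is enough to test the diagonal
  matrix elements. The integrals exist because \<open>E\<close> has bounded support.
\<close>

definition spectral_resolution ::
    "(real set \<Rightarrow> 'a::complex_hilbert_space \<Rightarrow> 'a) \<Rightarrow> ('a \<Rightarrow> 'a) \<Rightarrow> bool" where
  "spectral_resolution E C \<longleftrightarrow>
     bounded_pvm E \<and>
     (\<forall>\<psi>. cinner \<psi> (C \<psi>) = complex_of_real (\<integral>x. x \<partial>pvm_measure E \<psi>))"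

text \<open>
  By the spectral theorem a bounded selfadjoint operator has a spectral resolution, and its
  values on Borel sets are unique. Values of \<open>E\<close> on non-Borel sets do not enter
  \<^const>\<open>pvm_measure\<close>, so the choice below is immaterial.
\<close>

definition spectral_measure :: "('a::complex_hilbert_space \<Rightarrow> 'a) \<Rightarrow> 'a \<Rightarrow> real measure" where
  "spectral_measure C \<psi> = pvm_measure (SOME E. spectral_resolution E C) \<psi>"


section \<open>The singular subspace\<close>

definition lebesgue_singular :: "real measure \<Rightarrow> bool" where
  "lebesgue_singular \<mu> \<longleftrightarrow>
     (\<exists>N\<in>sets borel. emeasure lborel N = 0 \<and> emeasure \<mu> (UNIV - N) = 0)"

definition singular_subspace :: "('a::complex_hilbert_space \<Rightarrow> 'a) \<Rightarrow> 'a set" where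
  "singular_subspace C = {\<psi>. lebesgue_singular (spectral_measure C \<psi>)}"

text \<open>If the singular subspace is \<open>{0}\<close>, then \<open>0\<close> is a cyclic vector in it.\<close>

definition simple_singular_spectrum :: "('a::complex_hilbert_space \<Rightarrow> 'a) \<Rightarrow> bool" where
  "simple_singular_spectrum C \<longleftrightarrow> (\<exists>\<eta>. cyclic_vector_on (singular_subspace C) C \<eta>)"

end

theory Submission
  imports Defs "HOL-Probability.Helly_Selection" "HOL-Probability.Probability_Mass_Function"
    "HOL-Computational_Algebra.Polynomial"
begin

text \<open>
  Write \<open>A = A\<^sub>1 \<oplus> A\<^sub>2\<close>, let \<open>Z\<close> be the cyclic subspace of \<open>\<phi>\<close>, which is the same for \<open>A\<close> and \<open>C\<close>,
  and let \<open>g\<close> be the component of \<open>(\<phi>\<^sub>1, 0)\<close> orthogonal to \<open>Z\<close>. On the orthogonal complement of \<open>Z\<close>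
  the operators \<open>A\<close> and \<open>C\<close> agree, and \<open>\<phi>\<close> and \<open>g\<close> together generate the whole space. The spectral
  measure of \<open>g\<close> is absolutely continuous with respect to that of \<open>\<phi>\<close> for \<open>A\<close>. By Aronszajn--Donoghue
  the singular parts of the spectral measures of \<open>\<phi>\<close> for \<open>A\<close> and for \<open>C\<close> are mutually singular. Hence,
  if \<open>N\<close> is a Lebesgue null set carrying all singular parts, the spectral measures of \<open>E(N) \<phi>\<close> and
  \<open>E(N) g\<close> for \<open>C\<close> are mutually singular, so \<open>E(N) (\<phi> + g)\<close> is cyclic for the range of \<open>E(N)\<close>, which
  is the singular subspace.

  The spectral theorem is obtained from moments: \<open>\<langle>x, p(C) x\<rangle> = \<integral> p d\<mu>\<^sub>x\<close> determines measures \<open>\<mu>\<^sub>x\<close> by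
  the Hausdorff moment problem, and \<open>E(B)\<close> is the orthogonal projection onto the vectors \<open>x\<close> for
  which \<open>\<mu>\<^sub>x\<close> is carried by \<open>B\<close>.
\<close>


section \<open>The Hausdorff moment problem\<close>

text \<open>\<open>spectral_measure\<close> rests on an unspecified choice of resolution, so every
  fact about \<open>E\<close> and \<open>F\<close> must come from the axioms of an arbitrary
  resolution. The bridge is \<open>resolution_intertwine\<close>: a symmetric bounded
  \<open>T\<close> with \<open>C (T x) = T (A x)\<close> carries \<open>F B\<close> to
  \<open>E B\<close>. It is applied to three kinds of operator: projections onto invariant
  subspaces, the map \<open>R\<close> from (x, y) to (x, 0), which commutes with \<open>A\<close>,
  and the projection \<open>Q\<close> onto the complement of \<open>Z\<close>, where
  \<open>C (Q x) = Q (A x)\<close> because the perturbation vanishes there. The last two turn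
  \<open>F B \<phi> = 0\<close> into \<open>E B g = 0\<close>; this is the form in which absolute
  continuity enters. Singular parts are located without boundary values of Borel transforms. Points
  where the mass of dyadic cells divided by their length tends to infinity carry the measure on
  every Lebesgue null set, and there the imaginary part of the Borel transform at height 2^-n grows
  without bound. Disjoint carriers matter because a spectral projection can then extract each of two
  jointly generating vectors from their sum.\<close>

lemma falling_ratio_near_power:
  fixes k n j :: nat
  assumes "k \<le> n" "n > 2 * j"
  shows "\<bar>(\<Prod>i<j. (real k - real i) / (real n - real i)) - (real k / real n) ^ j\<bar>
      \<le> real j ^ 2 / (real n - real j)"
proof -
  have "\<bar>(\<Prod>i<j. (real k - real i) / (real n - real i)) - (\<Prod>i<j. real k / real n)\<bar>
      \<le> (\<Sum>i<j. \<bar>(real k - real i) / (real n - real i) - real k / real n\<bar>)"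
    \<comment> \<open>The product estimate requires factors of modulus at most 1. The bound
      \<open>n > 2 * j\<close> ensures this even for \<open>k < i\<close>, where the numerator is
      negative but \<open>i \<le> n - i\<close>.\<close>
    using assms
    by (intro norm_prod_diff[where 'a=real, unfolded real_norm_def]) (auto simp: field_simps abs_le_iff)
  also have "\<dots> \<le> (\<Sum>i<j. real j / (real n - real j))"
  proof (rule sum_mono)
    fix i assume "i \<in> {..<j}"
    then have i: "i < j" by simp
    have "\<bar>(real k - real i) / (real n - real i) - real k / real n\<bar>
        = (real i / (real n - real i)) * ((real n - real k) / real n)"
    proof -
      have "(real k - real i) / (real n - real i) - real k / real n
        = - ((real i / (real n - real i)) * ((real n - real k) / real n))"
        using assms i by (simp add: field_simps)
      moreover have "(real i / (real n - real i)) * ((real n - real k) / real n) \<ge> 0"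
        using assms i by (intro mult_nonneg_nonneg divide_nonneg_nonneg) auto
      ultimately show ?thesis by linarith
    qed
    also have "\<dots> \<le> (real i / (real n - real i)) * 1"
      using assms i by (intro mult_left_mono) (auto simp: field_simps)
    also have "\<dots> \<le> real j / (real n - real j)"
      using assms i by (simp add: frac_le)
    finally show "\<bar>(real k - real i) / (real n - real i) - real k / real n\<bar>
        \<le> real j / (real n - real j)" .
  qed
  finally show ?thesis by (simp add: power2_eq_square)
qed

lemma falling_ratio_eq_choose_ratio:
  fixes k n j :: nat
  assumes "j \<le> n"
  shows "(\<Prod>i<j. (real k - real i) / (real n - real i)) = real (k choose j) / real (n choose j)"
  using assms
  by (simp add: prod_dividef binomial_gbinomial gbinomial_prod_rev atLeast0LessThan)

text \<open>Factorial moments of a binomial distribution: \<open>choose_mult\<close> pulls out the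
  constant and leaves the binomial theorem. The semiring is general because \<open>x\<close> and
  \<open>y\<close> become the polynomials X and 1 - X, whose sum is 1.\<close>

lemma Bernstein_falling_moment:
  fixes x y :: "'a::comm_semiring_1"
  assumes "j \<le> n"
  shows "(\<Sum>k\<le>n. of_nat (n choose k) * of_nat (k choose j) * (x ^ k * y ^ (n - k)))
    = of_nat (n choose j) * (x ^ j * (x + y) ^ (n - j))"
proof -
  have "(\<Sum>k\<le>n. of_nat (n choose k) * of_nat (k choose j) * (x ^ k * y ^ (n - k)))
     = (\<Sum>k\<in>{j..n}. of_nat (n choose k) * of_nat (k choose j) * (x ^ k * y ^ (n - k)))"
    by (intro sum.mono_neutral_right) (auto simp: binomial_eq_0)
  also have "\<dots> = (\<Sum>i\<le>n - j. of_nat (n choose (i + j)) * of_nat ((i + j) choose j)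
        * (x ^ (i + j) * y ^ (n - (i + j))))"
    using assms
    by (intro sum.reindex_bij_witness[of _ "\<lambda>i. i + j" "\<lambda>k. k - j"]) auto
  also have "\<dots> = (\<Sum>i\<le>n - j. of_nat (n choose j) * (x ^ j * (of_nat ((n - j) choose i)
        * x ^ i * y ^ (n - j - i))))"
  proof (rule sum.cong[OF refl])
    fix i assume "i \<in> {..n - j}"
    then have "(n choose (i + j)) * ((i + j) choose j) = (n choose j) * ((n - j) choose i)"
      using assms choose_mult[of j "i + j" n] by simp
    then have "(of_nat (n choose (i + j)) * of_nat ((i + j) choose j) :: 'a)
        = of_nat (n choose j) * of_nat ((n - j) choose i)"
      by (metis of_nat_mult)
    then show "of_nat (n choose (i + j)) * of_nat ((i + j) choose j)
        * (x ^ (i + j) * y ^ (n - (i + j)))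
      = of_nat (n choose j) * (x ^ j * (of_nat ((n - j) choose i) * x ^ i * y ^ (n - j - i)))"
      by (simp add: power_add algebra_simps)
  qed
  also have "\<dots> = of_nat (n choose j) * (x ^ j * (x + y) ^ (n - j))"
    by (simp add: binomial_ring sum_distrib_left)
  finally show ?thesis .
qed

text \<open>Nonnegativity on X^k (1 - X)^l is Hausdorff's condition that the moment sequence be
  completely monotone.\<close>

locale hausdorff_functional =
  fixes L :: "real poly \<Rightarrow> real"
  assumes L_add: "L (p + q) = L p + L q"
    and L_smult: "L (smult c p) = c * L p"
    and L_nonneg: "L ([:0, 1:] ^ k * [:1, -1:] ^ l) \<ge> 0"
    and L_1: "L 1 = 1"
begin

lemma L_sum: "L (sum f A) = (\<Sum>i\<in>A. L (f i))"
proof -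
  have "L 0 = 0" using L_smult[of 0 0] by simp
  then show ?thesis by (induction A rule: infinite_finite_induct) (auto simp: L_add)
qed

text \<open>The value of \<open>L\<close> on a Bernstein basis polynomial, which becomes the mass at
  the node \<open>k / n\<close> of a discrete approximation to the measure sought.\<close>

definition weight :: "nat \<Rightarrow> nat \<Rightarrow> real" where
  "weight n k = real (n choose k) * L ([:0, 1:] ^ k * [:1, -1:] ^ (n - k))"

lemma weight_nonneg: "weight n k \<ge> 0"
  by (simp add: weight_def L_nonneg)

lemma weight_zero: "k > n \<Longrightarrow> weight n k = 0"
  by (simp add: weight_def binomial_eq_0)

text \<open>Falling factorial moments of the approximation are exact at every
  \<open>n \<ge> j\<close>; only replacing them by ordinary powers costs an error, of order
  1/n.\<close>

lemma weight_falling_moment: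
  assumes "j \<le> n"
  shows "(\<Sum>k\<le>n. weight n k * (real (k choose j) / real (n choose j))) = L ([:0, 1:] ^ j)"
proof -
  have "(\<Sum>k\<le>n. weight n k * (real (k choose j) / real (n choose j)))
      = (\<Sum>k\<le>n. L (smult (real (n choose k) * real (k choose j)) ([:0, 1:] ^ k * [:1, -1:] ^ (n - k))))
          / real (n choose j)"
    by (simp add: weight_def L_smult sum_divide_distrib algebra_simps)
  also have "\<dots> = L (\<Sum>k\<le>n. of_nat (n choose k) * of_nat (k choose j) * ([:0, 1:] ^ k * [:1, -1:] ^ (n - k)))
      / real (n choose j)"
    by (simp add: L_sum of_nat_poly mult_ac)
  also have "(\<Sum>k\<le>n. of_nat (n choose k) * of_nat (k choose j) * ([:0, 1:] ^ k * [:1, -1:] ^ (n - k)))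
      = of_nat (n choose j) * ([:0, 1:] ^ j * ([:0, 1:] + [:1, -1::real:]) ^ (n - j))"
    by (rule Bernstein_falling_moment[OF assms])
  also have "[:0, 1:] + [:1, -1::real:] = 1" by simp
  finally show ?thesis using assms by (simp add: of_nat_poly L_smult)
qed

lemma weight_sum: "(\<Sum>k\<le>n. weight n k) = 1"
  using weight_falling_moment[of 0 n] by (simp add: L_1)

definition wpmf :: "nat \<Rightarrow> nat pmf" where "wpmf n = embed_pmf (weight n)"

lemma pmf_wpmf: "pmf (wpmf n) k = weight n k"
  unfolding wpmf_def
proof (rule pmf_embed_pmf)
  show "0 \<le> weight n x" for x by (rule weight_nonneg)
  have "(\<integral>\<^sup>+ x. ennreal (weight n x) \<partial>count_space UNIV) = (\<integral>\<^sup>+ x. ennreal (weight n x) \<partial>count_space {..n})"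
    by (rule nn_integral_count_space_eq[symmetric]) (auto simp: weight_zero)
  also have "\<dots> = 1"
    by (simp add: nn_integral_count_space_finite weight_nonneg weight_sum flip: ennreal_1)
  finally show "(\<integral>\<^sup>+ x. ennreal (weight n x) \<partial>count_space UNIV) = 1" .
qed

text \<open>For \<open>n = 0\<close> division by zero puts the single node at 0, so the nodes lie in
  the unit interval for every \<open>n\<close>.\<close>

definition node_measure :: "nat \<Rightarrow> real measure" where
  "node_measure n = distr (measure_pmf (wpmf n)) borel (\<lambda>k. real k / real n)"

lemma real_distribution_node: "real_distribution (node_measure n)"
  unfolding node_measure_def real_distribution_def real_distribution_axioms_def
  by (auto intro!: prob_space.prob_space_distr measure_pmf.prob_space_axioms)

lemma integral_node:
  assumes [measurable]: "f \<in> borel_measurable borel"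
  shows "(\<integral>x. f x \<partial>node_measure n) = (\<Sum>k\<le>n. f (real k / real n) * weight n k)"
  unfolding node_measure_def
  by (subst integral_distr, simp, simp, subst integral_measure_pmf_real[where A="{..n}"])
     (auto simp: pmf_wpmf set_pmf_eq intro: leI dest: weight_zero)

lemma node_moment_tendsto:
  "(\<lambda>n. \<Sum>k\<le>n. (real k / real n) ^ j * weight n k) \<longlonglongrightarrow> L ([:0, 1:] ^ j)"
proof (rule LIM_zero_cancel, rule Lim_null_comparison)
  show "\<forall>\<^sub>F n in sequentially. norm ((\<Sum>k\<le>n. (real k / real n) ^ j * weight n k) - L ([:0, 1:] ^ j))
     \<le> real j ^ 2 / (real n - real j)"
  proof (rule eventually_sequentiallyI[of "2 * j + 1"])
    fix n assume n: "n \<ge> 2 * j + 1"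
    have "(\<Sum>k\<le>n. (real k / real n) ^ j * weight n k) - L ([:0, 1:] ^ j)
       = (\<Sum>k\<le>n. weight n k * ((real k / real n) ^ j - real (k choose j) / real (n choose j)))"
      using n by (simp add: weight_falling_moment[symmetric, of j n] algebra_simps sum_subtractf)
    also have "norm \<dots> \<le> (\<Sum>k\<le>n. weight n k * (real j ^ 2 / (real n - real j)))"
      unfolding real_norm_def
    proof (rule order.trans[OF sum_abs sum_mono])
      fix k assume "k \<in> {..n}"
      then have "\<bar>real (k choose j) / real (n choose j) - (real k / real n) ^ j\<bar> \<le> real j ^ 2 / (real n - real j)"
        using falling_ratio_near_power[of k n j] falling_ratio_eq_choose_ratio[of j n k] n by simp
      then show "\<bar>weight n k * ((real k / real n) ^ j - real (k choose j) / real (n choose j))\<bar>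
         \<le> weight n k * (real j ^ 2 / (real n - real j))"
        unfolding abs_mult using weight_nonneg[of n k]
        by (intro mult_mono) (auto simp: abs_minus_commute)
    qed
    also have "\<dots> = real j ^ 2 / (real n - real j)"
      by (simp only: sum_distrib_right[symmetric] weight_sum mult_1)
    finally show "norm ((\<Sum>k\<le>n. (real k / real n) ^ j * weight n k) - L ([:0, 1:] ^ j))
      \<le> real j ^ 2 / (real n - real j)" .
  qed
  have "(\<lambda>n. real j ^ 2 / (- real j + real n)) \<longlonglongrightarrow> 0"
    by (rule tendsto_divide_0[OF tendsto_const])
      (rule filterlim_at_top_imp_at_infinity,
       rule filterlim_tendsto_add_at_top[OF tendsto_const filterlim_real_sequentially])
  then show "(\<lambda>n. real j ^ 2 / (real n - real j)) \<longlonglongrightarrow> 0" by simp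
qed

text \<open>Helly selection gives a weak limit of a subsequence of the node measures. Support and
  moments are then carried to the limit by suitable bounded continuous test functions.\<close>

lemma ex_representing_measure:
  "\<exists>M. prob_space M \<and> sets M = sets borel \<and> (AE x in M. x \<in> {0..1}) \<and>
     (\<forall>p. (\<integral>x. poly p x \<partial>M) = L p)"
proof -
  \<comment> \<open>Tightness is phrased with intervals open on the left, so the left endpoint must
    lie below the node 0.\<close>
  have "measure (node_measure n) {-1<..1} = 1" for n
  proof -
    interpret real_distribution "node_measure n" by (rule real_distribution_node)
    have "(\<integral>x. indicator {-1<..1} x \<partial>node_measure n) = (\<Sum>k\<le>n. weight n k)"
      by (subst integral_node, simp, rule sum.cong)
        (auto simp: indicator_def divide_le_eq less_le_trans[OF _ divide_nonneg_nonneg])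
    then show ?thesis by (simp add: weight_sum)
  qed
  then have "tight node_measure"
    unfolding tight_def using real_distribution_node
    by (intro conjI allI impI exI[of _ "-1"] exI[of _ 1]) simp_all
  then obtain r M where r: "strict_mono (r :: nat \<Rightarrow> nat)" and M: "real_distribution M"
    and conv: "weak_conv_m (node_measure \<circ> id \<circ> r) M"
    using tight_imp_convergent_subsubsequence[of node_measure id] by (auto simp: strict_mono_id)
  interpret M: real_distribution M by fact
  have limit: "(\<lambda>n. integral\<^sup>L (node_measure (r n)) f) \<longlonglongrightarrow> integral\<^sup>L M f"
    if "\<And>x. isCont f x" "\<And>x. \<bar>f x\<bar> \<le> 1" for f :: "real \<Rightarrow> real"
    using weak_conv_imp_integral_bdd_continuous_conv[of "node_measure \<circ> id \<circ> r" M f 1]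
      that real_distribution_node M conv by simp
  \<comment> \<open>A bounded continuous function vanishing exactly on the unit interval: its
    integral is 0 along the sequence, hence also in the limit, which confines \<open>M\<close> to
    that interval.\<close>
  define h where "h x = min 1 (max 0 (x - 1) + max 0 (- x))" for x :: real
  have [measurable]: "h \<in> borel_measurable borel" unfolding h_def by measurable
  have h_nonneg: "h x \<ge> 0" for x by (auto simp: h_def)
  have h0: "h x = 0 \<longleftrightarrow> x \<in> {0..1}" for x by (auto simp: h_def min_def max_def)
  have hcont: "isCont h x" for x unfolding h_def by (intro continuous_intros)
  have hle: "\<bar>h x\<bar> \<le> 1" for x by (auto simp: h_def)
  have "integral\<^sup>L (node_measure (r n)) h = 0" for n
    by (subst integral_node, simp, rule sum.neutral) (auto simp: h0 divide_le_eq)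
  then have "integral\<^sup>L M h = 0"
    using limit[of h, OF hcont hle] by (simp add: LIMSEQ_const_iff)
  moreover have "integrable M h"
    using hle by (intro M.integrable_const_bound[where B=1]) auto
  ultimately have "AE x in M. h x = 0"
    using integral_nonneg_eq_0_iff_AE[of M h] h_nonneg by auto
  then have AE01: "AE x in M. x \<in> {0..1}" by (simp only: h0)
  have moment: "(\<integral>x. x ^ j \<partial>M) = L ([:0, 1:] ^ j)" for j
  proof -
    \<comment> \<open>Weak convergence tests only bounded functions; the clamped power agrees with
      the power at all nodes and almost everywhere for \<open>M\<close>.\<close>
    define f where "f x = (max 0 (min 1 x)) ^ j" for x :: real
    have [measurable]: "f \<in> borel_measurable borel" unfolding f_def by measurable
    have "(\<integral>x. x ^ j \<partial>M) = integral\<^sup>L M f"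
      using AE01 by (intro integral_cong_AE) (auto simp: f_def)
    moreover have "(\<lambda>n. integral\<^sup>L (node_measure (r n)) f) \<longlonglongrightarrow> integral\<^sup>L M f"
    proof (rule limit)
      show "isCont f x" for x unfolding f_def by (intro continuous_intros)
      show "\<bar>f x\<bar> \<le> 1" for x
        using power_le_one[of "max 0 (min 1 x)" j] by (auto simp: f_def)
    qed
    moreover have "integral\<^sup>L (node_measure n) f = (\<Sum>k\<le>n. (real k / real n) ^ j * weight n k)" for n
    proof (subst integral_node, simp, rule sum.cong[OF refl])
      fix k assume "k \<in> {..n}"
      then have "real k / real n \<le> 1" by (auto simp: divide_le_eq)
      then show "f (real k / real n) * weight n k = (real k / real n) ^ j * weight n k"
        by (simp add: f_def)
    qed
    then have "(\<lambda>n. integral\<^sup>L (node_measure (r n)) f) \<longlonglongrightarrow> L ([:0, 1:] ^ j)"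
      using LIMSEQ_subseq_LIMSEQ[OF node_moment_tendsto[of j] r] by (simp add: o_def)
    ultimately show ?thesis using LIMSEQ_unique by metis
  qed
  have intpow: "integrable M (\<lambda>x. x ^ j)" for j
    using AE01 by (intro M.integrable_const_bound[where B=1]) (auto simp: power_le_one)
  have "(\<integral>x. poly p x \<partial>M) = L p" for p
  proof -
    have "(\<integral>x. poly p x \<partial>M) = (\<Sum>i\<le>degree p. coeff p i * L ([:0, 1:] ^ i))"
      by (simp add: poly_altdef intpow moment)
    also have "\<dots> = L (\<Sum>i\<le>degree p. monom (coeff p i) i)"
      by (simp add: L_sum monom_altdef L_smult)
    finally show ?thesis by (simp add: poly_as_sum_of_monoms)
  qed
  then show ?thesis using AE01 M.prob_space_axioms M.events_eq_borel by blast
qed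

end

lemma ex_representing_measure_interval:
  fixes L :: "real poly \<Rightarrow> real"
  assumes "a > 0"
    and add: "\<And>p q. L (p + q) = L p + L q"
    and smult: "\<And>c p. L (smult c p) = c * L p"
    and nonneg: "\<And>k l. L ([:a, 1:] ^ k * [:a, -1:] ^ l) \<ge> 0"
  shows "\<exists>M. finite_measure M \<and> sets M = sets borel \<and> (AE x in M. x \<in> {-a..a}) \<and>
     (\<forall>p. (\<integral>x. poly p x \<partial>M) = L p)"
proof -
  \<comment> \<open>The affine map \<open>q\<close> takes the interval from \<open>- a\<close> to
    \<open>a\<close> onto the unit interval, and \<open>r\<close> is its inverse. Substituting
    \<open>q\<close> turns X and 1 - X into (a + X) / (2a) and (a - X) / (2a).\<close>
  define q where "q = [:1 / 2, 1 / (2 * a):]"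
  define r where "r = [:- a, 2 * a:]"
  define T where "T p = L (pcompose p q)" for p
  have T_add: "T (p + p') = T p + T p'" and T_smult: "T (smult c p) = c * T p" for p p' c
    by (simp_all add: T_def pcompose_add pcompose_smult add smult)
  have pow: "pcompose (p ^ n) p' = pcompose p p' ^ n" for p p' :: "real poly" and n
    by (induction n) (simp_all add: pcompose_mult pcompose_1)
  have T_nonneg: "T ([:0, 1:] ^ k * [:1, -1:] ^ l) \<ge> 0" for k l
  proof -
    have 1: "pcompose [:0, 1:] q = smult (1 / (2 * a)) [:a, 1:]"
      "pcompose [:1, -1:] q = smult (1 / (2 * a)) [:a, -1:]"
      using \<open>a > 0\<close> by (simp_all add: q_def pcompose_pCons)
    have "T ([:0, 1:] ^ k * [:1, -1:] ^ l) = (1 / (2 * a)) ^ k * (1 / (2 * a)) ^ l * L ([:a, 1:] ^ k * [:a, -1:] ^ l)"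
    proof -
      have "smult c A ^ k * smult c B ^ l = smult (c ^ k * c ^ l) (A ^ k * B ^ l)" for c and A B :: "real poly"
        by (simp add: smult_power mult.commute)
      then show ?thesis unfolding T_def pcompose_mult pow 1 by (simp only: smult)
    qed
    also have "\<dots> \<ge> 0" using \<open>a > 0\<close> nonneg by (intro mult_nonneg_nonneg) auto
    finally show ?thesis .
  qed
  have qr: "pcompose r q = [:0, 1:]"
    using \<open>a > 0\<close> by (simp add: q_def r_def pcompose_pCons)
  have L_T: "L p = T (pcompose p r)" for p
    unfolding T_def by (simp only: pcompose_assoc[symmetric] qr pcompose_idR)
  have T1: "T 1 = L 1" by (simp add: T_def pcompose_1)
  have "L 1 \<ge> 0" using nonneg[of 0 0] by simp
  show ?thesis
  proof (cases "L 1 = 0")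
    case True
    \<comment> \<open>Normalisation is impossible here, but X^j is the sum of X^j (1 - X) and
      X^(j+1), both of nonnegative value, so all moments vanish by induction.\<close>
    have Tx: "T ([:0, 1:] ^ j) = 0" for j
    proof (induction j)
      case 0 show ?case using T1 True by simp
    next
      case (Suc j)
      have eq: "[:0, 1:] ^ j * [:1, -1:] ^ 1 + [:0, 1:] ^ Suc j = ([:0, 1:] ^ j :: real poly)"
        by simp
      have "T ([:0, 1:] ^ j * [:1, -1:] ^ 1) + T ([:0, 1:] ^ Suc j) = T ([:0, 1:] ^ j)"
        by (simp only: T_add[symmetric] eq)
      moreover have "T ([:0, 1:] ^ Suc j) \<ge> 0" using T_nonneg[of "Suc j" 0] by simp
      ultimately show ?case using Suc T_nonneg[of j 1] by linarith
    qed
    have T0: "T p = 0" for p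
    proof -
      have "T (\<Sum>i\<in>A. f i) = (\<Sum>i\<in>A. T (f i))" for A :: "nat set" and f
      proof -
        have "T 0 = 0" using T_smult[of 0 0] by simp
        then show ?thesis by (induction A rule: infinite_finite_induct) (auto simp: T_add)
      qed
      then have "T (\<Sum>i\<le>degree p. monom (coeff p i) i) = 0"
        by (simp add: monom_altdef T_smult Tx)
      then show ?thesis by (simp add: poly_as_sum_of_monoms)
    qed
    have "finite_measure (null_measure borel :: real measure)"
      by (intro finite_measureI) simp
    moreover have "AE x in (null_measure borel :: real measure). x \<in> {-a..a}"
      by (rule AE_I[where N=UNIV]) auto
    ultimately show ?thesis by (intro exI[of _ "null_measure borel"]) (auto simp: L_T T0)
  next
    case False
    then have pos: "L 1 > 0" using \<open>L 1 \<ge> 0\<close> by simp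
    interpret hausdorff_functional "\<lambda>p. T p / L 1"
      by unfold_locales (use pos T_nonneg T1 in \<open>auto simp: T_add T_smult add_divide_distrib\<close>)
    obtain M where M: "prob_space M" "sets M = sets borel" "AE x in M. x \<in> {0..1}"
      "\<And>p. (\<integral>x. poly p x \<partial>M) = T p / L 1"
      using ex_representing_measure by auto
    interpret M: prob_space M by fact
    note [measurable_cong] = M(2)
    define N where "N = density (distr M borel (poly r)) (\<lambda>_. ennreal (L 1))"
    have [simp]: "sets N = sets borel" by (simp add: N_def)
    have [measurable]: "poly p \<in> borel_measurable borel" for p :: "real poly"
      by (intro borel_measurable_continuous_onI continuous_intros)
    have "finite_measure N"
    proof (rule finite_measureI)
      have "emeasure N (space N) = ennreal (L 1) * emeasure (distr M borel (poly r)) UNIV"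
        unfolding N_def by (simp add: emeasure_density nn_integral_cmult)
      also have "\<dots> \<noteq> \<infinity>"
        by (subst emeasure_distr) (auto simp: ennreal_mult_eq_top_iff M.emeasure_eq_measure)
      finally show "emeasure N (space N) \<noteq> \<infinity>" .
    qed
    moreover have "AE x in N. x \<in> {-a..a}"
    proof -
      have "AE x in distr M borel (poly r). x \<in> {-a..a}"
        using M(3) \<open>a > 0\<close> by (subst AE_distr_iff) (auto simp: r_def field_simps)
      then show ?thesis unfolding N_def using pos by (subst AE_density) auto
    qed
    moreover have "(\<integral>x. poly p x \<partial>N) = L p" for p
    proof -
      have "(\<integral>x. poly p x \<partial>N) = (\<integral>x. L 1 * poly p (poly r x) \<partial>M)"
        unfolding N_def using pos
        by (subst integral_density) (auto simp: integral_distr)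
      also have "\<dots> = L 1 * (\<integral>x. poly (pcompose p r) x \<partial>M)"
        by (simp add: poly_pcompose)
      also have "\<dots> = L p" using pos by (simp add: M(4) L_T)
      finally show ?thesis .
    qed
    ultimately show ?thesis by (intro exI[of _ N]) auto
  qed
qed


section \<open>Polynomials of a selfadjoint operator\<close>

text \<open>Horner evaluation of a polynomial at an operator. Real coefficients keep
  \<open>poly_op C p\<close> symmetric.\<close>

definition poly_op :: "('a::real_vector \<Rightarrow> 'a) \<Rightarrow> real poly \<Rightarrow> 'a \<Rightarrow> 'a" where
  "poly_op C p = fold_coeffs (\<lambda>c f x. c *\<^sub>R x + C (f x)) p (\<lambda>x. 0)"

context
  fixes C :: "'a::real_normed_vector \<Rightarrow> 'a"
  assumes C: "bounded_linear C"
begin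

interpretation C: bounded_linear C by (rule C)

lemma poly_op_0 [simp]: "poly_op C 0 x = 0"
  by (simp add: poly_op_def)

lemma poly_op_pCons [simp]: "poly_op C (pCons c p) x = c *\<^sub>R x + C (poly_op C p x)"
proof (cases "c = 0 \<and> p = 0")
  case True
  then show ?thesis by (simp add: C.zero)
next
  case False
  then have "fold_coeffs f (pCons c p) = f c \<circ> fold_coeffs f p" for f :: "real \<Rightarrow> ('a \<Rightarrow> 'a) \<Rightarrow> 'a \<Rightarrow> 'a"
    by (cases "c = 0") auto
  then show ?thesis by (simp add: poly_op_def)
qed

lemma poly_op_1 [simp]: "poly_op C 1 x = x"
  by (simp add: one_pCons C.zero)

lemma poly_op_add: "poly_op C (p + q) x = poly_op C p x + poly_op C q x"
  by (induction p q rule: poly_induct2) (simp_all add: C.add algebra_simps)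

lemma poly_op_smult: "poly_op C (smult c p) x = c *\<^sub>R poly_op C p x"
  by (induction p) (simp_all add: C.scaleR algebra_simps)

lemma poly_op_minus: "poly_op C (- p) x = - poly_op C p x"
  using poly_op_smult[of "-1" p x] by simp

lemma poly_op_diff: "poly_op C (p - q) x = poly_op C p x - poly_op C q x"
  using poly_op_add[of p "- q" x] by (simp add: poly_op_minus)

lemma poly_op_mult: "poly_op C (p * q) x = poly_op C p (poly_op C q x)"
  by (induction p) (simp_all add: poly_op_add poly_op_smult)

lemma poly_op_commute:
  assumes "linear T" "\<And>x. T (C x) = C (T x)"
  shows "T (poly_op C p x) = poly_op C p (T x)"
  by (induction p) (simp_all add: linear_0 linear_add linear_scale assms)

lemma bounded_linear_poly_op: "bounded_linear (poly_op C p)"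
proof (induction p)
  case 0
  have "poly_op C 0 = (\<lambda>x. 0)" by auto
  then show ?case by simp
next
  case (pCons c p)
  have "poly_op C (pCons c p) = (\<lambda>x. c *\<^sub>R x + C (poly_op C p x))" by auto
  then show ?case
    using pCons by (auto intro!: bounded_linear_add bounded_linear_compose[OF C] bounded_linear_scaleR_right)
qed

end

lemma poly_op_symmetric:
  fixes C :: "'a::real_inner \<Rightarrow> 'a"
  assumes "bounded_linear C" "\<And>x y. inner (C x) y = inner x (C y)"
  shows "inner (poly_op C p x) y = inner x (poly_op C p y)"
proof -
  have comm: "C (poly_op C p x) = poly_op C p (C x)" for p x
    by (rule poly_op_commute[OF assms(1)]) (auto intro: bounded_linear.linear assms)
  show ?thesis
    by (induction p arbitrary: x y) (simp_all add: assms inner_add_left inner_add_right flip: comm)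
qed

locale selfadjoint_operator =
  fixes C :: "'a::complex_hilbert_space \<Rightarrow> 'a" and a :: real
  assumes selfadjoint: "bounded_selfadjoint C"
    and bound_pos: "a > 0"
    and bound: "norm (C x) \<le> a * norm x"
begin

lemma bounded_linear: "bounded_linear C"
  using selfadjoint by (simp add: bounded_selfadjoint_def)

sublocale bounded_linear C by (rule bounded_linear)

lemma scaleC: "C (c *\<^sub>C x) = c *\<^sub>C C x"
  using selfadjoint by (simp add: bounded_selfadjoint_def)

lemma symmetric: "inner (C x) y = inner x (C y)"
  using selfadjoint by (simp add: bounded_selfadjoint_def inner_eq_Re_cinner)

lemma inner_bound: "\<bar>inner x (C x)\<bar> \<le> a * inner x x"
proof -
  have "\<bar>inner x (C x)\<bar> \<le> norm x * norm (C x)" by (rule Cauchy_Schwarz_ineq2)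
  also have "\<dots> \<le> norm x * (a * norm x)" by (intro mult_left_mono bound) simp
  finally show ?thesis by (simp add: power2_norm_eq_inner[symmetric] power2_eq_square mult_ac)
qed

lemmas op_simps = poly_op_add[OF bounded_linear] poly_op_diff[OF bounded_linear]
  poly_op_smult[OF bounded_linear] poly_op_mult[OF bounded_linear] poly_op_1[OF bounded_linear]

lemmas op_symmetric = poly_op_symmetric[OF bounded_linear symmetric]

lemma op_shift: "inner x (poly_op C (p * q * p) x) = inner (poly_op C p x) (poly_op C q (poly_op C p x))"
  by (simp add: op_simps op_symmetric)

lemma positive_lower: "inner x (poly_op C [:a, 1:] x) \<ge> 0"
  and positive_upper: "inner x (poly_op C [:a, -1:] x) \<ge> 0"
  using inner_bound[of x]
  by (auto simp: poly_op_pCons[OF bounded_linear] poly_op_0[OF bounded_linear] zero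
      inner_add_right inner_diff_right inner_scaleR_right neg abs_le_iff scaleR)

text \<open>Products of the commuting positive operators \<open>a + C\<close> and \<open>a - C\<close> are positive: pulling out
  squares leaves at most one factor of each, and \<open>2 a (a + C) (a - C)\<close> equals
  \<open>(a + C) (a - C) (a + C) + (a - C) (a + C) (a - C)\<close>.\<close>

lemma positive_product: "inner x (poly_op C ([:a, 1:] ^ k * [:a, -1:] ^ l) x) \<ge> 0"
proof -
  define P N where "P = [:a, 1:]" and "N = [:a, -1:]"
  have PN: "inner v (poly_op C (P * N) v) \<ge> 0" for v
  proof -
    have "smult (2 * a) (P * N) = P * N * P + N * P * N"
      by (simp add: P_def N_def algebra_simps)
    then have "2 * a * inner v (poly_op C (P * N) v) = inner v (poly_op C (P * N * P + N * P * N) v)"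
      by (simp flip: op_simps(3) inner_scaleR_right)
    also have "\<dots> \<ge> 0"
      unfolding op_simps(1) inner_add_right op_shift
      using positive_lower positive_upper by (simp add: P_def N_def)
    finally show ?thesis using bound_pos by (simp add: zero_le_mult_iff)
  qed
  have base: "inner v (poly_op C (P ^ (k mod 2) * N ^ (l mod 2)) v) \<ge> 0" for v
    using PN[of v] positive_lower[of v] positive_upper[of v]
    by (cases "even k"; cases "even l") (auto simp: P_def N_def odd_iff_mod_2_eq_one op_simps(5))
  have half: "p ^ k = p ^ (k div 2) * p ^ (k mod 2) * p ^ (k div 2)" for k and p :: "real poly"
  proof -
    have "k = k div 2 + k mod 2 + k div 2" by presburger
    then show ?thesis by (metis power_add)
  qed
  have "P ^ k * N ^ l = (P ^ (k div 2) * N ^ (l div 2)) * (P ^ (k mod 2) * N ^ (l mod 2)) * (P ^ (k div 2) * N ^ (l div 2))"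
    by (subst half[of P k], subst half[of N l]) (simp only: mult_ac)
  then show ?thesis
    unfolding P_def[symmetric] N_def[symmetric] by (simp only: op_shift base)
qed

lemma ex_vector_measure:
  "\<exists>M. finite_measure M \<and> sets M = sets borel \<and> (AE t in M. t \<in> {-a..a}) \<and>
     (\<forall>p. (\<integral>t. poly p t \<partial>M) = inner x (poly_op C p x))"
  by (rule ex_representing_measure_interval[OF bound_pos])
     (simp_all only: op_simps(1,3) inner_add_right inner_scaleR_right positive_product)

definition \<mu> :: "'a \<Rightarrow> real measure" where
  "\<mu> x = (SOME M. finite_measure M \<and> sets M = sets borel \<and> (AE t in M. t \<in> {-a..a}) \<and>
     (\<forall>p. (\<integral>t. poly p t \<partial>M) = inner x (poly_op C p x)))"

lemma finite_\<mu>: "finite_measure (\<mu> x)"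
  and sets_\<mu> [simp, measurable_cong]: "sets (\<mu> x) = sets borel"
  and AE_\<mu>: "AE t in \<mu> x. t \<in> {-a..a}"
  and integral_poly_\<mu>: "(\<integral>t. poly p t \<partial>\<mu> x) = inner x (poly_op C p x)"
  using someI_ex[OF ex_vector_measure[of x]] unfolding \<mu>_def[symmetric] by auto

text \<open>The isometry from L2 of \<open>\<mu> x\<close> into the Hilbert space, on polynomials.
  It lets spectral projections be reached as limits of polynomials in \<open>C\<close>.\<close>

lemma integral_poly_square_\<mu>: "(\<integral>t. (poly p t)\<^sup>2 \<partial>\<mu> x) = (norm (poly_op C p x))\<^sup>2"
  using integral_poly_\<mu>[where p="p * p" and x=x]
  by (simp add: power2_eq_square op_simps op_symmetric[symmetric] dot_square_norm)

end

section \<open>Approximation of indicator functions by polynomials\<close>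

lemma ex_poly_near_continuous:
  fixes f :: "real \<Rightarrow> real"
  assumes "continuous_on {a..b} f" "e > 0"
  shows "\<exists>p. \<forall>x\<in>{a..b}. \<bar>f x - poly p x\<bar> < e"
proof -
  obtain g where g: "real_polynomial_function g" "\<And>x. x \<in> {a..b} \<Longrightarrow> \<bar>f x - g x\<bar> < e"
    using Stone_Weierstrass_real_polynomial_function[OF compact_Icc assms] by metis
  then obtain c n where "g = (\<lambda>x. \<Sum>i\<le>n. c i * x ^ i)"
    unfolding real_polynomial_function_iff_sum by auto
  then have "g = poly (\<Sum>i\<le>n. monom (c i) i)"
    by (auto simp: poly_sum poly_monom)
  then show ?thesis using g(2) by (intro exI[of _ "\<Sum>i\<le>n. monom (c i) i"]) simp
qed

lemma compact_open_sandwich: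
  fixes M :: "real measure"
  assumes "finite_measure M" "sets M = sets borel" "B \<in> sets borel" "e > 0"
  shows "\<exists>K U. compact K \<and> open U \<and> K \<subseteq> B \<and> B \<subseteq> U \<and> measure M (U - K) < e"
proof -
  interpret finite_measure M by fact
  note [measurable_cong] = assms(2)
  note [measurable] = assms(3)
  have fin: "emeasure M (space M) \<noteq> \<infinity>" by simp
  \<comment> \<open>The second alternative covers sets of mass below \<open>e / 2\<close>: there
    \<open>ennreal\<close> truncates the negative number to 0, and the strict inequality could
    fail.\<close>
  have "(SUP K \<in> {K. K \<subseteq> B \<and> compact K}. emeasure M K) > ennreal (measure M B - e / 2)
    \<or> measure M B - e / 2 < 0"
    unfolding inner_regular[OF assms(2) fin assms(3), symmetric] using \<open>e > 0\<close>
    by (auto simp: emeasure_eq_measure intro!: ennreal_lessI)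
  then obtain K where K: "compact K" "K \<subseteq> B" "measure M B - e / 2 < measure M K"
  proof
    assume "ennreal (measure M B - e / 2) < (SUP K \<in> {K. K \<subseteq> B \<and> compact K}. emeasure M K)"
    then obtain K where "K \<subseteq> B" "compact K" "ennreal (measure M B - e / 2) < emeasure M K"
      unfolding less_SUP_iff by auto
    then show ?thesis
      using that[of K] by (metis emeasure_eq_measure ennreal_leI leD not_less)
  next
    assume "measure M B - e / 2 < 0"
    then show ?thesis using that[of "{}"] by simp
  qed
  have "(INF U \<in> {U. B \<subseteq> U \<and> open U}. emeasure M U) < ennreal (measure M B + e / 2)"
    unfolding outer_regular[OF assms(2) fin assms(3), symmetric] using \<open>e > 0\<close>
    by (auto simp: emeasure_eq_measure intro!: ennreal_lessI)
  then obtain U where U: "B \<subseteq> U" "open U" "emeasure M U < ennreal (measure M B + e / 2)"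
    unfolding INF_less_iff by auto
  then have "measure M U < measure M B + e / 2"
    by (metis emeasure_eq_measure ennreal_leI leD not_less)
  moreover have "measure M (U - K) = measure M U - measure M K"
    using K U by (intro finite_measure_Diff) (auto simp: assms(2) borel_compact)
  ultimately show ?thesis using K U by (intro exI[of _ K] exI[of _ U]) auto
qed

lemma poly_borel_measurable [measurable]: "poly p \<in> borel_measurable borel"
  for p :: "real poly"
  by (intro borel_measurable_continuous_onI continuous_intros)

lemma poly_bounded_Icc:
  fixes p :: "real poly"
  shows "\<exists>K>0. \<forall>t\<in>{a..b}. \<bar>poly p t\<bar> \<le> K"
proof -
  have "bounded (poly p ` {a..b})"
    by (intro compact_imp_bounded compact_continuous_image continuous_intros) auto
  then show ?thesis unfolding bounded_pos by auto
qed

text \<open>One polynomial has to serve several measures, since later arguments compare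
  \<open>poly_op C p\<close> on several vectors at once. The uniform bound turns closeness in L1
  into closeness in L2. The union of the compact sets and the intersection of the open sets form a
  sandwich that is good for every \<open>M i\<close>.\<close>

lemma ex_poly_near_indicator:
  fixes M :: "'i \<Rightarrow> real measure"
  assumes "finite I" and M: "\<And>i. i \<in> I \<Longrightarrow> finite_measure (M i)" "\<And>i. i \<in> I \<Longrightarrow> sets (M i) = sets borel"
    "\<And>i. i \<in> I \<Longrightarrow> AE t in M i. t \<in> {-a..a}"
    and B: "B \<in> sets borel" and "e > 0"
  shows "\<exists>p. (\<forall>t\<in>{-a..a}. \<bar>poly p t\<bar> \<le> 2) \<and> (\<forall>i\<in>I. (\<integral>t. \<bar>poly p t - indicator B t\<bar> \<partial>M i) < e)"
proof -
  have "\<forall>i\<in>I. \<exists>KU. compact (fst KU) \<and> open (snd KU) \<and> fst KU \<subseteq> B \<and> B \<subseteq> snd KU \<and>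
      measure (M i) (snd KU - fst KU) < e / 2"
    using compact_open_sandwich[OF M(1,2) B, of _ "e / 2"] \<open>e > 0\<close> by auto
  then obtain KU where KU: "\<And>i. i \<in> I \<Longrightarrow> compact (fst (KU i)) \<and> open (snd (KU i)) \<and>
      fst (KU i) \<subseteq> B \<and> B \<subseteq> snd (KU i) \<and> measure (M i) (snd (KU i) - fst (KU i)) < e / 2"
    by (metis (no_types, lifting))
  define K U where "K = (\<Union>i\<in>I. fst (KU i))" and "U = (\<Inter>i\<in>I. snd (KU i))"
  have "compact K" "open U" using KU \<open>finite I\<close> unfolding K_def U_def by auto
  have sub: "K \<subseteq> B" "B \<subseteq> U" using KU unfolding K_def U_def by blast+
  obtain f :: "real \<Rightarrow> real" where f: "continuous_on UNIV f"
    "\<And>x. f x \<in> closed_segment 1 0" "\<And>x. x \<in> K \<Longrightarrow> f x = 1" "\<And>x. x \<in> - U \<Longrightarrow> f x = 0"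
  proof (rule Urysohn[of K "- U" "1::real" 0])
    show "closed K" "closed (- U)" "K \<inter> - U = {}"
      using \<open>compact K\<close> \<open>open U\<close> sub by (auto intro: compact_imp_closed)
  qed blast
  have f01: "0 \<le> f x" "f x \<le> 1" for x
    using f(2)[of x] by (auto simp: closed_segment_eq_real_ivl)
  \<comment> \<open>The summand 1 keeps the denominator of \<open>d\<close> positive. In
    \<open>d\<close>, the minimum with 1 gives the bound 2 for the polynomial because
    \<open>f\<close> is at most 1, and \<open>e / (2 * m)\<close> uses up the half of
    \<open>e\<close> left by the sandwich.\<close>
  define m where "m = 1 + (\<Sum>i\<in>I. measure (M i) UNIV)"
  have "m \<ge> 1" unfolding m_def by (simp add: sum_nonneg)
  define d where "d = min 1 (e / (2 * m))"
  have "d > 0" using \<open>e > 0\<close> \<open>m \<ge> 1\<close> by (simp add: d_def)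
  obtain p where p: "\<And>t. t \<in> {-a..a} \<Longrightarrow> \<bar>f t - poly p t\<bar> < d"
    using ex_poly_near_continuous[OF continuous_on_subset[OF f(1)] \<open>d > 0\<close>] by blast
  have p2: "\<bar>poly p t\<bar> \<le> 2" if "t \<in> {-a..a}" for t
    using p[OF that] f01[of t] unfolding d_def by linarith
  have "(\<integral>t. \<bar>poly p t - indicator B t\<bar> \<partial>M i) < e" if i: "i \<in> I" for i
  proof -
    interpret finite_measure "M i" using M(1)[OF i] .
    note [measurable_cong] = M(2)[OF i]
    note [measurable] = B
    have [measurable]: "snd (KU i) \<in> sets borel" "fst (KU i) \<in> sets borel"
      using KU[OF i] by (auto intro: borel_compact)
    have "(\<integral>t. \<bar>poly p t - indicator B t\<bar> \<partial>M i) \<le> (\<integral>t. d + indicator (snd (KU i) - fst (KU i)) t \<partial>M i)"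
    proof (rule integral_mono_AE)
      show "integrable (M i) (\<lambda>t. \<bar>poly p t - indicator B t\<bar>)"
      proof (rule integrable_const_bound[where B=3])
        show "AE t in M i. norm \<bar>poly p t - indicator B t\<bar> \<le> 3"
          using M(3)[OF i]
        proof eventually_elim
          case (elim t)
          then show ?case using p2[OF elim] by (auto split: split_indicator)
        qed
      qed measurable
      show "integrable (M i) (\<lambda>t. d + indicator (snd (KU i) - fst (KU i)) t)"
        by (intro integrable_const_bound[where B="d + 1"]) (use \<open>d > 0\<close> in \<open>auto split: split_indicator\<close>)
      show "AE t in M i. \<bar>poly p t - indicator B t\<bar> \<le> d + indicator (snd (KU i) - fst (KU i)) t"
        using M(3)[OF i]
      proof eventually_elim
        case (elim t)
        have "\<bar>f t - indicator B t\<bar> \<le> (indicator (snd (KU i) - fst (KU i)) t :: real)"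
          using f01[of t] f(3,4)[of t] sub KU[OF i] i unfolding K_def U_def
          by (auto split: split_indicator)
        then show ?case using p[OF elim] by linarith
      qed
    qed
    also have "\<dots> = d * measure (M i) UNIV + measure (M i) (snd (KU i) - fst (KU i))"
      using sets_eq_imp_space_eq[OF M(2)[OF i]] by (simp add: emeasure_eq_measure)
    also have "measure (M i) UNIV \<le> (\<Sum>i\<in>I. measure (M i) UNIV)"
      using i \<open>finite I\<close> by (intro member_le_sum) auto
    then have "d * measure (M i) UNIV \<le> d * m"
      using \<open>d > 0\<close> unfolding m_def by (intro mult_left_mono) auto
    also have "d * m \<le> e / 2"
      using \<open>m \<ge> 1\<close> unfolding d_def by (auto simp: min_def field_simps)
    finally show ?thesis using KU[OF i] by simp
  qed
  then show ?thesis using p2 by blast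
qed

section \<open>From polynomials to Borel sets: vectors carried by a set\<close>

context selfadjoint_operator
begin

lemma space_\<mu> [simp]: "space (\<mu> x) = UNIV"
  using sets_eq_imp_space_eq[OF sets_\<mu>] by simp

lemma integrable_\<mu>:
  fixes f :: "real \<Rightarrow> real"
  assumes [measurable]: "f \<in> borel_measurable borel" and "\<And>t. t \<in> {-a..a} \<Longrightarrow> \<bar>f t\<bar> \<le> K"
  shows "integrable (\<mu> x) f"
proof -
  interpret finite_measure "\<mu> x" by (rule finite_\<mu>)
  show ?thesis
  proof (rule integrable_const_bound[where B=K])
    show "AE t in \<mu> x. norm (f t) \<le> K"
      using AE_\<mu>[of x] by eventually_elim (use assms(2) in auto)
  qed measurable
qed

lemma measure_\<mu>_UNIV: "measure (\<mu> x) UNIV = (norm x)\<^sup>2"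
proof -
  interpret finite_measure "\<mu> x" by (rule finite_\<mu>)
  have "(\<integral>t. (poly 1 t)\<^sup>2 \<partial>\<mu> x) = (norm x)\<^sup>2"
    by (simp only: integral_poly_square_\<mu> op_simps)
  then show ?thesis by simp
qed

lemma measure_\<mu>_le: "measure (\<mu> x) B \<le> (norm x)\<^sup>2"
proof -
  interpret finite_measure "\<mu> x" by (rule finite_\<mu>)
  show ?thesis using bounded_measure[of B] by (simp add: measure_\<mu>_UNIV)
qed

definition deviation :: "real poly \<Rightarrow> real set \<Rightarrow> 'a \<Rightarrow> real" where
  "deviation p B x = (\<integral>t. \<bar>poly p t - indicator B t\<bar> \<partial>\<mu> x)"

lemma ex_small_deviation:
  assumes "finite F" "B \<in> sets borel" "e > 0"
  shows "\<exists>p. (\<forall>t\<in>{-a..a}. \<bar>poly p t\<bar> \<le> 2) \<and> (\<forall>x\<in>F. deviation p B x < e)"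
  unfolding deviation_def
  by (rule ex_poly_near_indicator[OF assms(1) finite_\<mu> sets_\<mu> AE_\<mu> assms(2,3)])

text \<open>The indicator is its own square, so p^2 - 1_B factors as (p + 1_B) (p - 1_B) with first
  factor at most 3. This is the origin of the factor 3 in the estimates below.\<close>

lemma
  assumes p: "\<And>t. t \<in> {-a..a} \<Longrightarrow> \<bar>poly p t\<bar> \<le> 2" and [measurable]: "B \<in> sets borel"
    "w \<in> borel_measurable borel" and w: "\<And>t. t \<in> {-a..a} \<Longrightarrow> \<bar>w t\<bar> \<le> K"
  shows weighted_deviation:
      "\<bar>(\<integral>t. (poly p t)\<^sup>2 * w t \<partial>\<mu> x) - (\<integral>t. indicator B t * w t \<partial>\<mu> x)\<bar> \<le> 3 * K * deviation p B x"
    and square_deviation: "(\<integral>t. (poly p t - indicator B t)\<^sup>2 \<partial>\<mu> x) \<le> 3 * deviation p B x"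
proof -
  have "K \<ge> 0" using w[of 0] bound_pos by auto
  have sq: "(poly p t)\<^sup>2 \<le> 4" if "t \<in> {-a..a}" for t
    using power_mono[OF p[OF that] abs_ge_zero, of 2] by simp
  have i1: "integrable (\<mu> x) (\<lambda>t. (poly p t)\<^sup>2 * w t)"
    by (rule integrable_\<mu>[where K="4 * K"]) (auto simp: abs_mult intro!: mult_mono sq w)
  have i2: "integrable (\<mu> x) (\<lambda>t. indicator B t * w t)"
    by (rule integrable_\<mu>[where K=K]) (use w \<open>K \<ge> 0\<close> in \<open>auto split: split_indicator\<close>)
  have ind: "\<bar>poly p t - indicator B t\<bar> \<le> 3" if "t \<in> {-a..a}" for t
    using p[OF that] by (auto split: split_indicator)
  have i3: "integrable (\<mu> x) (\<lambda>t. \<bar>poly p t - indicator B t\<bar>)"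
    by (rule integrable_\<mu>[where K=3]) (use ind in auto)
  have i4: "integrable (\<mu> x) (\<lambda>t. (poly p t - indicator B t)\<^sup>2)"
    by (rule integrable_\<mu>[where K=9]) (use power_mono[OF ind abs_ge_zero, of _ 2] in auto)
  have "\<bar>(\<integral>t. (poly p t)\<^sup>2 * w t \<partial>\<mu> x) - (\<integral>t. indicator B t * w t \<partial>\<mu> x)\<bar>
    = \<bar>\<integral>t. (poly p t)\<^sup>2 * w t - indicator B t * w t \<partial>\<mu> x\<bar>"
    using i1 i2 by simp
  also have "\<dots> \<le> (\<integral>t. \<bar>(poly p t)\<^sup>2 * w t - indicator B t * w t\<bar> \<partial>\<mu> x)"
    by (rule integral_abs_bound)
  also have "\<dots> \<le> (\<integral>t. 3 * K * \<bar>poly p t - indicator B t\<bar> \<partial>\<mu> x)"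
  proof (rule integral_mono_AE)
    show "AE t in \<mu> x. \<bar>(poly p t)\<^sup>2 * w t - indicator B t * w t\<bar> \<le> 3 * K * \<bar>poly p t - indicator B t\<bar>"
      using AE_\<mu>[of x]
    proof eventually_elim
      case (elim t)
      have "(poly p t)\<^sup>2 - indicator B t = (poly p t + indicator B t) * (poly p t - indicator B t)"
        by (simp add: power2_eq_square algebra_simps split: split_indicator)
      then have "(poly p t)\<^sup>2 * w t - indicator B t * w t
          = (poly p t + indicator B t) * w t * (poly p t - indicator B t)"
        by (metis (no_types, lifting) left_diff_distrib mult.assoc mult.commute)
      moreover have "\<bar>(poly p t + indicator B t) * w t\<bar> \<le> 3 * K"
        unfolding abs_mult using p[OF elim] w[OF elim]
        by (intro mult_mono) (auto split: split_indicator)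
      ultimately show ?case by (simp add: abs_mult mult_right_mono)
    qed
  qed (use i1 i2 i3 in auto)
  finally show "\<bar>(\<integral>t. (poly p t)\<^sup>2 * w t \<partial>\<mu> x) - (\<integral>t. indicator B t * w t \<partial>\<mu> x)\<bar> \<le> 3 * K * deviation p B x"
    using i3 by (simp add: deviation_def)
  have "(\<integral>t. (poly p t - indicator B t)\<^sup>2 \<partial>\<mu> x) \<le> (\<integral>t. 3 * \<bar>poly p t - indicator B t\<bar> \<partial>\<mu> x)"
  proof (rule integral_mono_AE)
    show "AE t in \<mu> x. (poly p t - indicator B t)\<^sup>2 \<le> 3 * \<bar>poly p t - indicator B t\<bar>"
      using AE_\<mu>[of x]
    proof eventually_elim
      case (elim t)
      have "\<bar>poly p t - indicator B t\<bar> * \<bar>poly p t - indicator B t\<bar> \<le> 3 * \<bar>poly p t - indicator B t\<bar>"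
        by (intro mult_right_mono ind elim) simp
      then show ?case by (simp add: power2_eq_square)
    qed
  qed (use i3 i4 in auto)
  then show "(\<integral>t. (poly p t - indicator B t)\<^sup>2 \<partial>\<mu> x) \<le> 3 * deviation p B x"
    using i3 by (simp add: deviation_def)
qed

lemma norm_poly_op_near:
  assumes "\<And>t. t \<in> {-a..a} \<Longrightarrow> \<bar>poly p t\<bar> \<le> 2" "B \<in> sets borel"
    and q: "\<And>t. t \<in> {-a..a} \<Longrightarrow> (poly q t)\<^sup>2 \<le> K"
  shows "\<bar>(norm (poly_op C p (poly_op C q x)))\<^sup>2 - (\<integral>t. indicator B t * (poly q t)\<^sup>2 \<partial>\<mu> x)\<bar>
    \<le> 3 * K * deviation p B x"
proof -
  have "(norm (poly_op C p (poly_op C q x)))\<^sup>2 = (\<integral>t. (poly p t)\<^sup>2 * (poly q t)\<^sup>2 \<partial>\<mu> x)"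
    using integral_poly_square_\<mu>[where p="p * q" and x=x] by (simp add: op_simps(4) power_mult_distrib)
  moreover have "\<bar>(\<integral>t. (poly p t)\<^sup>2 * (poly q t)\<^sup>2 \<partial>\<mu> x) - (\<integral>t. indicator B t * (poly q t)\<^sup>2 \<partial>\<mu> x)\<bar>
      \<le> 3 * K * deviation p B x"
    by (rule weighted_deviation[OF assms(1,2)]) (use q in auto)
  ultimately show ?thesis by simp
qed

lemma norm_poly_op_near_measure:
  assumes p: "\<And>t. t \<in> {-a..a} \<Longrightarrow> \<bar>poly p t\<bar> \<le> 2" and B: "B \<in> sets borel"
  shows "\<bar>(norm (poly_op C p x))\<^sup>2 - measure (\<mu> x) B\<bar> \<le> 3 * deviation p B x"
proof -
  have "\<bar>(norm (poly_op C p (poly_op C 1 x)))\<^sup>2 - (\<integral>t. indicator B t * (poly 1 t)\<^sup>2 \<partial>\<mu> x)\<bar>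
      \<le> 3 * 1 * deviation p B x"
    by (rule norm_poly_op_near[OF assms]) auto
  then show ?thesis using B by (simp add: op_simps(5))
qed

text \<open>Both sides are limits of the squared norm of \<open>poly_op C p (poly_op C q x)\<close>
  as \<open>p\<close> approaches the indicator of \<open>B\<close> in the measures of
  \<open>x\<close> and of \<open>poly_op C q x\<close>.\<close>

lemma measure_poly_op:
  assumes B: "B \<in> sets borel"
  shows "measure (\<mu> (poly_op C q x)) B = (\<integral>t. indicator B t * (poly q t)\<^sup>2 \<partial>\<mu> x)"
proof -
  obtain K where K: "\<And>t. t \<in> {-a..a} \<Longrightarrow> \<bar>poly q t\<bar> \<le> K"
    using poly_bounded_Icc[where p=q] by blast
  have "K \<ge> 0" using K[of 0] bound_pos by auto
  have q: "(poly q t)\<^sup>2 \<le> K\<^sup>2" if "t \<in> {-a..a}" for t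
    using power_mono[OF K[OF that] abs_ge_zero, of 2] by simp
  define m m' where "m = measure (\<mu> (poly_op C q x)) B" and "m' = (\<integral>t. indicator B t * (poly q t)\<^sup>2 \<partial>\<mu> x)"
  have "\<bar>m - m'\<bar> \<le> e" if "e > 0" for e
  proof -
    define d where "d = e / (3 + 3 * K\<^sup>2)"
    have "3 + 3 * K\<^sup>2 > 0" by (simp add: add_pos_nonneg)
    then have "d > 0" using that by (simp add: d_def)
    obtain p where p: "\<forall>t\<in>{-a..a}. \<bar>poly p t\<bar> \<le> 2" "deviation p B x < d" "deviation p B (poly_op C q x) < d"
      using ex_small_deviation[OF _ B \<open>d > 0\<close>, of "{x, poly_op C q x}"] by auto
    have "\<bar>(norm (poly_op C p (poly_op C q x)))\<^sup>2 - m\<bar> \<le> 3 * d"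
      using norm_poly_op_near_measure[of p B "poly_op C q x"] p B unfolding m_def by auto
    moreover have "\<bar>(norm (poly_op C p (poly_op C q x)))\<^sup>2 - m'\<bar> \<le> 3 * K\<^sup>2 * deviation p B x"
      using norm_poly_op_near[of p B q "K\<^sup>2" x] p B q unfolding m'_def by auto
    moreover have "3 * K\<^sup>2 * deviation p B x \<le> 3 * K\<^sup>2 * d"
      using p(2) by (intro mult_left_mono) auto
    moreover have "3 * d + 3 * K\<^sup>2 * d = e"
    proof -
      have "d * (3 + 3 * K\<^sup>2) = e" using \<open>3 + 3 * K\<^sup>2 > 0\<close> unfolding d_def by simp
      then show ?thesis by (simp add: algebra_simps)
    qed
    ultimately show ?thesis by linarith
  qed
  then have "\<bar>m - m'\<bar> \<le> 0" by - (rule field_le_epsilon, simp)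
  then show ?thesis by (simp add: m_def m'_def)
qed

text \<open>The inequality between squared norms of a sum and its summands, applied after
  \<open>poly_op C p\<close> and passed to the limit. It makes vectors carried by a set stable under
  addition and, through \<open>measure_\<mu>_limit\<close>, under limits.\<close>

lemma measure_\<mu>_add:
  assumes B: "B \<in> sets borel"
  shows "measure (\<mu> (x + y)) B \<le> 2 * measure (\<mu> x) B + 2 * measure (\<mu> y) B"
proof (rule field_le_epsilon)
  fix e :: real assume "e > 0"
  \<comment> \<open>The deviations enter with total weight 3 * (1 + 2 + 2) = 15.\<close>
  then obtain p where p: "\<forall>t\<in>{-a..a}. \<bar>poly p t\<bar> \<le> 2"
    "deviation p B x < e / 15" "deviation p B y < e / 15" "deviation p B (x + y) < e / 15"
    using ex_small_deviation[OF _ B, of "{x, y, x + y}" "e / 15"] by auto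
  have near: "\<bar>(norm (poly_op C p z))\<^sup>2 - measure (\<mu> z) B\<bar> \<le> 3 * deviation p B z" for z
    using norm_poly_op_near_measure[of p B z] p B by auto
  interpret p: bounded_linear "poly_op C p" by (rule bounded_linear_poly_op[OF bounded_linear])
  have "(norm (u + v))\<^sup>2 \<le> 2 * (norm u)\<^sup>2 + 2 * (norm v)\<^sup>2" for u v :: 'a
  proof -
    have "(norm (u + v))\<^sup>2 \<le> (norm u + norm v)\<^sup>2"
      by (intro power_mono norm_triangle_ineq) simp
    also have "\<dots> \<le> 2 * (norm u)\<^sup>2 + 2 * (norm v)\<^sup>2"
      using zero_le_power2[of "norm u - norm v"] by (simp add: power2_eq_square algebra_simps)
    finally show ?thesis .
  qed
  then have "(norm (poly_op C p (x + y)))\<^sup>2 \<le> 2 * (norm (poly_op C p x))\<^sup>2 + 2 * (norm (poly_op C p y))\<^sup>2"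
    by (simp add: p.add)
  then show "measure (\<mu> (x + y)) B \<le> 2 * measure (\<mu> x) B + 2 * measure (\<mu> y) B + e"
    using near[of x] near[of y] near[of "x + y"] p(2-4) by linarith
qed

text \<open>An operator commuting with \<open>C\<close> commutes with its polynomials, so its norm
  bound applies to \<open>poly_op C p x\<close> and survives the limit.\<close>

lemma measure_\<mu>_commuting:
  assumes B: "B \<in> sets borel" and T: "linear T" "\<And>x. T (C x) = C (T x)" "\<And>x. norm (T x) \<le> K * norm x"
    and "K \<ge> 0"
  shows "measure (\<mu> (T x)) B \<le> K\<^sup>2 * measure (\<mu> x) B"
proof (rule field_le_epsilon)
  fix e :: real assume "e > 0"
  define d where "d = e / (3 + 3 * K\<^sup>2)"
  have "3 + 3 * K\<^sup>2 > 0" by (simp add: add_pos_nonneg)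
  then have "d > 0" using \<open>e > 0\<close> by (simp add: d_def)
  obtain p where p: "\<forall>t\<in>{-a..a}. \<bar>poly p t\<bar> \<le> 2" "deviation p B x < d" "deviation p B (T x) < d"
    using ex_small_deviation[OF _ B \<open>d > 0\<close>, of "{x, T x}"] by auto
  have near: "\<bar>(norm (poly_op C p z))\<^sup>2 - measure (\<mu> z) B\<bar> \<le> 3 * deviation p B z" for z
    using norm_poly_op_near_measure[of p B z] p B by auto
  have "norm (poly_op C p (T x)) \<le> K * norm (poly_op C p x)"
    using T(3) by (simp flip: poly_op_commute[OF bounded_linear T(1,2)])
  then have "(norm (poly_op C p (T x)))\<^sup>2 \<le> K\<^sup>2 * (norm (poly_op C p x))\<^sup>2"
    using power_mono[of "norm (poly_op C p (T x))" "K * norm (poly_op C p x)" 2]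
    by (simp add: power_mult_distrib)
  also have "\<dots> \<le> K\<^sup>2 * (measure (\<mu> x) B + 3 * d)"
    using near[of x] p(2) by (intro mult_left_mono) auto
  finally have "measure (\<mu> (T x)) B \<le> K\<^sup>2 * (measure (\<mu> x) B + 3 * d) + 3 * d"
    using near[of "T x"] p(3) by linarith
  also have "\<dots> = K\<^sup>2 * measure (\<mu> x) B + e"
  proof -
    have "d * (3 + 3 * K\<^sup>2) = e" using \<open>3 + 3 * K\<^sup>2 > 0\<close> unfolding d_def by simp
    then show ?thesis by (simp add: algebra_simps)
  qed
  finally show "measure (\<mu> (T x)) B \<le> K\<^sup>2 * measure (\<mu> x) B + e" .
qed

lemma measure_\<mu>_commuting_0:
  assumes "B \<in> sets borel" "bounded_linear T" "\<And>x. T (C x) = C (T x)" "measure (\<mu> x) B = 0"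
  shows "measure (\<mu> (T x)) B = 0"
proof -
  obtain K where "K \<ge> 0" "\<And>x. norm (T x) \<le> K * norm x"
    using bounded_linear.nonneg_bounded[OF assms(2)] by (metis mult.commute)
  then have "measure (\<mu> (T x)) B \<le> 0"
    using measure_\<mu>_commuting[of B T K x] assms by (auto intro: bounded_linear.linear)
  then show ?thesis by (simp add: measure_le_0_iff)
qed

definition supported :: "real set \<Rightarrow> 'a set" where
  "supported B = {x. measure (\<mu> x) (- B) = 0}"

text \<open>When \<open>p\<close> is close to the indicator of \<open>B\<close>,
  \<open>poly_op C p\<close> is almost the identity on vectors carried by \<open>B\<close> and
  almost zero on those carried by the complement, with errors given by the same integrand.\<close>

lemma supported_poly_op_norm:
  assumes [measurable]: "B \<in> sets borel" and u: "u \<in> supported B"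
  shows "(norm (poly_op C p u - u))\<^sup>2 = (\<integral>t. (poly p t - indicator B t)\<^sup>2 \<partial>\<mu> u)"
    and "v \<in> supported (- B) \<Longrightarrow> (norm (poly_op C p v))\<^sup>2 = (\<integral>t. (poly p t - indicator B t)\<^sup>2 \<partial>\<mu> v)"
proof -
  have AE: "AE t in \<mu> x. t \<in> B" if "x \<in> supported B" "B \<in> sets borel" for x B
  proof -
    interpret finite_measure "\<mu> x" by (rule finite_\<mu>)
    show ?thesis
      using that by (intro AE_I[where N="- B"]) (auto simp: supported_def emeasure_eq_measure)
  qed
  have "(norm (poly_op C p u - u))\<^sup>2 = (norm (poly_op C (p - 1) u))\<^sup>2"
    by (simp add: op_simps)
  also have "\<dots> = (\<integral>t. (poly p t - 1)\<^sup>2 \<partial>\<mu> u)"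
    by (simp flip: integral_poly_square_\<mu>)
  also have "\<dots> = (\<integral>t. (poly p t - indicator B t)\<^sup>2 \<partial>\<mu> u)"
    using AE[OF u] by (intro integral_cong_AE) auto
  finally show "(norm (poly_op C p u - u))\<^sup>2 = (\<integral>t. (poly p t - indicator B t)\<^sup>2 \<partial>\<mu> u)" .
  assume v: "v \<in> supported (- B)"
  have "(norm (poly_op C p v))\<^sup>2 = (\<integral>t. (poly p t)\<^sup>2 \<partial>\<mu> v)"
    by (simp flip: integral_poly_square_\<mu>)
  also have "\<dots> = (\<integral>t. (poly p t - indicator B t)\<^sup>2 \<partial>\<mu> v)"
    using AE[OF v] by (intro integral_cong_AE) auto
  finally show "(norm (poly_op C p v))\<^sup>2 = (\<integral>t. (poly p t - indicator B t)\<^sup>2 \<partial>\<mu> v)" .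
qed

text \<open>By symmetry of \<open>poly_op C p\<close>, the inner product splits into a term with
  \<open>poly_op C p v\<close> and one with \<open>poly_op C p u - u\<close>; both vectors are small
  when \<open>p\<close> is near the indicator.\<close>

lemma supported_orthogonal:
  assumes B: "B \<in> sets borel" and u: "u \<in> supported B" and v: "v \<in> supported (- B)"
  shows "inner u v = 0"
proof -
  have "\<bar>inner u v\<bar> \<le> e" if "e > 0" for e
  proof -
    define d where "d = e / (norm u + norm v + 1)"
    have "d > 0" using that by (simp add: d_def add_nonneg_pos)
    then obtain p where p: "\<forall>t\<in>{-a..a}. \<bar>poly p t\<bar> \<le> 2"
      "deviation p B u < d\<^sup>2 / 3" "deviation p B v < d\<^sup>2 / 3"
      using ex_small_deviation[OF _ B, of "{u, v}" "d\<^sup>2 / 3"] by auto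
    have sq: "(\<integral>t. (poly p t - indicator B t)\<^sup>2 \<partial>\<mu> x) \<le> 3 * deviation p B x" for x
      using square_deviation[of p B "\<lambda>_. 0" 0 x] p(1) B by auto
    have "(norm (poly_op C p u - u))\<^sup>2 \<le> d\<^sup>2" "(norm (poly_op C p v))\<^sup>2 \<le> d\<^sup>2"
      using supported_poly_op_norm[OF B u] v sq[of u] sq[of v] p(2,3) by auto
    then have n: "norm (poly_op C p u - u) \<le> d" "norm (poly_op C p v) \<le> d"
      using \<open>d > 0\<close> by (auto intro: power2_le_imp_le)
    have "inner u v = inner u (poly_op C p v) - inner (poly_op C p u - u) v"
      by (simp add: inner_diff_left op_symmetric)
    then have "\<bar>inner u v\<bar> \<le> norm u * norm (poly_op C p v) + norm (poly_op C p u - u) * norm v"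
      using Cauchy_Schwarz_ineq2[of u "poly_op C p v"] Cauchy_Schwarz_ineq2[of "poly_op C p u - u" v]
      by linarith
    also have "\<dots> \<le> norm u * d + d * norm v"
      using n by (intro add_mono mult_left_mono mult_right_mono) auto
    also have "\<dots> \<le> d * (norm u + norm v + 1)" using \<open>d > 0\<close> by (simp add: algebra_simps)
    also have "\<dots> = e" unfolding d_def by (simp add: add_nonneg_pos[THEN less_imp_neq, symmetric])
    finally show ?thesis .
  qed
  then have "\<bar>inner u v\<bar> \<le> 0" by - (rule field_le_epsilon, simp)
  then show ?thesis by simp
qed

lemma supported_add: "B \<in> sets borel \<Longrightarrow> x \<in> supported B \<Longrightarrow> y \<in> supported B \<Longrightarrow> x + y \<in> supported B"
  using measure_\<mu>_add[of "- B" x y] measure_nonneg[of "\<mu> (x + y)" "- B"] by (auto simp: supported_def)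

lemma supported_commuting:
  "B \<in> sets borel \<Longrightarrow> bounded_linear T \<Longrightarrow> (\<And>x. T (C x) = C (T x)) \<Longrightarrow> x \<in> supported B \<Longrightarrow> T x \<in> supported B"
  using measure_\<mu>_commuting_0[of "- B" T x] by (auto simp: supported_def)

text \<open>In the splitting of \<open>x\<close> into \<open>u n\<close> and \<open>x - u n\<close>,
  the second part has total mass equal to the squared distance.\<close>

lemma measure_\<mu>_limit:
  assumes B: "B \<in> sets borel" and lim: "u \<longlonglongrightarrow> x" "(\<lambda>n. measure (\<mu> (u n)) B) \<longlonglongrightarrow> 0"
  shows "measure (\<mu> x) B = 0"
proof -
  have "measure (\<mu> x) B \<le> 2 * measure (\<mu> (u n)) B + 2 * (norm (x - u n))\<^sup>2" for n
    using measure_\<mu>_add[OF B, of "u n" "x - u n"] measure_\<mu>_le[of "x - u n" B] by simp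
  moreover have "(\<lambda>n. 2 * measure (\<mu> (u n)) B + 2 * (norm (x - u n))\<^sup>2) \<longlonglongrightarrow> 2 * 0 + 2 * (norm (x - x))\<^sup>2"
    by (intro tendsto_intros lim)
  ultimately have "measure (\<mu> x) B \<le> 0"
    by (intro LIMSEQ_le_const[of _ "0::real" "measure (\<mu> x) B"]) auto
  then show ?thesis by (simp add: measure_le_0_iff)
qed

text \<open>Polynomials tending to the indicator of \<open>B\<close> in L2 give, by the isometry, a
  Cauchy sequence \<open>poly_op C (p n) x\<close> with limit \<open>u\<close>. Off \<open>B\<close>
  the density supplied by \<open>measure_poly_op\<close> is exactly the squared error, so the mass
  there disappears in the limit; on \<open>B\<close> the same holds for
  \<open>1 - p n\<close>.\<close>

lemma supported_decomposition:
  assumes B[measurable]: "B \<in> sets borel"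
  shows "\<exists>u. u \<in> supported B \<and> x - u \<in> supported (- B)"
proof -
  \<comment> \<open>The divisor 3 cancels the factor in \<open>square_deviation\<close>, leaving a
    squared L2 error of at most 2^-n.\<close>
  define d where "d n = (1 / 2) ^ n / (3::real)" for n :: nat
  have "\<forall>n. \<exists>p. (\<forall>t\<in>{-a..a}. \<bar>poly p t\<bar> \<le> 2) \<and> deviation p B x < d n"
  proof
    fix n
    have "d n > 0" by (simp add: d_def)
    then show "\<exists>p. (\<forall>t\<in>{-a..a}. \<bar>poly p t\<bar> \<le> 2) \<and> deviation p B x < d n"
      using ex_small_deviation[OF _ B, of "{x}" "d n"] by simp
  qed
  from choice[OF this] obtain p where
    p: "\<And>n t. t \<in> {-a..a} \<Longrightarrow> \<bar>poly (p n) t\<bar> \<le> 2" "\<And>n. deviation (p n) B x < d n"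
    by blast
  have int: "integrable (\<mu> x) (\<lambda>t. (poly (p n) t - indicator B t)\<^sup>2)" for n
  proof (rule integrable_\<mu>[where K=9])
    fix t assume t: "t \<in> {-a..a}"
    have "\<bar>poly (p n) t - indicator B t\<bar> \<le> 3" using p(1)[OF t, of n] by (auto split: split_indicator)
    from power_mono[OF this abs_ge_zero, of 2] show "\<bar>(poly (p n) t - indicator B t)\<^sup>2\<bar> \<le> 9" by simp
  qed measurable
  have sq: "(\<integral>t. (poly (p n) t - indicator B t)\<^sup>2 \<partial>\<mu> x) \<le> (1 / 2) ^ n" for n
    using square_deviation[of "p n" B "\<lambda>_. 0" 0 x] p(1)[of _ n] p(2)[of n] by (auto simp: d_def)
  define s where "s n = poly_op C (p n) x" for n
  have dist: "(norm (s m - s n))\<^sup>2 \<le> 2 * (1 / 2) ^ m + 2 * (1 / 2) ^ n" for m n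
  proof -
    have "(norm (s m - s n))\<^sup>2 = (\<integral>t. (poly (p m - p n) t)\<^sup>2 \<partial>\<mu> x)"
      by (simp add: integral_poly_square_\<mu> op_simps s_def del: poly_diff)
    also have "\<dots> \<le> (\<integral>t. 2 * (poly (p m) t - indicator B t)\<^sup>2 + 2 * (poly (p n) t - indicator B t)\<^sup>2 \<partial>\<mu> x)"
    proof (rule integral_mono_AE)
      have "integrable (\<mu> x) (\<lambda>t. (poly (p m) t - poly (p n) t)\<^sup>2)"
      proof (rule integrable_\<mu>[where K=16])
        fix t assume t: "t \<in> {-a..a}"
        have "\<bar>poly (p m) t - poly (p n) t\<bar> \<le> 4" using p(1)[OF t, of m] p(1)[OF t, of n] by linarith
        from power_mono[OF this abs_ge_zero, of 2] show "\<bar>(poly (p m) t - poly (p n) t)\<^sup>2\<bar> \<le> 16" by simp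
      qed measurable
      then show "integrable (\<mu> x) (\<lambda>t. (poly (p m - p n) t)\<^sup>2)" by simp
      have "(r - s)\<^sup>2 \<le> 2 * (r - i)\<^sup>2 + 2 * (s - i)\<^sup>2" for r s i :: real
        using zero_le_power2[of "r + s - 2 * i"] by (simp add: power2_eq_square algebra_simps)
      then show "AE t in \<mu> x. (poly (p m - p n) t)\<^sup>2 \<le> 2 * (poly (p m) t - indicator B t)\<^sup>2 + 2 * (poly (p n) t - indicator B t)\<^sup>2"
        by simp
    qed (use int in auto)
    also have "\<dots> \<le> 2 * (1 / 2) ^ m + 2 * (1 / 2) ^ n"
      using int sq[of m] sq[of n] by simp
    finally show ?thesis .
  qed
  have "Cauchy s"
  proof (rule CauchyI)
    fix e :: real assume "e > 0"
    then obtain N where N: "(1 / 2) ^ N < e\<^sup>2 / 4"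
      using real_arch_pow_inv[of "e\<^sup>2 / 4" "1 / 2"] by auto
    show "\<exists>M. \<forall>m\<ge>M. \<forall>n\<ge>M. norm (s m - s n) < e"
    proof (intro exI allI impI)
      fix m n assume "m \<ge> N" "n \<ge> N"
      then have "(1 / 2 :: real) ^ m \<le> (1 / 2) ^ N" "(1 / 2 :: real) ^ n \<le> (1 / 2) ^ N"
        by (auto intro: power_decreasing)
      then have "(norm (s m - s n))\<^sup>2 < e\<^sup>2" using dist[of m n] N by linarith
      then show "norm (s m - s n) < e" using \<open>e > 0\<close> by (auto intro: power2_less_imp_less)
    qed
  qed
  then obtain u where u: "s \<longlonglongrightarrow> u" using Cauchy_convergent convergent_def by blast
  have half: "(\<lambda>n. (1 / 2 :: real) ^ n) \<longlonglongrightarrow> 0" by (rule LIMSEQ_power_zero) simp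
  have "measure (\<mu> u) (- B) = 0"
  proof (rule measure_\<mu>_limit[OF _ u])
    show "(\<lambda>n. measure (\<mu> (s n)) (- B)) \<longlonglongrightarrow> 0"
    proof (rule Lim_null_comparison[OF _ half], rule always_eventually, rule allI)
      fix n
      have "measure (\<mu> (s n)) (- B) = (\<integral>t. indicator (- B) t * (poly (p n) t)\<^sup>2 \<partial>\<mu> x)"
        unfolding s_def by (rule measure_poly_op) auto
      also have "\<dots> \<le> (\<integral>t. (poly (p n) t - indicator B t)\<^sup>2 \<partial>\<mu> x)"
        by (rule integral_mono'[OF int]) (auto split: split_indicator)
      finally show "norm (measure (\<mu> (s n)) (- B)) \<le> (1 / 2) ^ n" using sq[of n] by simp
    qed
  qed auto
  moreover have "measure (\<mu> (x - u)) B = 0"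
  proof (rule measure_\<mu>_limit[OF _ tendsto_diff[OF tendsto_const u]])
    show "(\<lambda>n. measure (\<mu> (x - s n)) B) \<longlonglongrightarrow> 0"
    proof (rule Lim_null_comparison[OF _ half], rule always_eventually, rule allI)
      fix n
      have "x - s n = poly_op C (1 - p n) x" by (simp add: s_def op_simps)
      then have "measure (\<mu> (x - s n)) B = (\<integral>t. indicator B t * (poly (1 - p n) t)\<^sup>2 \<partial>\<mu> x)"
        by (simp only: measure_poly_op[OF B])
      also have "\<dots> \<le> (\<integral>t. (poly (p n) t - indicator B t)\<^sup>2 \<partial>\<mu> x)"
        by (rule integral_mono'[OF int]) (auto split: split_indicator simp: power2_commute)
      finally show "norm (measure (\<mu> (x - s n)) B) \<le> (1 / 2) ^ n" using sq[of n] by simp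
    qed
  qed auto
  ultimately show ?thesis by (auto simp: supported_def)
qed

end


section \<open>The spectral theorem\<close>

lemma cinner_scaleC_left: "cinner (c *\<^sub>C x) y = cnj c * cinner x y"
  by (metis cinner_commute cinner_scaleC_right complex_cnj_mult)

lemma cinner_eq_Complex: "cinner x y = Complex (inner x y) (inner (\<i> *\<^sub>C x) y)"
  by (simp add: complex_eq_iff inner_eq_Re_cinner cinner_scaleC_left)

lemma norm_scaleC: "norm (c *\<^sub>C x) = cmod c * norm x"
proof -
  have "inner (c *\<^sub>C x) (c *\<^sub>C x) = Re (of_real ((cmod c)\<^sup>2) * cinner x x)"
    unfolding inner_eq_Re_cinner cinner_scaleC_left cinner_scaleC_right
    by (metis complex_norm_square mult.assoc mult.commute)
  then have "(norm (c *\<^sub>C x))\<^sup>2 = (cmod c * norm x)\<^sup>2"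
    by (simp add: power2_norm_eq_inner power_mult_distrib inner_eq_Re_cinner)
  then show ?thesis by (simp add: power2_eq_iff_nonneg)
qed

lemma bounded_linear_scaleC: "bounded_linear (\<lambda>x. c *\<^sub>C x)"
proof (rule bounded_linear_intro[where K="cmod c"])
  show "c *\<^sub>C (x + y) = c *\<^sub>C x + c *\<^sub>C y" for x y by (rule scaleC_add_right)
  show "c *\<^sub>C r *\<^sub>R x = r *\<^sub>R c *\<^sub>C x" for r x
    by (simp add: scaleR_eq_scaleC scaleC_scaleC mult.commute)
qed (simp add: norm_scaleC mult.commute)

text \<open>Real symmetry tested on \<i> times a vector supplies the imaginary part, so
  constructions can be carried out with the real inner product alone.\<close>

lemma bounded_selfadjointI:
  assumes "bounded_linear T" "\<And>c x. T (c *\<^sub>C x) = c *\<^sub>C T x" "\<And>x y. inner (T x) y = inner x (T y)"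
  shows "bounded_selfadjoint T"
proof -
  have "inner (\<i> *\<^sub>C T x) y = inner (\<i> *\<^sub>C x) (T y)" for x y
    using assms(3)[of "\<i> *\<^sub>C x" y] by (simp only: assms(2))
  then show ?thesis
    unfolding bounded_selfadjoint_def cinner_eq_Complex using assms by simp
qed

lemma cinner_selfadjoint_real:
  assumes "\<And>x y. cinner (T x) y = cinner x (T y)"
  shows "cinner x (T x) = complex_of_real (inner x (T x))"
proof -
  have "cnj (cinner x (T x)) = cinner x (T x)"
    by (metis assms cinner_commute)
  then show ?thesis by (simp add: inner_eq_Re_cinner complex_eq_iff)
qed

context selfadjoint_operator
begin

lemma supported_0: "0 \<in> supported B"
  using measure_\<mu>_le[of 0 "- B"] by (simp add: supported_def measure_le_0_iff)

lemma supported_diff: "B \<in> sets borel \<Longrightarrow> x \<in> supported B \<Longrightarrow> y \<in> supported B \<Longrightarrow> x - y \<in> supported B"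
  using supported_add[of B x "- y"]
    supported_commuting[of B uminus y, OF _ bounded_linear_minus[OF bounded_linear_ident]]
  by (simp add: neg)

lemma supported_mono:
  assumes "B \<in> sets borel" "B' \<in> sets borel" "B \<subseteq> B'" "x \<in> supported B"
  shows "x \<in> supported B'"
proof -
  interpret finite_measure "\<mu> x" by (rule finite_\<mu>)
  have "measure (\<mu> x) (- B') \<le> measure (\<mu> x) (- B)"
    using assms by (intro finite_measure_mono) auto
  then show ?thesis using assms(4) measure_nonneg[of "\<mu> x" "- B'"]
    by (simp add: supported_def measure_le_0_iff)
qed

lemma supported_Int:
  assumes "B \<in> sets borel" "B' \<in> sets borel" "x \<in> supported B" "x \<in> supported B'"
  shows "x \<in> supported (B \<inter> B')"
proof -
  interpret finite_measure "\<mu> x" by (rule finite_\<mu>)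
  have "measure (\<mu> x) (- B \<union> - B') \<le> measure (\<mu> x) (- B) + measure (\<mu> x) (- B')"
    using assms by (intro measure_Un_le) auto
  then show ?thesis using assms(3,4) by (simp add: supported_def measure_le_0_iff)
qed

definition sproj :: "real set \<Rightarrow> 'a \<Rightarrow> 'a" where
  "sproj B x = (THE u. u \<in> supported B \<and> x - u \<in> supported (- B))"

lemma sproj_unique:
  assumes B: "B \<in> sets borel" and "u \<in> supported B" "x - u \<in> supported (- B)"
    "u' \<in> supported B" "x - u' \<in> supported (- B)"
  shows "u = u'"
proof -
  have "u - u' \<in> supported B" using assms by (simp add: supported_diff)
  moreover have "(x - u') - (x - u) \<in> supported (- B)" using assms by (intro supported_diff[of _ "x - u'"]) auto
  ultimately have "inner (u - u') (u - u') = 0"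
    using supported_orthogonal[OF B, of "u - u'" "u - u'"] by simp
  then show ?thesis by simp
qed

lemma sproj_eqI:
  assumes "B \<in> sets borel" "u \<in> supported B" "x - u \<in> supported (- B)"
  shows "sproj B x = u"
  unfolding sproj_def using assms sproj_unique by (intro the_equality) blast+

lemma sproj_supported: "B \<in> sets borel \<Longrightarrow> sproj B x \<in> supported B"
  and sproj_compl_supported: "B \<in> sets borel \<Longrightarrow> x - sproj B x \<in> supported (- B)"
  using supported_decomposition[of B x] sproj_eqI by blast+

lemma sproj_add: "B \<in> sets borel \<Longrightarrow> sproj B (x + y) = sproj B x + sproj B y"
  using supported_add[of B "sproj B x" "sproj B y"] supported_add[of "- B" "x - sproj B x" "y - sproj B y"]
  by (intro sproj_eqI) (auto simp: sproj_supported sproj_compl_supported algebra_simps)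

text \<open>A bounded operator commuting with \<open>C\<close> preserves both summands of the
  decomposition, which is unique. Complex scalars and \<open>C\<close> itself are instances.\<close>

lemma sproj_commuting:
  assumes "B \<in> sets borel" "bounded_linear T" "\<And>x. T (C x) = C (T x)"
  shows "sproj B (T x) = T (sproj B x)"
proof (rule sproj_eqI)
  show "T (sproj B x) \<in> supported B" by (rule supported_commuting[OF assms sproj_supported[OF assms(1)]])
  have "T (x - sproj B x) \<in> supported (- B)"
    by (rule supported_commuting[OF _ assms(2,3) sproj_compl_supported[OF assms(1)]]) (use assms(1) in auto)
  then show "T x - T (sproj B x) \<in> supported (- B)"
    by (simp add: linear_diff[OF bounded_linear.linear[OF assms(2)]])
qed (use assms in auto)

lemma sproj_scaleC: "B \<in> sets borel \<Longrightarrow> sproj B (c *\<^sub>C x) = c *\<^sub>C sproj B x"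
  by (rule sproj_commuting) (auto simp: bounded_linear_scaleC scaleC)

lemma sproj_C: "B \<in> sets borel \<Longrightarrow> sproj B (C x) = C (sproj B x)"
  by (rule sproj_commuting) (auto simp: bounded_linear)

lemma sproj_orthogonal: "B \<in> sets borel \<Longrightarrow> inner (sproj B x) (y - sproj B y) = 0"
  by (rule supported_orthogonal[OF _ sproj_supported sproj_compl_supported])

lemma sproj_symmetric: "B \<in> sets borel \<Longrightarrow> inner (sproj B x) y = inner x (sproj B y)"
  using sproj_orthogonal[of B x y] sproj_orthogonal[of B y x]
  by (simp add: inner_diff_right inner_diff_left inner_commute)

lemma norm_sproj_le: "B \<in> sets borel \<Longrightarrow> norm (sproj B x) \<le> norm x"
proof -
  assume B: "B \<in> sets borel"
  have "norm (sproj B x) * norm (sproj B x) = inner (sproj B x) x"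
    using sproj_orthogonal[OF B, of x x] by (simp add: inner_diff_right power2_norm_eq_inner flip: power2_eq_square)
  also have "\<dots> \<le> norm (sproj B x) * norm x" by (rule norm_cauchy_schwarz)
  finally show ?thesis by (cases "sproj B x = 0") auto
qed

lemma bounded_linear_sproj: "B \<in> sets borel \<Longrightarrow> bounded_linear (sproj B)"
  using norm_sproj_le
  by (intro bounded_linear_intro[where K=1])
     (auto simp: sproj_add scaleR_eq_scaleC sproj_scaleC)

lemma sproj_id: "B \<in> sets borel \<Longrightarrow> x \<in> supported B \<Longrightarrow> sproj B x = x"
  by (rule sproj_eqI) (auto simp: supported_0)

lemma orthogonal_projection_sproj: "B \<in> sets borel \<Longrightarrow> orthogonal_projection (sproj B)"
  unfolding orthogonal_projection_def
  by (auto intro!: bounded_selfadjointI simp: bounded_linear_sproj sproj_scaleC sproj_symmetric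
      fun_eq_iff sproj_id sproj_supported)

lemma sproj_Int:
  assumes "B \<in> sets borel" "B' \<in> sets borel"
  shows "sproj (B \<inter> B') x = sproj B (sproj B' x)"
proof (rule sproj_eqI)
  define v where "v = sproj B' x"
  have v: "v \<in> supported B'" unfolding v_def by (rule sproj_supported) fact
  \<comment> \<open>The projection for \<open>B\<close> commutes with \<open>C\<close>, hence
    preserves every space of carried vectors, also that of \<open>B'\<close>.\<close>
  have "sproj B v \<in> supported B'"
    by (rule supported_commuting) (use assms v in \<open>auto simp: bounded_linear_sproj sproj_C\<close>)
  then show "sproj B (sproj B' x) \<in> supported (B \<inter> B')"
    unfolding v_def[symmetric] using assms by (intro supported_Int sproj_supported) auto
  have "x - v \<in> supported (- (B \<inter> B'))"
    using assms by - (rule supported_mono[of "- B'"], auto simp: v_def sproj_compl_supported)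
  moreover have "v - sproj B v \<in> supported (- (B \<inter> B'))"
    using assms by - (rule supported_mono[of "- B"], auto simp: sproj_compl_supported)
  ultimately have "(x - v) + (v - sproj B v) \<in> supported (- (B \<inter> B'))"
    using assms by - (rule supported_add, auto)
  then show "x - sproj B (sproj B' x) \<in> supported (- (B \<inter> B'))" by (simp add: v_def)
qed (use assms in auto)

lemma sproj_disjoint_Un:
  assumes "B \<in> sets borel" "B' \<in> sets borel" "B \<inter> B' = {}"
  shows "sproj (B \<union> B') x = sproj B x + sproj B' x"
proof (rule sproj_eqI)
  show "sproj B x + sproj B' x \<in> supported (B \<union> B')"
    using assms by (intro supported_add) (auto intro: supported_mono[of B] supported_mono[of B'] sproj_supported)
  have "(x - sproj B x) - sproj B' x \<in> supported (- B)"
    using assms by (intro supported_diff[OF _ sproj_compl_supported])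
      (auto intro: supported_mono[of B'] sproj_supported)
  moreover have "(x - sproj B' x) - sproj B x \<in> supported (- B')"
    using assms by (intro supported_diff[OF _ sproj_compl_supported])
      (auto intro: supported_mono[of B] sproj_supported)
  ultimately have "x - (sproj B x + sproj B' x) \<in> supported (- B \<inter> - B')"
    using assms by (intro supported_Int) (auto simp: algebra_simps)
  then show "x - (sproj B x + sproj B' x) \<in> supported (- (B \<union> B'))" by simp
qed (use assms in auto)

text \<open>With \<open>u\<close> and \<open>v\<close> the components of \<open>x\<close>, the
  vectors \<open>poly_op C p u\<close> and \<open>poly_op C p v\<close> stay in the two orthogonal
  spaces. Pythagoras in the limit therefore makes the measures of \<open>u\<close> and
  \<open>v\<close> add up on \<open>B\<close>.\<close>

lemma measure_\<mu>_eq_norm_sproj: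
  assumes B: "B \<in> sets borel"
  shows "measure (\<mu> x) B = (norm (sproj B x))\<^sup>2"
proof -
  interpret finite_measure "\<mu> z" for z by (rule finite_\<mu>)
  define u v where "u = sproj B x" and "v = x - sproj B x"
  have u: "u \<in> supported B" and v: "v \<in> supported (- B)" and x: "x = u + v"
    using B by (auto simp: u_def v_def sproj_supported sproj_compl_supported)
  have "measure (\<mu> v) B = 0" using v by (simp add: supported_def)
  moreover have "measure (\<mu> u) B = (norm u)\<^sup>2"
    using u finite_measure_compl[of B u] B by (simp add: supported_def measure_\<mu>_UNIV Compl_eq_Diff_UNIV)
  moreover have "\<bar>measure (\<mu> x) B - measure (\<mu> u) B - measure (\<mu> v) B\<bar> \<le> e" if "e > 0" for e
  proof -
    have "e / 9 > 0" using that by simp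
    from ex_small_deviation[OF _ B this, of "{u, v, x}"]
    obtain p where p: "\<forall>t\<in>{-a..a}. \<bar>poly p t\<bar> \<le> 2"
      "deviation p B u < e / 9" "deviation p B v < e / 9" "deviation p B x < e / 9"
      by auto
    have near: "\<bar>(norm (poly_op C p z))\<^sup>2 - measure (\<mu> z) B\<bar> \<le> 3 * deviation p B z" for z
      using norm_poly_op_near_measure[of p B z] p B by auto
    interpret p: bounded_linear "poly_op C p" by (rule bounded_linear_poly_op[OF bounded_linear])
    have comm: "poly_op C p (C z) = C (poly_op C p z)" for z
      by (rule poly_op_commute[OF bounded_linear, symmetric]) (auto intro: bounded_linear.linear bounded_linear)
    have "inner (poly_op C p u) (poly_op C p v) = 0"
      by (rule supported_orthogonal[OF B supported_commuting[OF B p.bounded_linear_axioms comm u]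
            supported_commuting[OF _ p.bounded_linear_axioms comm v]]) (use B in auto)
    then have "(norm (poly_op C p x))\<^sup>2 = (norm (poly_op C p u))\<^sup>2 + (norm (poly_op C p v))\<^sup>2"
      by (simp add: x p.add power2_norm_eq_inner inner_add_left inner_add_right inner_commute)
    then show ?thesis using near[of u] near[of v] near[of x] p(2-4) by linarith
  qed
  then have "\<bar>measure (\<mu> x) B - measure (\<mu> u) B - measure (\<mu> v) B\<bar> \<le> 0"
    by - (rule field_le_epsilon, simp)
  ultimately show ?thesis unfolding u_def by linarith
qed

text \<open>The squared error of a partial sum is the \<open>\<mu> x\<close>-mass of the sets not
  yet included, so countable additivity of the scalar measure gives convergence in norm.\<close>

lemma sproj_sums:
  assumes F: "range F \<subseteq> sets borel" "disjoint_family F"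
  shows "(\<lambda>n. sproj (F n) x) sums sproj (\<Union>n. F n) x"
proof -
  interpret finite_measure "\<mu> x" by (rule finite_\<mu>)
  have [measurable]: "F n \<in> sets borel" for n using F by auto
  define G where "G n = (\<Union>k<n. F k)" for n
  have [measurable]: "G n \<in> sets borel" for n unfolding G_def by auto
  have G: "(\<Sum>k<n. sproj (F k) x) = sproj (G n) x" for n
  proof (induction n)
    case 0
    have "sproj {} x = 0"
      by (rule sproj_eqI) (auto simp: supported_0, simp add: supported_def)
    then show ?case by (simp add: G_def)
  next
    case (Suc n)
    have "G (Suc n) = G n \<union> F n" by (auto simp: G_def less_Suc_eq)
    moreover have "G n \<inter> F n = {}"
      using F(2) by (auto simp: G_def disjoint_family_on_def) (metis IntI empty_iff less_irrefl)
    ultimately show ?case using Suc by (simp add: sproj_disjoint_Un)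
  qed
  let ?U = "\<Union>n. F n"
  have diff: "(norm (sproj ?U x - sproj (G n) x))\<^sup>2 = measure (\<mu> x) ?U - measure (\<mu> x) (G n)" for n
  proof -
    have sub: "G n \<subseteq> ?U" by (auto simp: G_def)
    have "sproj (G n \<union> (?U - G n)) x = sproj (G n) x + sproj (?U - G n) x"
      by (rule sproj_disjoint_Un) auto
    then have "sproj ?U x - sproj (G n) x = sproj (?U - G n) x"
      using sub by (simp add: Un_absorb1)
    moreover have "measure (\<mu> x) (?U - G n) = measure (\<mu> x) ?U - measure (\<mu> x) (G n)"
      using sub by (intro finite_measure_Diff) auto
    ultimately show ?thesis by (simp add: measure_\<mu>_eq_norm_sproj[symmetric])
  qed
  have "(\<lambda>n. measure (\<mu> x) (G n)) \<longlonglongrightarrow> measure (\<mu> x) (\<Union>n. G n)"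
    by (rule finite_Lim_measure_incseq) (auto simp: incseq_def G_def intro: less_le_trans)
  moreover have "(\<Union>n. G n) = ?U" by (auto simp: G_def)
  ultimately have "(\<lambda>n. measure (\<mu> x) ?U - measure (\<mu> x) (G n)) \<longlonglongrightarrow> measure (\<mu> x) ?U - measure (\<mu> x) ?U"
    by (intro tendsto_intros) auto
  then have "(\<lambda>n. sqrt ((norm (sproj ?U x - sproj (G n) x))\<^sup>2)) \<longlonglongrightarrow> sqrt 0"
    unfolding diff by (intro tendsto_intros) simp
  then have "(\<lambda>n. norm (sproj (G n) x - sproj ?U x)) \<longlonglongrightarrow> 0"
    by (simp add: norm_minus_commute)
  then show ?thesis
    unfolding sums_def G by (rule LIM_zero_cancel[OF tendsto_norm_zero_cancel])
qed

lemma bounded_pvm_sproj: "bounded_pvm sproj"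
  unfolding bounded_pvm_def
proof (intro conjI ballI allI impI)
  show "sproj {} = (\<lambda>x. 0)"
    by (rule ext, rule sproj_eqI) (auto simp: supported_0, simp add: supported_def)
  \<comment> \<open>The open interval is widened by 1 because the endpoints \<open>- a\<close> and
    \<open>a\<close> may carry mass.\<close>
  have "supported {-(a+1)<..<a+1} = UNIV"
  proof safe
    fix x
    interpret finite_measure "\<mu> x" by (rule finite_\<mu>)
    have "AE t in \<mu> x. (t \<in> - {-(a+1)<..<a+1}) = (t \<in> {})"
      using AE_\<mu>[of x] by eventually_elim auto
    then have "measure (\<mu> x) (- {-(a+1)<..<a+1}) = measure (\<mu> x) {}"
      by (rule measure_eq_AE) auto
    then show "x \<in> supported {-(a+1)<..<a+1}"
      by (simp add: supported_def)
  qed auto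
  then show "\<exists>b. sproj {-b<..<b} = id"
    by (intro exI[of _ "a + 1"]) (auto simp: fun_eq_iff intro!: sproj_id)
qed (auto simp: orthogonal_projection_sproj sproj_Int fun_eq_iff intro: sproj_sums)

lemma pvm_measure_sproj: "pvm_measure sproj x = \<mu> x"
proof -
  interpret finite_measure "\<mu> x" by (rule finite_\<mu>)
  have "measure_of UNIV (sets borel) (\<lambda>B. ennreal (Re (cinner x (sproj B x))))
      = measure_of (space (\<mu> x)) (sets (\<mu> x)) (emeasure (\<mu> x))"
    unfolding space_\<mu> sets_\<mu>
  proof (rule measure_of_eq)
    fix B assume "B \<in> sigma_sets UNIV (sets (borel :: real measure))"
    then have B: "B \<in> sets borel" by (metis sets.sigma_sets_eq space_borel)
    have "inner x (sproj B x) = inner (sproj B x) (sproj B x)"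
      using sproj_symmetric[OF B, of x "sproj B x"] sproj_id[OF B sproj_supported[OF B], of x] by simp
    then show "ennreal (Re (cinner x (sproj B x))) = emeasure (\<mu> x) B"
      by (simp add: emeasure_eq_measure measure_\<mu>_eq_norm_sproj[OF B] power2_norm_eq_inner
          flip: inner_eq_Re_cinner)
  qed auto
  then show ?thesis unfolding pvm_measure_def by (simp only: measure_of_of_measure)
qed

lemma spectral_resolution_sproj: "spectral_resolution sproj C"
  unfolding spectral_resolution_def
proof (intro conjI allI bounded_pvm_sproj)
  fix x
  have "cinner x (C x) = complex_of_real (inner x (C x))"
    using selfadjoint by (intro cinner_selfadjoint_real) (simp add: bounded_selfadjoint_def)
  also have "inner x (C x) = (\<integral>t. t \<partial>\<mu> x)"
    using integral_poly_\<mu>[where p="[:0, 1:]" and x=x]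
    by (simp add: poly_op_pCons[OF bounded_linear] poly_op_0[OF bounded_linear] zero)
  finally show "cinner x (C x) = complex_of_real (\<integral>t. t \<partial>pvm_measure sproj x)"
    by (simp add: pvm_measure_sproj)
qed

end

theorem spectral_theorem:
  assumes "bounded_selfadjoint C"
  shows "\<exists>E. spectral_resolution E C"
proof -
  obtain K where "K > 0" "\<And>x. norm (C x) \<le> norm x * K"
    using bounded_linear.pos_bounded assms unfolding bounded_selfadjoint_def by blast
  then interpret selfadjoint_operator C K
    using assms by unfold_locales (auto simp: mult.commute)
  show ?thesis using spectral_resolution_sproj by blast
qed


section \<open>Properties of spectral resolutions\<close>

text \<open>Here \<open>E\<close> is any resolution, not the one just constructed, so that the
  results apply to the one chosen in \<open>spectral_measure\<close>.\<close>

locale resolved_operator =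
  fixes C :: "'a::complex_hilbert_space \<Rightarrow> 'a" and E :: "real set \<Rightarrow> 'a \<Rightarrow> 'a"
  assumes selfadjoint: "bounded_selfadjoint C"
    and resolution: "spectral_resolution E C"
begin

lemma bounded_linear: "bounded_linear C"
  using selfadjoint by (simp add: bounded_selfadjoint_def)

sublocale bounded_linear C by (rule bounded_linear)

lemma symmetric: "inner (C x) y = inner x (C y)"
  using selfadjoint by (simp add: bounded_selfadjoint_def inner_eq_Re_cinner)

lemma pvm: "bounded_pvm E"
  using resolution by (simp add: spectral_resolution_def)

lemma E_selfadjoint: "B \<in> sets borel \<Longrightarrow> bounded_selfadjoint (E B)"
  using pvm by (auto simp: bounded_pvm_def orthogonal_projection_def)

lemma bounded_linear_E: "B \<in> sets borel \<Longrightarrow> bounded_linear (E B)"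
  using E_selfadjoint by (simp add: bounded_selfadjoint_def)

lemma linear_E: "B \<in> sets borel \<Longrightarrow> linear (E B)"
  by (intro bounded_linear.linear bounded_linear_E)

lemma E_zero: "B \<in> sets borel \<Longrightarrow> E B 0 = 0"
  and E_add: "B \<in> sets borel \<Longrightarrow> E B (x + y) = E B x + E B y"
  and E_diff: "B \<in> sets borel \<Longrightarrow> E B (x - y) = E B x - E B y"
  by (simp_all add: linear_E linear_0 linear_add linear_diff)

lemma E_scaleC: "B \<in> sets borel \<Longrightarrow> E B (c *\<^sub>C x) = c *\<^sub>C E B x"
  using E_selfadjoint by (simp add: bounded_selfadjoint_def)

lemma E_symmetric: "B \<in> sets borel \<Longrightarrow> inner (E B x) y = inner x (E B y)"
  using E_selfadjoint by (simp add: bounded_selfadjoint_def inner_eq_Re_cinner)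

lemma E_Int: "B \<in> sets borel \<Longrightarrow> B' \<in> sets borel \<Longrightarrow> E B (E B' x) = E (B \<inter> B') x"
  using pvm by (auto simp: bounded_pvm_def)

lemma E_idem: "B \<in> sets borel \<Longrightarrow> E B (E B x) = E B x"
  by (simp add: E_Int)

lemma E_empty [simp]: "E {} x = 0"
  using pvm by (simp add: bounded_pvm_def)

lemma E_UNIV [simp]: "E UNIV x = x"
proof -
  obtain b where "E {-b<..<b} = id" using pvm by (auto simp: bounded_pvm_def)
  then show ?thesis using E_Int[of UNIV "{-b<..<b}" x] by simp
qed

lemma E_sums: "(\<And>n. F n \<in> sets borel) \<Longrightarrow> disjoint_family F \<Longrightarrow> (\<lambda>n. E (F n) x) sums E (\<Union>n. F n) x"
  using pvm by (auto simp: bounded_pvm_def image_subset_iff)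

lemma E_Un:
  assumes "B \<in> sets borel" "B' \<in> sets borel" "B \<inter> B' = {}"
  shows "E (B \<union> B') x = E B x + E B' x"
proof -
  define F where "F n = (if n = 0 then B else if n = 1 then B' else {})" for n :: nat
  have "(\<lambda>n. E (F n) x) sums E (\<Union>n. F n) x"
    by (rule E_sums) (use assms in \<open>auto simp: F_def disjoint_family_on_def\<close>)
  moreover have "(\<lambda>n. E (F n) x) sums (\<Sum>n\<in>{0, 1}. E (F n) x)"
    by (rule sums_finite) (auto simp: F_def)
  moreover have "(\<Union>n. F n) = B \<union> B'"
    by (auto simp: F_def split: if_splits intro: exI[of _ 0] exI[of _ "1::nat"])
  ultimately show ?thesis by (auto simp: F_def dest: sums_unique2)
qed

lemma E_compl: "B \<in> sets borel \<Longrightarrow> E (- B) x = x - E B x"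
  using E_Un[of B "- B" x] by (simp add: algebra_simps)

lemma E_Diff: "B \<in> sets borel \<Longrightarrow> B' \<in> sets borel \<Longrightarrow> B' \<subseteq> B \<Longrightarrow> E B x = E (B - B') x + E B' x"
  using E_Un[of "B - B'" B' x] by (auto simp: Un_absorb2)

lemma E_zero_mono: "B \<in> sets borel \<Longrightarrow> B' \<in> sets borel \<Longrightarrow> B \<subseteq> B' \<Longrightarrow> E B' x = 0 \<Longrightarrow> E B x = 0"
  by (metis E_Int E_zero inf.absorb1)

lemma norm_E_square: "B \<in> sets borel \<Longrightarrow> (norm (E B x))\<^sup>2 = inner x (E B x)"
  using E_symmetric[of B x "E B x"] by (simp add: E_idem power2_norm_eq_inner)

abbreviation M :: "'a \<Rightarrow> real measure" where "M \<equiv> pvm_measure E"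

lemma sets_M [simp, measurable_cong]: "sets (M x) = sets borel"
  unfolding pvm_measure_def by (metis sets.sets_measure_of_eq space_borel)

lemma space_M [simp]: "space (M x) = UNIV"
  using sets_eq_imp_space_eq[OF sets_M] by simp

text \<open>Values of a \<open>measure_of\<close> construction are accessible only after countable
  additivity is proved; it follows from strong additivity of \<open>E\<close>. Idempotence turns the
  diagonal element into a squared norm.\<close>

lemma emeasure_M:
  assumes "B \<in> sets borel"
  shows "emeasure (M x) B = ennreal ((norm (E B x))\<^sup>2)"
proof -
  have "emeasure (M x) B = ennreal (Re (cinner x (E B x)))"
  proof (rule emeasure_measure_of[OF pvm_measure_def])
    show "countably_additive (sets (M x)) (\<lambda>B. ennreal (Re (cinner x (E B x))))"
    proof (rule countably_additiveI)
      fix F :: "nat \<Rightarrow> real set"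
      assume F: "range F \<subseteq> sets (M x)" "disjoint_family F"
      then have "(\<lambda>n. inner x (E (F n) x)) sums inner x (E (\<Union>n. F n) x)"
        by (intro bounded_linear.sums[OF bounded_linear_inner_right] E_sums) auto
      moreover have "inner x (E (F n) x) \<ge> 0" for n
        using F norm_E_square[of "F n" x] by (auto simp flip: norm_E_square)
      ultimately show "(\<Sum>n. ennreal (Re (cinner x (E (F n) x)))) = ennreal (Re (cinner x (E (\<Union>n. F n) x)))"
        unfolding inner_eq_Re_cinner[symmetric] by (intro suminf_ennreal_eq) auto
    qed
  qed (use assms in \<open>auto simp: positive_def inner_eq_Re_cinner[symmetric]\<close>)
  then show ?thesis using assms by (simp add: norm_E_square inner_eq_Re_cinner)
qed

lemma finite_M: "finite_measure (M x)"
  by (rule finite_measureI) (simp add: emeasure_M)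

lemma measure_M: "B \<in> sets borel \<Longrightarrow> measure (M x) B = (norm (E B x))\<^sup>2"
  by (simp add: measure_def emeasure_M)

lemma inner_C_eq: "inner x (C x) = (\<integral>t. t \<partial>M x)"
  using resolution by (simp add: spectral_resolution_def inner_eq_Re_cinner)

lemma AE_M: "B \<in> sets borel \<Longrightarrow> E B x = x \<Longrightarrow> AE t in M x. t \<in> B"
  by (rule AE_I[where N="- B"]) (auto simp: emeasure_M E_compl)

lemma ex_support: "\<exists>b>0. \<forall>x. AE t in M x. \<bar>t\<bar> < b"
proof -
  obtain b where b: "E {-b<..<b} = id" using pvm by (auto simp: bounded_pvm_def)
  have "AE t in M x. \<bar>t\<bar> < \<bar>b\<bar> + 1" for x
    by (rule eventually_mono[OF AE_M[of "{-b<..<b}" x]]) (use b in auto)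
  then show ?thesis by (intro exI[of _ "\<bar>b\<bar> + 1"]) auto
qed

lemma integrable_M: "integrable (M x) (\<lambda>t. t)"
proof -
  interpret finite_measure "M x" by (rule finite_M)
  obtain b where "AE t in M x. \<bar>t\<bar> < b" using ex_support by blast
  then show ?thesis
    by (intro integrable_const_bound[where B=b]) (auto elim!: eventually_mono)
qed

lemma M_E:
  assumes [measurable]: "B \<in> sets borel"
  shows "M (E B x) = density (M x) (indicator B)"
proof (rule measure_eqI)
  fix A assume "A \<in> sets (M (E B x))"
  then have [measurable]: "A \<in> sets borel" by simp
  have "emeasure (density (M x) (indicator B)) A = emeasure (M x) (A \<inter> B)"
    by (simp add: emeasure_density mult.commute flip: indicator_inter_arith)
  then show "emeasure (M (E B x)) A = emeasure (density (M x) (indicator B)) A"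
    by (simp add: emeasure_M E_Int)
qed simp

lemma inner_C_E:
  assumes [measurable]: "B \<in> sets borel"
  shows "inner (E B x) (C (E B x)) = (\<integral>t. indicator B t * t \<partial>M x)"
  unfolding inner_C_eq M_E[OF assms]
  using integral_density[of "\<lambda>t. t" "M x" "indicator B"] by (simp add: ennreal_indicator)

text \<open>Splitting the integral of t over \<open>B\<close> and its complement shows that the
  quadratic form of \<open>C\<close> has no cross term between the two ranges. Hence
  \<open>C\<close> maps each range into itself, which is commutation with the projection.\<close>

lemma C_E:
  assumes B[measurable]: "B \<in> sets borel"
  shows "C (E B x) = E B (C x)"
proof -
  have Bc[measurable]: "- B \<in> sets borel" by auto
  have int: "integrable (M w) (\<lambda>t. indicator B t * t)" if [measurable]: "B \<in> sets borel" for w B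
    using integrable_M[of w] by (rule Bochner_Integration.integrable_bound) (auto split: split_indicator)
  have "inner (E B w) (C (E B w)) + inner (E (- B) w) (C (E (- B) w)) = inner w (C w)" for w
  proof -
    have "inner (E B w) (C (E B w)) + inner (E (- B) w) (C (E (- B) w))
        = (\<integral>t. indicator B t * t + indicator (- B) t * t \<partial>M w)"
      using int[OF B] int[OF Bc] by (simp add: inner_C_E)
    also have "\<dots> = (\<integral>t. t \<partial>M w)"
      by (rule Bochner_Integration.integral_cong) (auto split: split_indicator)
    finally show ?thesis by (simp add: inner_C_eq)
  qed
  then have cross: "inner (E B w) (C (E (- B) w)) = 0" for w
  proof -
    assume *: "\<And>w. inner (E B w) (C (E B w)) + inner (E (- B) w) (C (E (- B) w)) = inner w (C w)"
    have w: "w = E B w + E (- B) w" by (simp add: E_compl)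
    have "inner w (C w) = inner (E B w) (C (E B w)) + inner (E (- B) w) (C (E (- B) w))
        + inner (E B w) (C (E (- B) w)) + inner (E (- B) w) (C (E B w))"
      by (subst (1 2) w) (simp add: inner_add_left inner_add_right add)
    moreover have "inner (E (- B) w) (C (E B w)) = inner (E B w) (C (E (- B) w))"
      by (metis inner_commute symmetric)
    ultimately show ?thesis using *[of w] by linarith
  qed
  have disj: "E B (E (- B) y) = 0" "E (- B) (E B y) = 0" for y by (simp_all add: E_Int)
  \<comment> \<open>The cross term vanishes for a single \<open>w\<close>; choosing its two
    components independently separates \<open>u\<close> from \<open>v\<close>.\<close>
  have "inner (E B u) (C (E (- B) v)) = 0" for u v
    using cross[of "E B u + E (- B) v"] by (simp add: E_add E_idem disj)
  then have 1: "inner u (E B (C (E (- B) v))) = 0" and 2: "inner v (E (- B) (C (E B u))) = 0" for u v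
    by (simp_all add: E_symmetric[symmetric])
       (metis E_symmetric Bc B inner_commute symmetric)
  have "E B (C (E (- B) x)) = 0" using 1[of "E B (C (E (- B) x))" x] by simp
  then have "E B (C x) = E B (C (E B x))" by (simp add: E_compl diff E_diff)
  moreover have "E (- B) (C (E B x)) = 0" using 2[of "E (- B) (C (E B x))" x] by simp
  then have "C (E B x) = E B (C (E B x))" by (simp add: E_compl)
  ultimately show ?thesis by simp
qed

lemma
  assumes B: "B \<in> sets borel" "E B x = x"
  shows inner_C_le: "B \<subseteq> {..t} \<Longrightarrow> inner x (C x) \<le> t * inner x x"
    and inner_C_ge: "B \<subseteq> {t..} \<Longrightarrow> t * inner x x \<le> inner x (C x)"
proof -
  interpret finite_measure "M x" by (rule finite_M)
  have const: "(\<integral>s. t \<partial>M x) = t * inner x x"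
    using measure_M[of UNIV x] by (simp add: power2_norm_eq_inner)
  show "inner x (C x) \<le> t * inner x x" if "B \<subseteq> {..t}"
    unfolding inner_C_eq const[symmetric]
    using AE_M[OF B] that by (intro integral_mono_AE integrable_M) (auto elim!: eventually_mono)
  show "t * inner x x \<le> inner x (C x)" if "B \<subseteq> {t..}"
    unfolding inner_C_eq const[symmetric]
    using AE_M[OF B] that by (intro integral_mono_AE integrable_M) (auto elim!: eventually_mono)
qed

end

text \<open>With \<open>w\<close> the multiple of \<open>T x\<close> that has the norm of
  \<open>x\<close>, polarisation writes 4 <w, T x> as a difference of the quadratic form at
  \<open>x + w\<close> and \<open>x - w\<close>, and the parallelogram law sums the bounds. The
  restriction to an invariant subspace allows use on ranges of spectral projections.\<close>

lemma norm_le_numerical_radius: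
  fixes T :: "'a::real_inner \<Rightarrow> 'a"
  assumes S: "subspace S" and T: "linear T" "\<And>x. x \<in> S \<Longrightarrow> T x \<in> S"
    and sym: "\<And>x y. inner (T x) y = inner x (T y)"
    and radius: "\<And>x. x \<in> S \<Longrightarrow> \<bar>inner x (T x)\<bar> \<le> r * inner x x" and x: "x \<in> S"
  shows "norm (T x) \<le> r * norm x"
proof (cases "T x = 0 \<or> x = 0")
  case True
  then show ?thesis
  proof
    assume Tx: "T x = 0"
    have "0 \<le> r * norm x"
    proof (cases "x = 0")
      case False
      have "0 \<le> r * inner x x" "inner x x > 0" using radius[OF x] False by auto
      then show ?thesis using False by (simp add: zero_le_mult_iff)
    qed simp
    then show ?thesis using Tx by simp
  qed (simp add: linear_0[OF T(1)])
next
  case False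
  define c where "c = norm x / norm (T x)"
  define w where "w = c *\<^sub>R T x"
  have nw: "norm w = norm x" using False by (simp add: w_def c_def)
  have w: "w \<in> S" unfolding w_def by (intro subspace_scale S T x)
  have "inner (x + w) (T (x + w)) - inner (x - w) (T (x - w)) = 2 * inner x (T w) + 2 * inner w (T x)"
    by (simp add: linear_add[OF T(1)] linear_diff[OF T(1)] inner_add_left inner_add_right
        inner_diff_left inner_diff_right)
  also have "\<dots> = 4 * inner w (T x)" using sym[of x w] by (simp add: inner_commute)
  also have "inner w (T x) = norm x * norm (T x)"
    using False by (simp add: w_def c_def power2_norm_eq_inner[symmetric] power2_eq_square)
  finally have "4 * (norm x * norm (T x)) = inner (x + w) (T (x + w)) - inner (x - w) (T (x - w))" by simp
  also have "\<dots> \<le> r * inner (x + w) (x + w) + r * inner (x - w) (x - w)"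
    using radius[of "x + w"] radius[of "x - w"] subspace_add[OF S x w] subspace_diff[OF S x w] by linarith
  also have "\<dots> = 2 * r * (inner x x + inner w w)"
    by (simp add: inner_add_left inner_add_right inner_diff_left inner_diff_right algebra_simps)
  also have "\<dots> = 4 * (norm x * (r * norm x))"
    unfolding power2_norm_eq_inner[symmetric] nw by (simp add: power2_eq_square)
  finally show ?thesis using False by (simp add: mult_le_cancel_left_pos)
qed

context resolved_operator
begin

lemma subspace_range_E: "B \<in> sets borel \<Longrightarrow> subspace {x. E B x = x}"
  by (rule subspaceI) (auto simp: E_zero E_add linear_scale[OF linear_E])

lemma norm_C_shift_le:
  assumes B: "B \<in> sets borel" "B \<subseteq> {s - r..s + r}" and x: "E B x = x"
  shows "norm (C x - s *\<^sub>R x) \<le> r * norm x"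
proof (rule norm_le_numerical_radius[where S="{x. E B x = x}"])
  show "linear (\<lambda>x. C x - s *\<^sub>R x)"
    by (intro linear_compose_sub bounded_linear.linear[OF bounded_linear] linear_scale_self)
  show "C y - s *\<^sub>R y \<in> {x. E B x = x}" if "y \<in> {x. E B x = x}" for y
    using that B by (simp add: E_diff linear_scale[OF linear_E] flip: C_E)
  show "\<bar>inner y (C y - s *\<^sub>R y)\<bar> \<le> r * inner y y" if "y \<in> {x. E B x = x}" for y
  proof -
    have "inner y (C y) \<le> (s + r) * inner y y"
      by (rule inner_C_le[OF B(1)]) (use that B in auto)
    moreover have "(s - r) * inner y y \<le> inner y (C y)"
      by (rule inner_C_ge[OF B(1)]) (use that B in auto)
    ultimately show ?thesis by (auto simp: inner_diff_right algebra_simps abs_le_iff)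
  qed
qed (use x B subspace_range_E in \<open>auto simp: inner_diff_left inner_diff_right symmetric\<close>)

end


section \<open>Intertwining operators\<close>

lemma geometric_domination_zero:
  fixes u v :: real
  assumes "0 \<le> \<alpha>" "\<alpha> < \<beta>" "0 \<le> u" "\<And>n. \<beta> ^ n * u \<le> \<alpha> ^ n * v"
  shows "u = 0"
proof -
  have "(\<lambda>n. (\<alpha> / \<beta>) ^ n * v) \<longlonglongrightarrow> 0 * v"
    using assms by (intro tendsto_intros LIMSEQ_power_zero) auto
  moreover have "u \<le> (\<alpha> / \<beta>) ^ n * v" for n
    using assms(4)[of n] assms(1,2) by (simp add: power_divide field_simps)
  ultimately have "u \<le> 0 * v" by (intro LIMSEQ_le_const) auto
  then show ?thesis using \<open>0 \<le> u\<close> by simp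
qed

text \<open>Symmetry of \<open>T\<close> yields the reverse relation
  \<open>A (T x) = T (C x)\<close> by taking adjoints, so the two operators can be
  exchanged.\<close>

locale intertwining =
  C: resolved_operator C E + A: resolved_operator A F
  for C :: "'a::complex_hilbert_space \<Rightarrow> 'a" and E and A :: "'a \<Rightarrow> 'a" and F +
  fixes T :: "'a \<Rightarrow> 'a"
  assumes bounded_linear_T: "bounded_linear T"
    and symmetric_T: "inner (T x) y = inner x (T y)"
    and intertwine: "C (T x) = T (A x)"
begin

lemma linear_T: "linear T"
  by (intro bounded_linear.linear bounded_linear_T)

text \<open>On the range of \<open>F {t<..}\<close> the operator \<open>c - A\<close> has norm at most \<open>c - t\<close>, while on the range
  of \<open>E {..s}\<close> the operator \<open>c - C\<close> expands by at least \<open>c - s\<close>. Comparing powers of both sides of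
  \<open>(c - C) X = X (c - A)\<close> shows that \<open>X = E {..s} T F {t<..}\<close> vanishes.\<close>

lemma separated_zero:
  assumes "s < t"
  shows "E {..s} (T (F {t<..} x)) = 0"
proof -
  obtain K where K: "\<And>y. norm (A y) \<le> norm y * K"
    using bounded_linear.bounded[OF A.bounded_linear] by blast
  \<comment> \<open>The term with \<open>K\<close> makes c - A nonnegative, so that only its upper
    bound c - t matters on the range of \<open>F {t<..}\<close>. Being above \<open>t\<close>, the
    constant also puts (c - t) / (c - s) between 0 and 1.\<close>
  define c where "c = \<bar>K\<bar> + \<bar>t\<bar> + 1"
  have "c > t" by (simp add: c_def)
  have A_le: "inner y (A y) \<le> c * inner y y" for y
  proof -
    have "inner y (A y) \<le> norm y * norm (A y)" by (rule norm_cauchy_schwarz)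
    also have "\<dots> \<le> norm y * (norm y * c)"
      using K[of y] mult_left_mono[of K c "norm y"]
      by (intro mult_left_mono) (auto simp: c_def intro: order_trans)
    finally show ?thesis by (simp add: power2_norm_eq_inner[symmetric] power2_eq_square mult_ac)
  qed
  define DA DC where "DA y = c *\<^sub>R y - A y" and "DC y = c *\<^sub>R y - C y" for y
  define X where "X y = E {..s} (T y)" for y
  have [measurable]: "{t<..} \<in> sets borel" "{..s} \<in> sets borel" by auto
  have X_DA: "X (DA y) = DC (X y)" for y
    by (simp add: X_def DA_def DC_def linear_diff[OF linear_T] linear_scale[OF linear_T]
        C.E_diff linear_scale[OF C.linear_E] C.C_E flip: intertwine)
  have X_pow: "X ((DA ^^ n) y) = (DC ^^ n) (X y)" for n y
    by (induction n) (simp_all add: X_DA)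
  have DA_le: "F {t<..} (DA y) = DA y \<and> norm (DA y) \<le> (c - t) * norm y" if "F {t<..} y = y" for y
  proof
    have inv: "F {t<..} (DA y) = DA y" if "F {t<..} y = y" for y
      using that by (simp add: DA_def A.E_diff linear_scale[OF A.linear_E] flip: A.C_E)
    then show "F {t<..} (DA y) = DA y" using that .
    show "norm (DA y) \<le> (c - t) * norm y"
    proof (rule norm_le_numerical_radius[where S="{y. F {t<..} y = y}"])
      show "linear DA"
        unfolding DA_def
        by (intro linear_compose_sub linear_scale_self bounded_linear.linear[OF A.bounded_linear])
      show "\<bar>inner z (DA z)\<bar> \<le> (c - t) * inner z z" if "z \<in> {y. F {t<..} y = y}" for z
      proof -
        have "t * inner z z \<le> inner z (A z)"
          by (rule A.inner_C_ge[of "{t<..}"]) (use that in auto)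
        then show ?thesis using A_le[of z]
          by (auto simp: DA_def inner_diff_right algebra_simps abs_le_iff)
      qed
    qed (use that inv A.subspace_range_E in \<open>auto simp: DA_def inner_diff_left inner_diff_right A.symmetric\<close>)
  qed
  have DA_pow: "F {t<..} ((DA ^^ n) y) = (DA ^^ n) y \<and> norm ((DA ^^ n) y) \<le> (c - t) ^ n * norm y"
    if "F {t<..} y = y" for n y
  proof (induction n)
    case (Suc n)
    have "norm (DA ((DA ^^ n) y)) \<le> (c - t) * norm ((DA ^^ n) y)" using DA_le Suc by blast
    also have "\<dots> \<le> (c - t) * ((c - t) ^ n * norm y)"
      using Suc \<open>c > t\<close> by (intro mult_left_mono) auto
    finally show ?case using DA_le[of "(DA ^^ n) y"] Suc by simp
  qed (use that in auto)
  have DC_ge: "(c - s) * norm y \<le> norm (DC y)" and DC_inv: "E {..s} (DC y) = DC y" if "E {..s} y = y" for y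
  proof -
    show "E {..s} (DC y) = DC y"
      using that by (simp add: DC_def C.E_diff linear_scale[OF C.linear_E] flip: C.C_E)
    have "inner y (C y) \<le> s * inner y y"
      by (rule C.inner_C_le[of "{..s}"]) (use that in auto)
    then have "norm y * ((c - s) * norm y) \<le> inner y (DC y)"
      by (simp add: DC_def inner_diff_right power2_norm_eq_inner[symmetric] power2_eq_square algebra_simps)
    also have "\<dots> \<le> norm y * norm (DC y)" by (rule norm_cauchy_schwarz)
    finally show "(c - s) * norm y \<le> norm (DC y)"
      by (cases "y = 0") (auto simp: mult_le_cancel_left_pos)
  qed
  have DC_pow: "E {..s} ((DC ^^ n) y) = (DC ^^ n) y \<and> (c - s) ^ n * norm y \<le> norm ((DC ^^ n) y)"
    if "E {..s} y = y" for n y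
  proof (induction n)
    case (Suc n)
    have "(c - s) * ((c - s) ^ n * norm y) \<le> (c - s) * norm ((DC ^^ n) y)"
      using Suc \<open>c > t\<close> \<open>s < t\<close> by (intro mult_left_mono) auto
    also have "\<dots> \<le> norm (DC ((DC ^^ n) y))" using DC_ge Suc by blast
    finally show ?case using DC_inv[of "(DC ^^ n) y"] Suc by (simp add: mult.assoc)
  qed (use that in auto)
  have "bounded_linear X"
    unfolding X_def by (intro bounded_linear_compose[OF C.bounded_linear_E] bounded_linear_T) auto
  then obtain L where L: "L \<ge> 0" "\<And>y. norm (X y) \<le> norm y * L"
    using bounded_linear.nonneg_bounded by blast
  define v where "v = F {t<..} x"
  have v: "F {t<..} v = v" by (simp add: v_def A.E_idem)
  have Xv: "E {..s} (X v) = X v" by (simp add: X_def C.E_idem)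
  have "norm (X v) = 0"
  proof (rule geometric_domination_zero[of "c - t" "c - s" _ "norm v * L"])
    fix n
    have "(c - s) ^ n * norm (X v) \<le> norm (X ((DA ^^ n) v))"
      using DC_pow[OF Xv] by (simp add: X_pow)
    also have "\<dots> \<le> norm ((DA ^^ n) v) * L" by (rule L)
    also have "\<dots> \<le> ((c - t) ^ n * norm v) * L"
      using DA_pow[OF v] L by (intro mult_right_mono) auto
    finally show "(c - s) ^ n * norm (X v) \<le> (c - t) ^ n * (norm v * L)" by (simp add: mult.assoc)
  qed (use \<open>c > t\<close> \<open>s < t\<close> in auto)
  then show ?thesis by (simp add: X_def v_def)
qed

text \<open>The gap between \<open>s\<close> and \<open>t\<close> is closed by cutting off a
  half-open interval of length 1 / (n + 1) to the right of \<open>s\<close>; its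
  \<open>F\<close>-part tends to 0 since these intervals shrink to the empty set.\<close>

lemma adjacent_zero: "E {..s} (T (F {s<..} x)) = 0"
proof -
  interpret M: finite_measure "A.M x" by (rule A.finite_M)
  define I where "I n = {s<..s + 1 / real (Suc n)}" for n
  have [measurable]: "I n \<in> sets borel" for n by (auto simp: I_def)
  have "bounded_linear (\<lambda>y. E {..s} (T y))"
    by (intro bounded_linear_compose[OF C.bounded_linear_E] bounded_linear_T) auto
  then obtain L where L: "L \<ge> 0" "\<And>y. norm (E {..s} (T y)) \<le> norm y * L"
    using bounded_linear.nonneg_bounded by blast
  have "norm (E {..s} (T (F {s<..} x))) \<le> norm (F (I n) x) * L" for n
  proof -
    have "{s<..} = {s<..t} \<union> {t<..}" if "s < t" for t using that by auto
    from this[of "s + 1 / real (Suc n)"]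
    have "{s<..} = I n \<union> {s + 1 / real (Suc n)<..}" by (simp add: I_def)
    moreover have "F (I n \<union> {s + 1 / real (Suc n)<..}) x = F (I n) x + F {s + 1 / real (Suc n)<..} x"
      by (rule A.E_Un) (auto simp: I_def)
    ultimately have "F {s<..} x = F (I n) x + F {s + 1 / real (Suc n)<..} x" by (simp only:)
    then have "E {..s} (T (F {s<..} x)) = E {..s} (T (F (I n) x)) + E {..s} (T (F {s + 1 / real (Suc n)<..} x))"
      by (simp only: linear_add[OF linear_T] C.E_add[OF borel_closed[OF closed_atMost]])
    moreover have "E {..s} (T (F {s + 1 / real (Suc n)<..} x)) = 0"
      by (rule separated_zero) simp
    ultimately have "E {..s} (T (F {s<..} x)) = E {..s} (T (F (I n) x))" by simp
    then show ?thesis using L by simp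
  qed
  moreover have "(\<lambda>n. norm (F (I n) x) * L) \<longlonglongrightarrow> 0"
  proof -
    have "(\<lambda>n. measure (A.M x) (I n)) \<longlonglongrightarrow> measure (A.M x) (\<Inter>n. I n)"
    proof (rule M.finite_Lim_measure_decseq)
      show "decseq I"
        unfolding decseq_def
      proof (intro allI impI)
        fix m n :: nat assume "m \<le> n"
        then have "1 / real (Suc n) \<le> 1 / real (Suc m)" by (intro frac_le) auto
        then show "I n \<subseteq> I m" by (auto simp: I_def)
      qed
    qed auto
    moreover have "(\<Inter>n. I n) = {}"
    proof -
      have False if "\<And>n. y \<in> I n" for y
      proof -
        have "y > s" using that[of 0] by (simp add: I_def)
        then obtain n where "1 / real (Suc n) < y - s"
          using reals_Archimedean[of "y - s"] by (auto simp: inverse_eq_divide)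
        then show False using that[of n] by (simp add: I_def)
      qed
      then show ?thesis by auto
    qed
    ultimately have "(\<lambda>n. (norm (F (I n) x))\<^sup>2) \<longlonglongrightarrow> 0" by (simp add: A.measure_M)
    then have "(\<lambda>n. sqrt ((norm (F (I n) x))\<^sup>2) * L) \<longlonglongrightarrow> sqrt 0 * L" by (intro tendsto_intros)
    then show ?thesis by simp
  qed
  ultimately have "norm (E {..s} (T (F {s<..} x))) \<le> 0" by (intro LIMSEQ_le_const) auto
  then show ?thesis by simp
qed

lemma intertwining_swap: "intertwining A F C E T"
proof (intro intertwining.intro intertwining_axioms.intro A.resolved_operator_axioms
    C.resolved_operator_axioms bounded_linear_T symmetric_T)
  fix x
  have "inner (A (T x)) y = inner (T (C x)) y" for y
    by (simp add: A.symmetric symmetric_T intertwine C.symmetric)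
  then show "A (T x) = T (C x)" by (metis inner_commute vector_eq_rdot)
qed

text \<open>Both off-diagonal blocks of \<open>T\<close> vanish: one is
  \<open>adjacent_zero\<close>, the other is the adjoint of the same fact with the operators
  exchanged.\<close>

lemma resolution_intertwine_atMost: "E {..s} (T x) = T (F {..s} x)"
proof -
  interpret swap: intertwining A F C E T by (rule intertwining_swap)
  have B: "{..s} \<in> sets borel" "- {..s} = {s<..}" "{s<..} \<in> sets borel" by auto
  have x: "x = F {..s} x + F {s<..} x" for x using A.E_compl[OF B(1), of x] unfolding B by simp
  have y: "y = E {..s} y + E {s<..} y" for y using C.E_compl[OF B(1), of y] unfolding B by simp
  have "inner (E {s<..} (T (F {..s} x))) y = 0" for y
    using swap.adjacent_zero[of s y] B by (simp add: C.E_symmetric symmetric_T A.E_symmetric)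
  then have 1: "E {s<..} (T (F {..s} x)) = 0" by (metis inner_eq_zero_iff)
  have "E {..s} (T x) = E {..s} (T (F {..s} x))"
    by (subst x[of x]) (simp add: linear_add[OF linear_T] C.E_add adjacent_zero)
  also have "\<dots> = T (F {..s} x)" using y[of "T (F {..s} x)"] 1 by simp
  finally show ?thesis .
qed

text \<open>Both sides are countably additive in \<open>B\<close> and respect complements, so the
  identity spreads from the intersection-stable half-lines to all Borel sets.\<close>

theorem resolution_intertwine:
  assumes "B \<in> sets borel"
  shows "E B (T x) = T (F B x)"
proof -
  have gen: "sets (borel :: real measure) = sigma_sets UNIV (range (\<lambda>a. {..a}))"
    by (subst borel_eq_atMost) (simp add: sets_measure_of)
  have stable: "Int_stable (range (\<lambda>a::real. {..a}))"
    by (auto simp: Int_stable_def)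
  have "range (\<lambda>a::real. {..a}) \<subseteq> Pow UNIV" by simp
  from stable this assms[unfolded gen] have "\<forall>x. E B (T x) = T (F B x)"
  proof (induction rule: sigma_sets_induct_disjoint)
    case (basic A)
    then show ?case by (auto simp: resolution_intertwine_atMost)
  next
    case empty
    show ?case by (simp add: linear_0[OF linear_T])
  next
    case (compl B)
    then have "B \<in> sets borel" by (simp add: gen)
    then show ?case using compl(2)
      by (simp add: Compl_eq_Diff_UNIV[symmetric] C.E_compl A.E_compl linear_diff[OF linear_T])
  next
    case (union G)
    have G: "G n \<in> sets borel" for n using union by (auto simp: gen)
    show ?case
    proof
      fix x
      have "(\<lambda>n. E (G n) (T x)) sums E (\<Union>n. G n) (T x)"
        by (rule C.E_sums) (use G union in auto)
      moreover have "(\<lambda>n. T (F (G n) x)) sums T (F (\<Union>n. G n) x)"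
        by (rule bounded_linear.sums[OF bounded_linear_T A.E_sums]) (use G union in auto)
      ultimately show "E (\<Union>n. G n) (T x) = T (F (\<Union>n. G n) x)"
        using union(3) by (simp add: sums_unique2)
    qed
  qed
  then show ?thesis by blast
qed

end


section \<open>Density of a measure at Lebesgue null sets\<close>

definition dyadic_cell :: "nat \<Rightarrow> int \<Rightarrow> real set" where
  "dyadic_cell n j = {real_of_int j / 2 ^ n ..< (real_of_int j + 1) / 2 ^ n}"

lemma mem_dyadic_cell: "y \<in> dyadic_cell n j \<longleftrightarrow> \<lfloor>2 ^ n * y\<rfloor> = j"
  by (auto simp: dyadic_cell_def floor_eq_iff field_simps)

lemma dyadic_cell_borel [measurable]: "dyadic_cell n j \<in> sets borel"
  by (simp add: dyadic_cell_def)

lemma emeasure_lborel_dyadic_cell: "emeasure lborel (dyadic_cell n j) = ennreal (1 / 2 ^ n)"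
  by (simp add: dyadic_cell_def divide_right_mono diff_divide_distrib[symmetric])

lemma dyadic_cell_near:
  assumes "x \<in> dyadic_cell n j"
  shows "dyadic_cell n j \<subseteq> {x - 1 / 2 ^ n..x + 1 / 2 ^ n}"
  using assms by (auto simp: dyadic_cell_def field_simps)

text \<open>Dyadic cells are nested: the index at level \<open>m\<close> is the index at level
  \<open>n\<close> divided by a power of two, rounded down.\<close>

lemma floor_dyadic_coarser:
  assumes "m \<le> n" "\<lfloor>2 ^ n * (x::real)\<rfloor> = \<lfloor>2 ^ n * (y::real)\<rfloor>"
  shows "\<lfloor>2 ^ m * x\<rfloor> = \<lfloor>2 ^ m * y\<rfloor>"
proof -
  have "\<lfloor>2 ^ m * z\<rfloor> = \<lfloor>2 ^ n * z\<rfloor> div 2 ^ (n - m)" for z :: real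
  proof -
    have "2 ^ m * z = 2 ^ n * z / real_of_int (2 ^ (n - m))"
    proof -
      have "(2::real) ^ n = 2 ^ m * 2 ^ (n - m)" using assms(1) by (simp flip: power_add)
      then show ?thesis by simp
    qed
    then show ?thesis by (simp only: floor_divide_real_eq_div zero_le_power zero_le_numeral)
  qed
  then show ?thesis using assms(2) by simp
qed

text \<open>The points at which the lower dyadic derivative of \<open>\<kappa>\<close> with respect
  to Lebesgue measure is infinite; the factor \<open>2 ^ n\<close> is the reciprocal length of a
  cell.\<close>

definition infinite_density :: "real measure \<Rightarrow> real set" where
  "infinite_density \<kappa> = {x. \<forall>k::nat. \<exists>m. \<forall>n\<ge>m. real k \<le> 2 ^ n * measure \<kappa> (dyadic_cell n \<lfloor>2 ^ n * x\<rfloor>)}"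

lemma density_bound_measurable [measurable]:
  "(\<lambda>x::real. 2 ^ n * measure \<kappa> (dyadic_cell n \<lfloor>2 ^ n * x\<rfloor>) :: real) \<in> borel_measurable borel"
proof -
  have "(\<lambda>x::real. \<lfloor>2 ^ n * x\<rfloor>) \<in> measurable borel (count_space UNIV)"
    by measurable
  then show ?thesis by measurable
qed

lemma infinite_density_borel [measurable]: "infinite_density \<kappa> \<in> sets borel"
proof -
  define f where "f n x = 2 ^ n * measure \<kappa> (dyadic_cell n \<lfloor>2 ^ n * x\<rfloor>)" for n and x :: real
  have [measurable]: "f n \<in> borel_measurable borel" for n
    unfolding f_def by (rule density_bound_measurable)
  have "{x \<in> space borel. \<forall>k::nat. \<exists>m. \<forall>n\<ge>m. real k \<le> f n x} \<in> sets borel"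
    by measurable
  then show ?thesis by (simp add: infinite_density_def f_def)
qed

text \<open>The maximal dyadic cells inside an open neighbourhood \<open>U\<close> of \<open>N\<close> on which \<open>\<kappa>\<close> is at most
  \<open>k\<close> times Lebesgue measure are disjoint, so they carry \<open>\<kappa>\<close>-mass at most \<open>k\<close> times the Lebesgue
  measure of \<open>U\<close>.\<close>

lemma finite_density_null:
  assumes "finite_measure \<kappa>" and sets_\<kappa>: "sets \<kappa> = sets borel"
    and N: "N \<in> sets borel" "emeasure lborel N = 0"
  shows "emeasure \<kappa> (N - infinite_density \<kappa>) = 0"
proof -
  interpret finite_measure \<kappa> by fact
  note [measurable_cong] = sets_\<kappa>
  note [measurable] = N(1)
  define P where "P k = {x \<in> N. \<forall>m. \<exists>n\<ge>m. 2 ^ n * measure \<kappa> (dyadic_cell n \<lfloor>2 ^ n * x\<rfloor>) < real k}" for k :: nat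
  have P_meas: "P k \<in> sets borel" for k
  proof -
    define f where "f n x = 2 ^ n * measure \<kappa> (dyadic_cell n \<lfloor>2 ^ n * x\<rfloor>)" for n and x :: real
    have [measurable]: "f n \<in> borel_measurable borel" for n
      unfolding f_def by (rule density_bound_measurable)
    have "{x \<in> space borel. x \<in> N \<and> (\<forall>m. \<exists>n\<ge>m. f n x < real k)} \<in> sets borel"
      by measurable
    then show ?thesis by (simp add: P_def f_def)
  qed
  have P_le: "emeasure \<kappa> (P k) \<le> ennreal (real k) * ennreal e" if "e > 0" for k and e :: real
  proof -
    obtain U where U: "open U" "N \<subseteq> U" "emeasure lborel (U - N) \<le> e"
      using outer_regular_lborel_le[OF N(1) \<open>e > 0\<close>] by blast
    have [measurable]: "U \<in> sets borel" using U(1) by auto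
    have "emeasure lborel U = emeasure lborel (U - N)"
      using U N by (intro emeasure_Diff_null_set[symmetric]) auto
    then have U_le: "emeasure lborel U \<le> ennreal e" using U(3) by simp
    define good where "good n j \<longleftrightarrow> dyadic_cell n j \<subseteq> U \<and> 2 ^ n * measure \<kappa> (dyadic_cell n j) < real k" for n j
    have ex_good: "\<exists>n. good n \<lfloor>2 ^ n * x\<rfloor>" if "x \<in> P k" for x
    proof -
      have "x \<in> U" using that U by (auto simp: P_def)
      then obtain r where r: "r > 0" "ball x r \<subseteq> U" using U(1) open_contains_ball by blast
      obtain m where m: "(1 / 2) ^ m < r" using real_arch_pow_inv[OF r(1), of "1 / 2"] by auto
      have "\<exists>n\<ge>m. 2 ^ n * measure \<kappa> (dyadic_cell n \<lfloor>2 ^ n * x\<rfloor>) < real k"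
        using that by (simp add: P_def)
      then obtain n where n: "n \<ge> m" "2 ^ n * measure \<kappa> (dyadic_cell n \<lfloor>2 ^ n * x\<rfloor>) < real k"
        by blast
      have "(1 / 2 :: real) ^ n \<le> (1 / 2) ^ m" using n by (intro power_decreasing) auto
      then have "1 / 2 ^ n < r" using m by (simp add: power_one_over)
      then have "{x - 1 / 2 ^ n..x + 1 / 2 ^ n} \<subseteq> ball x r" by (auto simp: dist_real_def)
      then have "dyadic_cell n \<lfloor>2 ^ n * x\<rfloor> \<subseteq> U"
        using dyadic_cell_near[of x n "\<lfloor>2 ^ n * x\<rfloor>"] r(2) by (auto simp: mem_dyadic_cell)
      then show ?thesis using n by (auto simp: good_def)
    qed
    \<comment> \<open>The least good level belongs to the largest good cell around
      \<open>x\<close>.\<close>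
    define lev where "lev x = (LEAST n. good n \<lfloor>2 ^ n * x\<rfloor>)" for x :: real
    have lev: "good (lev x) \<lfloor>2 ^ lev x * x\<rfloor>" if "x \<in> P k" for x
      unfolding lev_def by (rule LeastI_ex[OF ex_good[OF that]])
    define J where "J = (\<lambda>x. (lev x, \<lfloor>2 ^ lev x * x\<rfloor>)) ` P k"
    define cell where "cell p = dyadic_cell (fst p) (snd p)" for p
    have good_J: "good (fst p) (snd p)" if "p \<in> J" for p using that lev by (auto simp: J_def)
    \<comment> \<open>If two selected cells share a point \<open>y\<close>, nestedness puts
      \<open>x'\<close> into the coarser one. That cell is then good for \<open>x'\<close> too, and
      minimality of its level forces the cells to coincide.\<close>
    have eqI: "(lev x, \<lfloor>2 ^ lev x * x\<rfloor>) = (lev x', \<lfloor>2 ^ lev x' * x'\<rfloor>)"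
      if x: "x \<in> P k" "x' \<in> P k" and y: "\<lfloor>2 ^ lev x * y\<rfloor> = \<lfloor>2 ^ lev x * x\<rfloor>" "\<lfloor>2 ^ lev x' * y\<rfloor> = \<lfloor>2 ^ lev x' * x'\<rfloor>"
        and le: "lev x \<le> lev x'" for x x' y :: real
    proof -
      have e: "\<lfloor>2 ^ lev x * x'\<rfloor> = \<lfloor>2 ^ lev x * x\<rfloor>"
        using floor_dyadic_coarser[OF le y(2)] y(1) by simp
      then have "good (lev x) \<lfloor>2 ^ lev x * x'\<rfloor>" using lev[OF x(1)] by simp
      then have "lev x' \<le> lev x" unfolding lev_def[of x'] by (rule Least_le)
      then have "lev x = lev x'" using le by simp
      then show ?thesis using e by simp
    qed
    have disj: "disjoint_family_on cell J"
      unfolding disjoint_family_on_def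
    proof (intro ballI impI)
      fix p q assume pq: "p \<in> J" "q \<in> J" "p \<noteq> q"
      then obtain x x' where x: "x \<in> P k" "x' \<in> P k"
        "p = (lev x, \<lfloor>2 ^ lev x * x\<rfloor>)" "q = (lev x', \<lfloor>2 ^ lev x' * x'\<rfloor>)" by (auto simp: J_def)
      have False if "y \<in> cell p" "y \<in> cell q" for y
        using eqI[OF x(1,2), of y] eqI[OF x(2,1), of y] that pq(3) x
        by (cases "lev x \<le> lev x'") (auto simp: cell_def mem_dyadic_cell)
      then show "cell p \<inter> cell q = {}" by auto
    qed
    have cnt: "countable J" by (rule countableI_type)
    have cell_meas[measurable]: "cell p \<in> sets borel" for p by (simp add: cell_def)
    have "P k \<subseteq> (\<Union>p\<in>J. cell p)" by (auto simp: J_def cell_def mem_dyadic_cell)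
    then have "emeasure \<kappa> (P k) \<le> emeasure \<kappa> (\<Union>p\<in>J. cell p)"
      using cnt by (intro emeasure_mono) (auto simp: sets_\<kappa>)
    also have "\<dots> = (\<integral>\<^sup>+p. emeasure \<kappa> (cell p) \<partial>count_space J)"
      using cnt disj by (intro emeasure_UN_countable) (auto simp: sets_\<kappa>)
    also have "\<dots> \<le> (\<integral>\<^sup>+p. ennreal (real k) * emeasure lborel (cell p) \<partial>count_space J)"
    proof (rule nn_integral_mono)
      fix p assume "p \<in> space (count_space J)"
      then have "2 ^ fst p * measure \<kappa> (cell p) < real k" using good_J[of p] by (simp add: good_def cell_def)
      then have "measure \<kappa> (cell p) \<le> real k * (1 / 2 ^ fst p)" by (simp add: field_simps)
      then show "emeasure \<kappa> (cell p) \<le> ennreal (real k) * emeasure lborel (cell p)"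
        unfolding cell_def emeasure_lborel_dyadic_cell emeasure_eq_measure
        by (subst ennreal_mult[symmetric]) (auto intro: ennreal_leI)
    qed
    also have "\<dots> = ennreal (real k) * (\<integral>\<^sup>+p. emeasure lborel (cell p) \<partial>count_space J)"
      by (intro nn_integral_cmult) auto
    also have "(\<integral>\<^sup>+p. emeasure lborel (cell p) \<partial>count_space J) = emeasure lborel (\<Union>p\<in>J. cell p)"
      using cnt disj by (intro emeasure_UN_countable[symmetric]) auto
    also have "\<dots> \<le> emeasure lborel U"
      using good_J by (intro emeasure_mono) (auto simp: good_def cell_def)
    also note U_le
    finally show ?thesis by (simp add: mult_left_mono)
  qed
  have P0: "emeasure \<kappa> (P k) = 0" for k
  proof -
    have "measure \<kappa> (P k) \<le> 0 + e" if "e > 0" for e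
    proof -
      have "emeasure \<kappa> (P k) \<le> ennreal (real k * (e / (real k + 1)))"
        using P_le[of "e / (real k + 1)" k] that by (subst ennreal_mult) auto
      then have "measure \<kappa> (P k) \<le> real k * (e / (real k + 1))"
        using that by (simp add: emeasure_eq_measure)
      also have "\<dots> \<le> e" using that by (simp add: field_simps)
      finally show ?thesis by simp
    qed
    then have "measure \<kappa> (P k) \<le> 0" by (rule field_le_epsilon)
    then show ?thesis by (simp add: emeasure_eq_measure measure_le_0_iff)
  qed
  have "N - infinite_density \<kappa> = (\<Union>k. P k)"
    unfolding P_def infinite_density_def not_le[symmetric] by blast
  also have "emeasure \<kappa> \<dots> = 0"
    using P0 P_meas by (intro emeasure_UN_eq_0) (auto simp: sets_\<kappa>)
  finally show ?thesis .
qed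


section \<open>Resolvents and rank one perturbations\<close>

lemma cinner_diff_right: "cinner x (y - z) = cinner x y - cinner x z"
  using cinner_add_right[of x "y - z" z] by simp

lemma cinner_scaleR_right: "cinner x (r *\<^sub>R y) = complex_of_real r * cinner x y"
  by (simp add: scaleR_eq_scaleC cinner_scaleC_right)

lemma norm_diff_orthogonal:
  assumes "inner p q = 0"
  shows "(norm (p - r *\<^sub>R q))\<^sup>2 = (norm p)\<^sup>2 + r\<^sup>2 * (norm q)\<^sup>2"
proof -
  have "inner q p = 0" using assms by (simp add: inner_commute)
  then have "inner (p - r *\<^sub>R q) (p - r *\<^sub>R q) = inner p p + r * r * inner q q"
    using assms by (simp add: inner_diff_left inner_diff_right)
  then show ?thesis by (simp only: power2_norm_eq_inner power2_eq_square[of r])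
qed

context resolved_operator
begin

lemma scaleC: "C (c *\<^sub>C x) = c *\<^sub>C C x"
  using selfadjoint by (simp add: bounded_selfadjoint_def)

lemma inner_i_symmetric: "inner y (\<i> *\<^sub>C (C y - s *\<^sub>R y)) = 0"
proof -
  have "cinner y (C y) = complex_of_real (inner y (C y))"
    using selfadjoint by (intro cinner_selfadjoint_real) (simp add: bounded_selfadjoint_def)
  then have "Im (cinner y (C y)) = 0" by (metis Im_complex_of_real)
  moreover have "Im (cinner y y) = 0"
    using cinner_selfadjoint_real[of "\<lambda>y. y" y] by (metis Im_complex_of_real)
  ultimately show ?thesis
    by (simp add: inner_eq_Re_cinner cinner_scaleC_right cinner_diff_right cinner_scaleR_right)
qed

text \<open>Pythagoras: the quadratic form of \<open>C\<close> is real, so (C - s) y and \<i> y are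
  orthogonal in the real inner product.\<close>

lemma norm_shift_i:
  "(norm (C y - s *\<^sub>R y - r *\<^sub>R \<i> *\<^sub>C y))\<^sup>2 = (norm (C y - s *\<^sub>R y))\<^sup>2 + r\<^sup>2 * (norm y)\<^sup>2"
proof -
  have "inner (C y - s *\<^sub>R y) (\<i> *\<^sub>C y) = 0"
  proof -
    have "inner (\<i> *\<^sub>C v) (\<i> *\<^sub>C u) = inner v u" for u v :: 'a
      by (simp add: inner_eq_Re_cinner cinner_scaleC_left cinner_scaleC_right)
    then have "inner (C y - s *\<^sub>R y) (\<i> *\<^sub>C y) = inner (\<i> *\<^sub>C (C y - s *\<^sub>R y)) (\<i> *\<^sub>C \<i> *\<^sub>C y)" by metis
    also have "\<i> *\<^sub>C \<i> *\<^sub>C y = - y"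
      using scaleR_eq_scaleC[of "-1" y] by (simp add: scaleC_scaleC)
    finally show ?thesis using inner_i_symmetric[of y s] by (simp add: inner_commute)
  qed
  then show ?thesis by (simp add: norm_diff_orthogonal norm_scaleC)
qed

text \<open>Multiplying the equation by \<open>\<i>\<close> makes it coercive, \<open>Re \<langle>u, (r + \<i> (C - s)) u\<rangle> = r \<parallel>u\<parallel>\<^sup>2\<close>, so that it
  is the fixed point equation of a contraction.\<close>

lemma ex_resolvent_vector:
  assumes "r > 0"
  shows "\<exists>u. C u - s *\<^sub>R u - r *\<^sub>R \<i> *\<^sub>C u = v"
proof -
  define T where "T y = C y - s *\<^sub>R y" for y
  define J where "J y = \<i> *\<^sub>C y" for y :: 'a
  have lin: "bounded_linear T"
    unfolding T_def by (intro bounded_linear_sub bounded_linear bounded_linear_scaleR_right)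
  have J: "bounded_linear J" unfolding J_def by (rule bounded_linear_scaleC)
  have JJ: "J (J y) = - y" for y
    using scaleR_eq_scaleC[of "-1" y] by (simp add: J_def scaleC_scaleC)
  obtain K where K: "K > 0" "\<And>y. norm (T y) \<le> norm y * K"
    using bounded_linear.pos_bounded[OF lin] by blast
  \<comment> \<open>This step size minimises (1 - t r)^2 + t^2 K^2, the bound for the squared
    contraction factor; \<open>c\<close> is the root of the minimum.\<close>
  define t where "t = r / (r\<^sup>2 + K\<^sup>2)"
  define c where "c = sqrt (1 - r\<^sup>2 / (r\<^sup>2 + K\<^sup>2))"
  have pos: "r\<^sup>2 + K\<^sup>2 > 0" using assms by (simp add: add_pos_nonneg)
  have frac: "0 \<le> 1 - r\<^sup>2 / (r\<^sup>2 + K\<^sup>2)" "1 - r\<^sup>2 / (r\<^sup>2 + K\<^sup>2) < 1"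
    using pos assms by (simp_all add: field_simps)
  have c: "0 \<le> c" "c < 1" using frac real_sqrt_less_mono[OF frac(2)] by (simp_all add: c_def)
  have coeff: "(1 - t * r)\<^sup>2 + t\<^sup>2 * K\<^sup>2 = c\<^sup>2"
  proof -
    have 1: "t * (r\<^sup>2 + K\<^sup>2) = r" using pos by (simp add: t_def)
    have "(1 - t * r)\<^sup>2 + t\<^sup>2 * K\<^sup>2 = 1 - 2 * t * r + t * (t * (r\<^sup>2 + K\<^sup>2))"
      by (simp add: power2_eq_square algebra_simps)
    also have "\<dots> = 1 - t * r" unfolding 1 by simp
    also have "\<dots> = c\<^sup>2" using frac by (simp add: c_def t_def power2_eq_square)
    finally show ?thesis .
  qed
  \<comment> \<open>A fixed point solves r u + J (T u) = J v. Applying \<open>J\<close> once more,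
    with J^2 = -1, gives the resolvent equation.\<close>
  define G where "G u = u - t *\<^sub>R (r *\<^sub>R u + J (T u) - J v)" for u
  have contr: "dist (G u) (G u') \<le> c * dist u u'" for u u'
  proof -
    define w where "w = u - u'"
    have "G u - G u' = (1 - t * r) *\<^sub>R w - t *\<^sub>R J (T w)"
      unfolding G_def w_def
      by (simp add: linear_diff[OF bounded_linear.linear[OF J]]
          linear_diff[OF bounded_linear.linear[OF lin]] algebra_simps)
    moreover have "inner ((1 - t * r) *\<^sub>R w) (J (T w)) = 0"
      unfolding J_def T_def by (simp add: inner_i_symmetric)
    ultimately have "(norm (G u - G u'))\<^sup>2 = (1 - t * r)\<^sup>2 * (norm w)\<^sup>2 + t\<^sup>2 * (norm (T w))\<^sup>2"
      by (simp add: norm_diff_orthogonal power_mult_distrib) (simp add: J_def norm_scaleC)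
    also have "\<dots> \<le> (1 - t * r)\<^sup>2 * (norm w)\<^sup>2 + t\<^sup>2 * (norm w * K)\<^sup>2"
      using K by (intro add_left_mono mult_left_mono power_mono) auto
    also have "\<dots> = ((1 - t * r)\<^sup>2 + t\<^sup>2 * K\<^sup>2) * (norm w)\<^sup>2"
      by (simp add: power_mult_distrib algebra_simps)
    also have "\<dots> = (c * norm w)\<^sup>2" unfolding coeff by (simp add: power_mult_distrib)
    finally show ?thesis
      using c(1) unfolding dist_norm w_def by (auto intro: power2_le_imp_le)
  qed
  have "\<exists>!u. G u = u" by (rule banach_fix_type[OF c]) (use contr in blast)
  then obtain u where "G u = u" by auto
  then have "r *\<^sub>R u + J (T u) = J v" using assms pos by (simp add: G_def t_def)
  then have "J (r *\<^sub>R u) + J (J (T u)) = J (J v)"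
    by (simp flip: linear_add[OF bounded_linear.linear[OF J]])
  then have "T u - r *\<^sub>R J u = v"
    by (simp add: JJ linear_scale[OF bounded_linear.linear[OF J]] algebra_simps)
  then show ?thesis unfolding T_def J_def by blast
qed

text \<open>Here \<open>u\<close> is the resolvent at s + \<i> r applied to \<open>v\<close>, so the
  left-hand side is the imaginary part of the Borel transform of the measure of \<open>v\<close>.
  With \<open>v = 0\<close> the identity also gives uniqueness of the resolvent vector.\<close>

lemma Im_resolvent:
  assumes "C u - s *\<^sub>R u - r *\<^sub>R \<i> *\<^sub>C u = v"
  shows "Im (cinner v u) = r * (norm u)\<^sup>2"
proof -
  have "inner (\<i> *\<^sub>C v) u = inner v (- (\<i> *\<^sub>C u))"
  proof -
    have "inner (\<i> *\<^sub>C v) u = inner v ((- \<i>) *\<^sub>C u)"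
      by (simp add: inner_eq_Re_cinner cinner_scaleC_left cinner_scaleC_right del: complex_vector.scale_minus_left)
    then show ?thesis by (simp only: complex_vector.scale_minus_left)
  qed
  also have "\<dots> = - inner (C u - s *\<^sub>R u) (\<i> *\<^sub>C u) + r * inner (\<i> *\<^sub>C u) (\<i> *\<^sub>C u)"
    unfolding assms[symmetric] by (simp add: inner_diff_left)
  also have "inner (C u - s *\<^sub>R u) (\<i> *\<^sub>C u) = - inner u (\<i> *\<^sub>C (C u - s *\<^sub>R u))"
  proof -
    have "inner y (\<i> *\<^sub>C z) = - inner (\<i> *\<^sub>C y) z" for y z :: 'a
      by (simp add: inner_eq_Re_cinner cinner_scaleC_left cinner_scaleC_right)
    then show ?thesis by (metis inner_commute)
  qed
  also have "\<dots> = 0" by (simp add: inner_i_symmetric)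
  also have "inner (\<i> *\<^sub>C u) (\<i> *\<^sub>C u) = (norm u)\<^sup>2"
    by (simp add: power2_norm_eq_inner inner_eq_Re_cinner cinner_scaleC_left cinner_scaleC_right)
  finally show ?thesis by (simp add: cinner_eq_Complex)
qed

text \<open>An operator version of the lower bound for the Poisson kernel on one cell: on the range
  of \<open>E B\<close> the norm of C - s is at most the cell length r, so the projected resolvent
  equation bounds the squared norm of \<open>E B v\<close> by 2 r^2 times that of
  \<open>u\<close>.\<close>

lemma Im_resolvent_ge_density:
  assumes u: "C u - s *\<^sub>R u - (1 / 2 ^ n) *\<^sub>R \<i> *\<^sub>C u = v"
  shows "2 ^ n * measure (M v) (dyadic_cell n \<lfloor>2 ^ n * s\<rfloor>) / 2 \<le> Im (cinner v u)"
proof -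
  define r :: real where "r = 1 / 2 ^ n"
  define B where "B = dyadic_cell n \<lfloor>2 ^ n * s\<rfloor>"
  have r: "r > 0" by (simp add: r_def)
  have [measurable]: "B \<in> sets borel" by (simp add: B_def)
  have B: "B \<subseteq> {s - r..s + r}"
    unfolding B_def r_def by (rule dyadic_cell_near) (simp add: mem_dyadic_cell)
  have "E B v = C (E B u) - s *\<^sub>R E B u - r *\<^sub>R \<i> *\<^sub>C E B u"
    unfolding u[symmetric] r_def
    by (simp add: E_diff C_E E_scaleC linear_scale[OF linear_E])
  then have "(norm (E B v))\<^sup>2 = (norm (C (E B u) - s *\<^sub>R E B u))\<^sup>2 + r\<^sup>2 * (norm (E B u))\<^sup>2"
    by (simp only: norm_shift_i)
  also have "\<dots> \<le> (r * norm (E B u))\<^sup>2 + r\<^sup>2 * (norm (E B u))\<^sup>2"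
    by (intro add_right_mono power_mono norm_C_shift_le[OF _ B]) (auto simp: E_idem)
  also have "\<dots> = 2 * r\<^sup>2 * (norm (E B u))\<^sup>2" by (simp add: power_mult_distrib)
  also have "\<dots> \<le> 2 * r\<^sup>2 * (norm u)\<^sup>2"
  proof -
    have "(norm (E B u))\<^sup>2 \<le> (norm u)\<^sup>2"
      using finite_measure.bounded_measure[OF finite_M, of u B] by (simp add: measure_M)
    then show ?thesis by (intro mult_left_mono) auto
  qed
  finally have "measure (M v) B \<le> 2 * r * Im (cinner v u)"
    using Im_resolvent[OF u] by (simp add: measure_M r_def power2_eq_square)
  then show ?thesis unfolding B_def[symmetric] by (simp add: r_def field_simps)
qed

end

text \<open>Aronszajn--Donoghue: if \<open>F\<close> and \<open>G\<close> denote the Borel transforms of the spectral measures of \<open>\<phi>\<close>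
  for \<open>A\<close> and \<open>C\<close>, then \<open>1 / G - 1 / F = \<lambda>\<close>, so \<open>F\<close> and \<open>G\<close> cannot both blow up at the same point.\<close>

lemma infinite_density_rank_one_disjoint:
  assumes "resolved_operator A F" "resolved_operator C E" "lam \<noteq> 0"
    and C: "\<And>u. C u = A u + complex_of_real lam *\<^sub>C cinner \<phi> u *\<^sub>C \<phi>"
  shows "infinite_density (pvm_measure F \<phi>) \<inter> infinite_density (pvm_measure E \<phi>) = {}"
proof (rule ccontr)
  interpret A: resolved_operator A F by fact
  interpret C: resolved_operator C E by fact
  assume "infinite_density (pvm_measure F \<phi>) \<inter> infinite_density (pvm_measure E \<phi>) \<noteq> {}"
  then obtain s where s: "s \<in> infinite_density (pvm_measure F \<phi>)" "s \<in> infinite_density (pvm_measure E \<phi>)"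
    by blast
  \<comment> \<open>Beyond this threshold both |lam| |f| and |lam| |g| exceed 2, which is
    incompatible with |lam| |f| |g| \<le> |f| + |g|.\<close>
  obtain k :: nat where k: "4 / \<bar>lam\<bar> < real k" using reals_Archimedean2 by blast
  have kpos: "real k > 0" using k by (smt (verit) divide_nonneg_nonneg)
  obtain m1 where m1: "\<And>n. n \<ge> m1 \<Longrightarrow> real k \<le> 2 ^ n * measure (pvm_measure F \<phi>) (dyadic_cell n \<lfloor>2 ^ n * s\<rfloor>)"
    using s(1) unfolding infinite_density_def by blast
  obtain m2 where m2: "\<And>n. n \<ge> m2 \<Longrightarrow> real k \<le> 2 ^ n * measure (pvm_measure E \<phi>) (dyadic_cell n \<lfloor>2 ^ n * s\<rfloor>)"
    using s(2) unfolding infinite_density_def by blast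
  define n where "n = max m1 m2"
  define r :: real where "r = 1 / 2 ^ n"
  have "r > 0" by (simp add: r_def)
  obtain u where u: "A u - s *\<^sub>R u - r *\<^sub>R \<i> *\<^sub>C u = \<phi>" using A.ex_resolvent_vector[OF \<open>r > 0\<close>] by blast
  obtain w where w: "C w - s *\<^sub>R w - r *\<^sub>R \<i> *\<^sub>C w = \<phi>" using C.ex_resolvent_vector[OF \<open>r > 0\<close>] by blast
  define f g where "f = cinner \<phi> u" and "g = cinner \<phi> w"
  have "real k / 2 \<le> Im f"
    using A.Im_resolvent_ge_density[OF u[unfolded r_def]] m1[of n] by (simp add: n_def f_def)
  then have f: "real k / 2 \<le> cmod f" using abs_Im_le_cmod[of f] by linarith
  have "real k / 2 \<le> Im g"
    using C.Im_resolvent_ge_density[OF w[unfolded r_def]] m2[of n] by (simp add: n_def g_def)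
  then have g: "real k / 2 \<le> cmod g" using abs_Im_le_cmod[of g] by linarith
  \<comment> \<open>The rank one resolvent formula: \<open>w\<close> and
    \<open>c *\<^sub>C u\<close> solve the unperturbed equation with the same right-hand side, so
    their difference \<open>d\<close> vanishes by \<open>Im_resolvent\<close>. Pairing with
    \<open>\<phi>\<close> then relates \<open>g\<close> to \<open>f\<close>.\<close>
  define c where "c = 1 - complex_of_real lam * g"
  define d where "d = w - c *\<^sub>C u"
  have lin: "(\<lambda>y. A y - s *\<^sub>R y - r *\<^sub>R \<i> *\<^sub>C y) (w - c *\<^sub>C u)
      = (A w - s *\<^sub>R w - r *\<^sub>R \<i> *\<^sub>C w) - c *\<^sub>C (A u - s *\<^sub>R u - r *\<^sub>R \<i> *\<^sub>C u)"
    by (simp add: A.diff A.scaleC scaleR_eq_scaleC scaleC_scaleC complex_vector.scale_right_diff_distrib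
        algebra_simps)
  have "A w - s *\<^sub>R w - r *\<^sub>R \<i> *\<^sub>C w = \<phi> - complex_of_real lam *\<^sub>C g *\<^sub>C \<phi>"
    using w unfolding C g_def by (simp add: algebra_simps)
  also have "\<dots> = c *\<^sub>C \<phi>"
    by (simp add: c_def complex_vector.scale_left_diff_distrib scaleC_one scaleC_scaleC)
  finally have "A d - s *\<^sub>R d - r *\<^sub>R \<i> *\<^sub>C d = 0"
    using lin u unfolding d_def by simp
  from A.Im_resolvent[OF this] have "r * (norm d)\<^sup>2 = 0"
    by (simp add: cinner_eq_Complex zero_complex.code)
  then have "w = c *\<^sub>C u" using \<open>r > 0\<close> by (simp add: d_def)
  then have "g = c * f" by (simp add: g_def f_def cinner_scaleC_right)
  then have "complex_of_real lam * g * f = f - g" by (simp add: c_def algebra_simps)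
  then have "\<bar>lam\<bar> * cmod g * cmod f \<le> cmod f + cmod g"
    by (metis norm_mult norm_of_real norm_triangle_ineq4)
  moreover have "2 * (cmod f + cmod g) < 2 * (\<bar>lam\<bar> * cmod g * cmod f)"
  proof -
    have "4 < \<bar>lam\<bar> * real k" using k \<open>lam \<noteq> 0\<close> by (simp add: field_simps)
    moreover have "\<bar>lam\<bar> * (real k / 2) \<le> \<bar>lam\<bar> * cmod f" "\<bar>lam\<bar> * (real k / 2) \<le> \<bar>lam\<bar> * cmod g"
      by (rule mult_left_mono[OF f abs_ge_zero], rule mult_left_mono[OF g abs_ge_zero])
    ultimately have "2 < \<bar>lam\<bar> * cmod f" "2 < \<bar>lam\<bar> * cmod g" by simp_all
    moreover have "cmod f > 0" "cmod g > 0" using f g kpos by linarith+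
    ultimately have "2 * cmod g < (\<bar>lam\<bar> * cmod f) * cmod g" "2 * cmod f < (\<bar>lam\<bar> * cmod g) * cmod f"
      by (simp_all only: mult_strict_right_mono)
    then show ?thesis by (simp add: mult_ac)
  qed
  ultimately show False by (metis mult_less_cancel_left_pos not_less zero_less_numeral)
qed

section \<open>Orthogonal projections onto closed subspaces\<close>

lemma ex_nearest_point:
  fixes S :: "'a::{real_inner, banach} set"
  assumes S: "closed S" "subspace S"
  shows "\<exists>u\<in>S. \<forall>v\<in>S. inner (x - u) v = 0"
proof -
  define d where "d = infdist x S"
  have ne: "S \<noteq> {}" using subspace_0[OF S(2)] by auto
  have d: "d \<ge> 0" unfolding d_def by (rule infdist_nonneg)
  have d_le: "d \<le> norm (x - v)" if "v \<in> S" for v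
    using infdist_le[OF that, of x] by (simp add: d_def dist_norm)
  have "\<exists>v\<in>S. (norm (x - v))\<^sup>2 < d\<^sup>2 + e" if "e > 0" for e
  proof -
    have "d < sqrt (d\<^sup>2 + e)" using that d by (intro real_less_rsqrt) auto
    then obtain v where "v \<in> S" "dist x v < sqrt (d\<^sup>2 + e)"
      using ne unfolding d_def infdist_notempty[OF ne] by (subst (asm) cINF_less_iff) auto
    moreover from this have "(norm (x - v))\<^sup>2 < (sqrt (d\<^sup>2 + e))\<^sup>2"
      unfolding dist_norm by (intro power_strict_mono) auto
    ultimately show ?thesis using that d by (auto intro!: bexI[of _ v])
  qed
  then have "\<exists>v\<in>S. (norm (x - v))\<^sup>2 < d\<^sup>2 + (1 / 2) ^ n" for n :: nat by simp
  then obtain v where v: "\<And>n. v n \<in> S" "\<And>n::nat. (norm (x - v n))\<^sup>2 < d\<^sup>2 + (1 / 2) ^ n" by metis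
  \<comment> \<open>The midpoint of two almost nearest points lies in \<open>S\<close> and is no
    closer than \<open>d\<close>; the parallelogram law then forces the two points together.\<close>
  have par: "(norm (v m - v n))\<^sup>2 \<le> 2 * (1 / 2) ^ m + 2 * (1 / 2) ^ n" for m n
  proof -
    define h where "h = (1 / 2) *\<^sub>R (v m + v n)"
    have "h \<in> S" unfolding h_def using v S(2) by (intro subspace_scale subspace_add)
    then have "d\<^sup>2 \<le> (norm (x - h))\<^sup>2" using d d_le by (intro power_mono)
    moreover have "(norm (v m - v n))\<^sup>2 + 4 * (norm (x - h))\<^sup>2 = 2 * (norm (x - v m))\<^sup>2 + 2 * (norm (x - v n))\<^sup>2"
      unfolding power2_norm_eq_inner h_def
      by (simp add: inner_add_left inner_add_right inner_diff_left inner_diff_right inner_commute algebra_simps)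
    ultimately show ?thesis using v(2)[of m] v(2)[of n] by linarith
  qed
  have "Cauchy v"
  proof (rule CauchyI)
    fix e :: real assume "e > 0"
    then obtain N where N: "(1 / 2) ^ N < e\<^sup>2 / 4"
      using real_arch_pow_inv[of "e\<^sup>2 / 4" "1 / 2"] by auto
    show "\<exists>M. \<forall>m\<ge>M. \<forall>n\<ge>M. norm (v m - v n) < e"
    proof (intro exI allI impI)
      fix m n assume "m \<ge> N" "n \<ge> N"
      then have "(1 / 2 :: real) ^ m \<le> (1 / 2) ^ N" "(1 / 2 :: real) ^ n \<le> (1 / 2) ^ N"
        by (auto intro: power_decreasing)
      then have "(norm (v m - v n))\<^sup>2 < e\<^sup>2" using par[of m n] N by linarith
      then show "norm (v m - v n) < e" using \<open>e > 0\<close> by (auto intro: power2_less_imp_less)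
    qed
  qed
  then obtain u where u: "v \<longlonglongrightarrow> u" using Cauchy_convergent convergent_def by blast
  have uS: "u \<in> S" using S(1) v(1) u by (auto simp: closed_sequential_limits)
  have "(norm (x - u))\<^sup>2 \<le> d\<^sup>2"
  proof (rule LIMSEQ_le)
    show "(\<lambda>n. (norm (x - v n))\<^sup>2) \<longlonglongrightarrow> (norm (x - u))\<^sup>2" by (intro tendsto_intros u)
    have "(\<lambda>n. d\<^sup>2 + (1 / 2) ^ n) \<longlonglongrightarrow> d\<^sup>2 + 0"
      by (intro tendsto_intros LIMSEQ_power_zero) simp
    then show "(\<lambda>n. d\<^sup>2 + (1 / 2) ^ n) \<longlonglongrightarrow> d\<^sup>2" by simp
  qed (use v(2) less_imp_le in blast)
  have "inner (x - u) w = 0" if w: "w \<in> S" for w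
  proof (cases "w = 0")
    case False
    \<comment> \<open>The minimiser of the distance along the direction \<open>w\<close>.\<close>
    define t where "t = inner (x - u) w / inner w w"
    have ww: "inner w w > 0" using False by simp
    have "u + t *\<^sub>R w \<in> S" using uS w S(2) by (intro subspace_add subspace_scale)
    then have "d\<^sup>2 \<le> (norm (x - (u + t *\<^sub>R w)))\<^sup>2" using d d_le by (intro power_mono)
    then have "(norm (x - u))\<^sup>2 \<le> (norm (x - u - t *\<^sub>R w))\<^sup>2"
      using \<open>(norm (x - u))\<^sup>2 \<le> d\<^sup>2\<close> unfolding diff_diff_eq by linarith
    also have "\<dots> = inner (x - u) (x - u) - 2 * t * inner (x - u) w + t * (t * inner w w)"
      unfolding power2_norm_eq_inner
      by (simp only: inner_diff_left[of "x - u" "t *\<^sub>R w"] inner_diff_right[of _ "x - u" "t *\<^sub>R w"]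
          inner_scaleR_left inner_scaleR_right inner_commute[of w "x - u"]) (simp add: algebra_simps)
    also have "t * inner w w = inner (x - u) w" using ww by (simp add: t_def)
    finally have "t * inner (x - u) w \<le> 0" by (simp add: power2_norm_eq_inner)
    then have "(inner (x - u) w)\<^sup>2 \<le> 0" using ww by (simp add: t_def power2_eq_square divide_le_0_iff)
    then show ?thesis by simp
  qed simp
  then show ?thesis using uS by blast
qed

lemma ex_orthogonal_projection:
  fixes S :: "'a::{real_inner, banach} set"
  assumes S: "closed S" "subspace S"
  shows "\<exists>P. bounded_linear P \<and> (\<forall>x y. inner (P x) y = inner x (P y)) \<and>
    (\<forall>x. P x \<in> S) \<and> (\<forall>x\<in>S. P x = x) \<and> (\<forall>x. \<forall>v\<in>S. inner (x - P x) v = 0)"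
proof -
  obtain P where P: "\<And>x. P x \<in> S" "\<And>x v. v \<in> S \<Longrightarrow> inner (x - P x) v = 0"
    using ex_nearest_point[OF S] by metis
  have unique: "P x = u" if "u \<in> S" "\<And>v. v \<in> S \<Longrightarrow> inner (x - u) v = 0" for x u
  proof -
    have "u - P x \<in> S" using that(1) P(1) S(2) by (intro subspace_diff)
    then have "inner (u - P x) (u - P x) = 0"
      using P(2)[of "u - P x" x] that(2)[of "u - P x"] by (simp add: inner_diff_left)
    then show ?thesis by simp
  qed
  have sym: "inner (P x) y = inner x (P y)" for x y
  proof -
    have "inner x (P y) = inner (P x) (P y)" "inner y (P x) = inner (P y) (P x)"
      using P(2)[OF P(1), of x y] P(2)[OF P(1), of y x] by (simp_all add: inner_diff_left)
    then show ?thesis by (metis inner_commute)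
  qed
  have "bounded_linear P"
  proof (rule bounded_linear_intro[where K=1])
    show "P (x + y) = P x + P y" for x y
    proof (rule unique)
      show "inner (x + y - (P x + P y)) v = 0" if "v \<in> S" for v
        using P(2)[OF that, of x] P(2)[OF that, of y] by (simp add: inner_diff_left inner_add_left)
    qed (use P S in \<open>auto intro: subspace_add\<close>)
    show "P (r *\<^sub>R x) = r *\<^sub>R P x" for r x
    proof (rule unique)
      show "inner (r *\<^sub>R x - r *\<^sub>R P x) v = 0" if "v \<in> S" for v
        using P(2)[OF that, of x] by (simp add: inner_diff_left)
    qed (use P S in \<open>auto intro: subspace_scale\<close>)
    show "norm (P x) \<le> norm x * 1" for x
    proof -
      have "norm (P x) * norm (P x) = inner x (P x)"
        using P(2)[OF P(1), of x x] by (simp add: inner_diff_left power2_norm_eq_inner flip: power2_eq_square)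
      also have "\<dots> \<le> norm x * norm (P x)" by (rule norm_cauchy_schwarz)
      finally show ?thesis by (cases "P x = 0") auto
    qed
  qed
  then show ?thesis using P sym unique by (intro exI[of _ P]) auto
qed


section \<open>Cyclic subspaces\<close>

definition closed_csubspace :: "'a::complex_hilbert_space set \<Rightarrow> bool" where
  "closed_csubspace S \<longleftrightarrow> closed S \<and> complex_vector.subspace S"

lemma closed_csubspace_closed: "closed_csubspace S \<Longrightarrow> closed S"
  and closed_csubspace_0: "closed_csubspace S \<Longrightarrow> 0 \<in> S"
  and closed_csubspace_add: "closed_csubspace S \<Longrightarrow> x \<in> S \<Longrightarrow> y \<in> S \<Longrightarrow> x + y \<in> S"
  and closed_csubspace_diff: "closed_csubspace S \<Longrightarrow> x \<in> S \<Longrightarrow> y \<in> S \<Longrightarrow> x - y \<in> S"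
  and closed_csubspace_scaleC: "closed_csubspace S \<Longrightarrow> x \<in> S \<Longrightarrow> c *\<^sub>C x \<in> S"
  unfolding closed_csubspace_def
  by (simp_all add: complex_vector.subspace_0 complex_vector.subspace_add complex_vector.subspace_diff
      complex_vector.subspace_scale)

lemma closed_csubspace_subspace: "closed_csubspace S \<Longrightarrow> subspace S"
  by (rule subspaceI)
     (simp_all add: closed_csubspace_0 closed_csubspace_add closed_csubspace_scaleC scaleR_eq_scaleC)

lemma closed_csubspace_vimage:
  assumes T: "bounded_linear T" "\<And>c x. T (c *\<^sub>C x) = c *\<^sub>C T x" and S: "closed_csubspace S"
  shows "closed_csubspace {x. T x \<in> S}"
proof -
  interpret T: bounded_linear T by fact
  have "closed (T -` S)"
    using S by (intro closed_vimage T.continuous_on continuous_on_id) (auto simp: closed_csubspace_def)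
  moreover have "0 \<in> S" using S by (auto simp: closed_csubspace_def complex_vector.subspace_0)
  ultimately show ?thesis
    using S unfolding closed_csubspace_def
    by (auto simp: vimage_def T.zero T.add T(2) complex_vector.subspace_add
        complex_vector.subspace_scale intro!: complex_vector.subspaceI)
qed

lemma closed_csubspace_zero: "closed_csubspace {0}"
  by (simp add: closed_csubspace_def complex_vector.subspace_single_0)

lemma closed_csubspace_closure:
  assumes "complex_vector.subspace S"
  shows "closed_csubspace (closure S)"
  unfolding closed_csubspace_def
proof (intro conjI closed_closure complex_vector.subspaceI)
  show "0 \<in> closure S" using complex_vector.subspace_0[OF assms] closure_subset by auto
  show "x + y \<in> closure S" if xy: "x \<in> closure S" "y \<in> closure S" for x y
  proof -
    obtain u v where "\<And>n. u n \<in> S" "u \<longlonglongrightarrow> x" "\<And>n. v n \<in> S" "v \<longlonglongrightarrow> y"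
      using xy unfolding closure_sequential by blast
    then show ?thesis
      unfolding closure_sequential
      by (intro exI[of _ "\<lambda>n. u n + v n"]) (auto intro: tendsto_add complex_vector.subspace_add[OF assms])
  qed
  show "c *\<^sub>C x \<in> closure S" if x: "x \<in> closure S" for c x
  proof -
    obtain u where "\<And>n. u n \<in> S" "u \<longlonglongrightarrow> x" using x unfolding closure_sequential by blast
    then show ?thesis
      unfolding closure_sequential
      by (intro exI[of _ "\<lambda>n. c *\<^sub>C u n"])
        (auto intro: bounded_linear.tendsto[OF bounded_linear_scaleC] complex_vector.subspace_scale[OF assms])
  qed
qed

definition cyclic_space :: "('a::complex_hilbert_space \<Rightarrow> 'a) \<Rightarrow> 'a \<Rightarrow> 'a set" where
  "cyclic_space C \<phi> = closure (complex_vector.span (range (\<lambda>n::nat. (C ^^ n) \<phi>)))"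

lemma closed_csubspace_cyclic_space: "closed_csubspace (cyclic_space C \<phi>)"
  unfolding cyclic_space_def by (intro closed_csubspace_closure complex_vector.subspace_span)

lemma cyclic_space_mem: "\<phi> \<in> cyclic_space C \<phi>"
proof -
  have "\<phi> \<in> range (\<lambda>n::nat. (C ^^ n) \<phi>)" by (rule range_eqI[of _ _ 0]) simp
  then show ?thesis
    unfolding cyclic_space_def by (intro subsetD[OF closure_subset] complex_vector.span_base)
qed

text \<open>The induction principle for cyclic subspaces: a property of all their vectors follows
  once it defines a closed invariant subspace containing the generator.\<close>

lemma cyclic_space_minimal:
  assumes "closed_csubspace K" "\<And>x. x \<in> K \<Longrightarrow> C x \<in> K" "\<phi> \<in> K"
  shows "cyclic_space C \<phi> \<subseteq> K"
proof -
  have "(C ^^ n) \<phi> \<in> K" for n by (induction n) (auto simp: assms)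
  then show ?thesis
    unfolding cyclic_space_def using assms(1)
    by (intro closure_minimal complex_vector.span_minimal) (auto simp: closed_csubspace_def)
qed

lemma cyclic_space_invariant:
  assumes "bounded_selfadjoint C" "x \<in> cyclic_space C \<phi>"
  shows "C x \<in> cyclic_space C \<phi>"
proof -
  have C: "bounded_linear C" "\<And>c x. C (c *\<^sub>C x) = c *\<^sub>C C x"
    using assms(1) by (auto simp: bounded_selfadjoint_def)
  interpret C: bounded_linear C by fact
  define orbit where "orbit = range (\<lambda>n::nat. (C ^^ n) \<phi>)"
  have "C y \<in> complex_vector.span orbit" if "y \<in> complex_vector.span orbit" for y
    using that
  proof (induction rule: complex_vector.span_induct_alt)
    case base
    show ?case by (simp add: C.zero complex_vector.span_zero)
  next
    case (step c u v)
    then obtain n where "u = (C ^^ n) \<phi>" by (auto simp: orbit_def)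
    then have "C u = (C ^^ Suc n) \<phi>" by simp
    then have "C u \<in> complex_vector.span orbit"
      unfolding orbit_def by (metis complex_vector.span_base rangeI)
    then show ?case
      using step by (simp add: C.add C(2) complex_vector.span_add complex_vector.span_scale)
  qed
  then have "C ` complex_vector.span orbit \<subseteq> complex_vector.span orbit" by auto
  then have "C ` closure (complex_vector.span orbit) \<subseteq> closure (complex_vector.span orbit)"
    by (rule order_trans[OF closure_bounded_linear_image_subset[OF C(1)] closure_mono])
  then show ?thesis using assms(2) unfolding cyclic_space_def orbit_def by auto
qed

text \<open>A symmetric operator that preserves \<open>S\<close> preserves its orthogonal complement
  as well.\<close>

lemma projection_commute:
  assumes P: "linear P" "\<And>x. P x \<in> S" "\<And>x. x \<in> S \<Longrightarrow> P x = x"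
      "\<And>x v. v \<in> S \<Longrightarrow> inner (x - P x) v = 0"
    and D: "linear D" "\<And>x y. inner (D x) y = inner x (D y)" "\<And>x. x \<in> S \<Longrightarrow> D x \<in> S"
  shows "P (D x) = D (P x)"
proof -
  have "P (D (x - P x)) = 0"
  proof -
    define w where "w = D (x - P x)"
    have "inner w v = 0" if "v \<in> S" for v using P(4)[OF D(3)[OF that]] by (simp add: w_def D(2))
    then have "inner (P w) (P w) = 0" using P(4)[OF P(2), of w w] P(2) by (simp add: inner_diff_left)
    then show ?thesis by (simp add: w_def)
  qed
  then have "P (D x) = P (D (P x))" by (simp add: linear_diff[OF D(1)] linear_diff[OF P(1)])
  then show ?thesis using P(3)[OF D(3)[OF P(2)]] by simp
qed

context resolved_operator
begin

text \<open>The projection onto \<open>S\<close> commutes with \<open>C\<close>, so it intertwines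
  \<open>C\<close> with itself and thereby commutes with \<open>E B\<close>.\<close>

lemma invariant_subspace_E:
  assumes S: "closed_csubspace S" "\<And>x. x \<in> S \<Longrightarrow> C x \<in> S" and B: "B \<in> sets borel" and "x \<in> S"
  shows "E B x \<in> S"
proof -
  obtain P where P: "bounded_linear P" "\<And>x y. inner (P x) y = inner x (P y)"
    "\<And>x. P x \<in> S" "\<And>x. x \<in> S \<Longrightarrow> P x = x" "\<And>x v. v \<in> S \<Longrightarrow> inner (x - P x) v = 0"
    using ex_orthogonal_projection[OF closed_csubspace_closed[OF S(1)] closed_csubspace_subspace[OF S(1)]]
    by blast
  have "C (P x) = P (C x)" for x
    by (rule projection_commute[symmetric, where S=S])
       (use P S symmetric bounded_linear.linear bounded_linear in auto)
  then interpret intertwining C E C E P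
    by (intro intertwining.intro intertwining_axioms.intro resolved_operator_axioms P(1,2))
  show ?thesis using resolution_intertwine[OF B, of x] P(3,4) \<open>x \<in> S\<close> by metis
qed

lemma closed_csubspace_range_E:
  assumes "B \<in> sets borel"
  shows "closed_csubspace {x. E B x = x}"
proof -
  have "closed_csubspace {x. E (- B) x \<in> {0}}"
    using assms by (intro closed_csubspace_vimage bounded_linear_E E_scaleC closed_csubspace_zero) auto
  moreover have "E (- B) x \<in> {0} \<longleftrightarrow> E B x = x" for x
    using assms by (auto simp: E_compl)
  ultimately show ?thesis by simp
qed

lemma lebesgue_singular_iff:
  "lebesgue_singular (M x) \<longleftrightarrow> (\<exists>N\<in>sets borel. emeasure lborel N = 0 \<and> E N x = x)"
proof -
  have "emeasure (M x) (UNIV - N) = 0 \<longleftrightarrow> E N x = x" if "N \<in> sets borel" for N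
    using that by (auto simp: emeasure_M E_compl simp flip: Compl_eq_Diff_UNIV)
  then show ?thesis unfolding lebesgue_singular_def by auto
qed

end

text \<open>The supremum of the mass of null sets is attained by a countable union; a further null
  set with mass outside it would exceed the supremum. The set carries the singular part of
  \<open>\<kappa>\<close> in its Lebesgue decomposition.\<close>

lemma ex_maximal_null_set:
  fixes \<kappa> :: "real measure"
  assumes "finite_measure \<kappa>" and sets_\<kappa>: "sets \<kappa> = sets borel"
  shows "\<exists>N\<in>sets borel. emeasure lborel N = 0 \<and>
    (\<forall>B\<in>sets borel. emeasure lborel B = 0 \<longrightarrow> emeasure \<kappa> (B - N) = 0)"
proof -
  interpret finite_measure \<kappa> by fact
  define Z :: "real set set" where "Z = {B \<in> sets borel. emeasure lborel B = 0}"
  define s where "s = (SUP B\<in>Z. measure \<kappa> B)"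
  have "{} \<in> Z" by (simp add: Z_def)
  have bdd: "bdd_above (measure \<kappa> ` Z)"
    by (rule bdd_aboveI2[of _ _ "measure \<kappa> (space \<kappa>)"]) (rule bounded_measure)
  have le: "measure \<kappa> B \<le> s" if "B \<in> Z" for B
    unfolding s_def using bdd that by (intro cSUP_upper)
  have "\<exists>B\<in>Z. s - 1 / real (Suc n) < measure \<kappa> B" for n
    using less_cSUP_iff[of Z "measure \<kappa>" "s - 1 / real (Suc n)"] \<open>{} \<in> Z\<close> bdd
    unfolding s_def[symmetric] by auto
  then obtain B where B: "\<And>n. B n \<in> Z" "\<And>n. s - 1 / real (Suc n) < measure \<kappa> (B n)" by metis
  define N where "N = (\<Union>n. B n)"
  have N_borel: "N \<in> sets borel" using B(1) by (auto simp: N_def Z_def)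
  have "emeasure lborel N = 0"
    unfolding N_def using B(1) by (intro emeasure_UN_eq_0) (auto simp: Z_def)
  have "s \<le> measure \<kappa> N"
  proof (rule LIMSEQ_le_const2)
    show "(\<lambda>n. s - 1 / real (Suc n)) \<longlonglongrightarrow> s"
      using tendsto_diff[OF tendsto_const LIMSEQ_inverse_real_of_nat, of s] by (simp add: inverse_eq_divide)
    have "measure \<kappa> (B n) \<le> measure \<kappa> N" for n
      using N_borel by (intro finite_measure_mono) (auto simp: N_def sets_\<kappa>)
    then show "\<exists>k. \<forall>n\<ge>k. s - 1 / real (Suc n) \<le> measure \<kappa> N"
      using B(2) by (meson less_imp_le order_trans)
  qed
  have "emeasure \<kappa> (A - N) = 0" if A: "A \<in> sets borel" "emeasure lborel A = 0" for A
  proof -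
    have "A \<union> N \<in> Z"
      using A N_borel \<open>emeasure lborel N = 0\<close> emeasure_Un_null_set[of A lborel N]
      by (auto simp: Z_def null_sets_def)
    then have "measure \<kappa> (A \<union> N) \<le> measure \<kappa> N" using le \<open>s \<le> measure \<kappa> N\<close> by fastforce
    moreover have "measure \<kappa> ((A \<union> N) - N) = measure \<kappa> (A \<union> N) - measure \<kappa> N"
      using A N_borel by (intro finite_measure_Diff) (auto simp: sets_\<kappa>)
    ultimately have "measure \<kappa> (A - N) \<le> 0" by (simp add: Un_Diff)
    then show ?thesis by (simp add: emeasure_eq_measure measure_le_0_iff)
  qed
  then show ?thesis using N_borel \<open>emeasure lborel N = 0\<close> by blast
qed

lemma bounded_linear_rank_one: "bounded_linear (\<lambda>x. cinner \<phi> x *\<^sub>C \<psi>)"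
proof -
  have "cinner \<phi> x *\<^sub>C \<psi> = inner \<phi> x *\<^sub>R \<psi> + inner (\<i> *\<^sub>C \<phi>) x *\<^sub>R \<i> *\<^sub>C \<psi>" for x
    by (simp add: cinner_eq_Complex Complex_eq scaleC_add_left scaleR_eq_scaleC scaleC_scaleC mult.commute)
  then show ?thesis
    by (simp, intro bounded_linear_add bounded_linear_compose[OF bounded_linear_scaleR_left]
        bounded_linear_inner_right)
qed

lemma bounded_selfadjoint_map_prod:
  assumes "bounded_selfadjoint A\<^sub>1" "bounded_selfadjoint A\<^sub>2"
  shows "bounded_selfadjoint (map_prod A\<^sub>1 A\<^sub>2)"
proof -
  have "bounded_linear (\<lambda>x. (A\<^sub>1 (fst x), A\<^sub>2 (snd x)))"
    using assms by (intro bounded_linear_Pair bounded_linear_compose[OF _ bounded_linear_fst]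
        bounded_linear_compose[OF _ bounded_linear_snd]) (auto simp: bounded_selfadjoint_def)
  then show ?thesis
    using assms
    by (simp add: bounded_selfadjoint_def map_prod_def case_prod_beta' scaleC_prod_def cinner_prod_def)
qed

lemma bounded_selfadjoint_rank_one_perturbation:
  fixes r :: real
  assumes "bounded_selfadjoint A"
  shows "bounded_selfadjoint (\<lambda>u. A u + complex_of_real r *\<^sub>C cinner \<phi> u *\<^sub>C \<phi>)"
  unfolding bounded_selfadjoint_def
proof (intro conjI allI)
  have A: "bounded_linear A" "\<And>c x. A (c *\<^sub>C x) = c *\<^sub>C A x" "\<And>x y. cinner (A x) y = cinner x (A y)"
    using assms by (auto simp: bounded_selfadjoint_def)
  show "bounded_linear (\<lambda>u. A u + complex_of_real r *\<^sub>C cinner \<phi> u *\<^sub>C \<phi>)"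
    by (intro bounded_linear_add A bounded_linear_compose[OF bounded_linear_scaleC] bounded_linear_rank_one)
  show "A (c *\<^sub>C x) + complex_of_real r *\<^sub>C cinner \<phi> (c *\<^sub>C x) *\<^sub>C \<phi> =
      c *\<^sub>C (A x + complex_of_real r *\<^sub>C cinner \<phi> x *\<^sub>C \<phi>)" for c x
    by (simp add: A scaleC_add_right scaleC_scaleC cinner_scaleC_right mult_ac)
  have add_left: "cinner (u + v) y = cinner u y + cinner v y" for u v y :: 'a
    by (metis cinner_add_right cinner_commute complex_cnj_add)
  show "cinner (A x + complex_of_real r *\<^sub>C cinner \<phi> x *\<^sub>C \<phi>) y =
      cinner x (A y + complex_of_real r *\<^sub>C cinner \<phi> y *\<^sub>C \<phi>)" for x y
    by (simp add: add_left cinner_add_right cinner_scaleC_left cinner_scaleC_right A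
        flip: cinner_commute)
qed


section \<open>Simplicity of the singular spectrum\<close>

lemma closed_csubspace_kernel:
  assumes "bounded_selfadjoint T"
  shows "closed_csubspace {x. T x = 0}"
  using closed_csubspace_vimage[of T "{0}"] assms closed_csubspace_zero
  by (simp add: bounded_selfadjoint_def)

text \<open>Subtraction puts both components of \<open>\<phi>\<close> into \<open>K\<close>. The
  slices of \<open>K\<close> along the two summands are closed and invariant, so each contains the
  cyclic space of its component.\<close>

lemma closed_csubspace_prod_full:
  assumes cyc: "cyclic_vector A\<^sub>1 (fst \<phi>)" "cyclic_vector A\<^sub>2 (snd \<phi>)"
    and K: "closed_csubspace K" "\<And>x. x \<in> K \<Longrightarrow> map_prod A\<^sub>1 A\<^sub>2 x \<in> K" "\<phi> \<in> K" "(fst \<phi>, 0) \<in> K"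
    and A: "bounded_selfadjoint A\<^sub>1" "bounded_selfadjoint A\<^sub>2"
  shows "K = UNIV"
proof -
  have zero: "A\<^sub>1 0 = 0" "A\<^sub>2 0 = 0"
    using A by (auto simp: bounded_selfadjoint_def linear_0 bounded_linear.linear)
  have snd: "(0, snd \<phi>) \<in> K"
  proof -
    have "\<phi> - (fst \<phi>, 0) = (0, snd \<phi>)" by (simp add: prod_eq_iff)
    then show ?thesis using closed_csubspace_diff[OF K(1,3,4)] by simp
  qed
  have "cyclic_space A\<^sub>1 (fst \<phi>) \<subseteq> {x. (x, 0) \<in> K}"
  proof (rule cyclic_space_minimal)
    show "closed_csubspace {x. (x, 0) \<in> K}"
      by (rule closed_csubspace_vimage[OF _ _ K(1)])
         (auto intro!: bounded_linear_Pair bounded_linear_ident bounded_linear_zero simp: scaleC_prod_def)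
    show "A\<^sub>1 x \<in> {x. (x, 0) \<in> K}" if "x \<in> {x. (x, 0) \<in> K}" for x
      using K(2)[of "(x, 0)"] that by (simp add: zero)
  qed (use K in simp)
  then have 1: "(x, 0) \<in> K" for x
    using cyc(1) unfolding cyclic_vector_on_def cyclic_space_def by auto
  have "cyclic_space A\<^sub>2 (snd \<phi>) \<subseteq> {y. (0, y) \<in> K}"
  proof (rule cyclic_space_minimal)
    show "closed_csubspace {y. (0, y) \<in> K}"
      by (rule closed_csubspace_vimage[OF _ _ K(1)])
         (auto intro!: bounded_linear_Pair bounded_linear_ident bounded_linear_zero simp: scaleC_prod_def)
    show "A\<^sub>2 y \<in> {y. (0, y) \<in> K}" if "y \<in> {y. (0, y) \<in> K}" for y
      using K(2)[of "(0, y)"] that by (simp add: zero)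
  qed (use snd in simp)
  then have 2: "(0, y) \<in> K" for y
    using cyc(2) unfolding cyclic_vector_on_def cyclic_space_def by auto
  have "(x, y) \<in> K" for x y
    using closed_csubspace_add[OF K(1) 1[of x] 2[of y]] by simp
  then show ?thesis by auto
qed

theorem theorem2:
  fixes A\<^sub>1 :: "'a::complex_hilbert_space \<Rightarrow> 'a"
    and A\<^sub>2 :: "'b::complex_hilbert_space \<Rightarrow> 'b"
    and \<phi> :: "'a \<times> 'b"
    and lam :: real
    and C :: "'a \<times> 'b \<Rightarrow> 'a \<times> 'b"
  assumes "bounded_selfadjoint A\<^sub>1"
    and "bounded_selfadjoint A\<^sub>2"
    and "cyclic_vector A\<^sub>1 (fst \<phi>)"
    and "cyclic_vector A\<^sub>2 (snd \<phi>)"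
    and "lam \<noteq> 0"
    and C: "C = (\<lambda>u. map_prod A\<^sub>1 A\<^sub>2 u + complex_of_real lam *\<^sub>C cinner \<phi> u *\<^sub>C \<phi>)"
  shows "bounded_selfadjoint C \<and> simple_singular_spectrum C"
proof
  define A where "A = map_prod A\<^sub>1 A\<^sub>2"
  have A: "bounded_selfadjoint A"
    unfolding A_def using assms by (intro bounded_selfadjoint_map_prod)
  have C_eq: "C u = A u + complex_of_real lam *\<^sub>C cinner \<phi> u *\<^sub>C \<phi>" for u
    by (simp add: C A_def)
  show C_sa: "bounded_selfadjoint C"
    unfolding C A_def[symmetric] by (rule bounded_selfadjoint_rank_one_perturbation[OF A])
  define E where "E = (SOME E. spectral_resolution E C)"
  define F where "F = (SOME F. spectral_resolution F A)"
  interpret C: resolved_operator C E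
    unfolding E_def using C_sa someI_ex[OF spectral_theorem[OF C_sa]] by unfold_locales
  interpret A: resolved_operator A F
    unfolding F_def using A someI_ex[OF spectral_theorem[OF A]] by unfold_locales

  define Z where "Z = cyclic_space A \<phi>"
  have Z: "closed_csubspace Z" "\<phi> \<in> Z" "\<And>x. x \<in> Z \<Longrightarrow> A x \<in> Z"
    unfolding Z_def
    by (rule closed_csubspace_cyclic_space, rule cyclic_space_mem, rule cyclic_space_invariant[OF A])
  obtain P where P: "bounded_linear P" "\<And>x y. inner (P x) y = inner x (P y)"
    "\<And>x. P x \<in> Z" "\<And>x. x \<in> Z \<Longrightarrow> P x = x" "\<And>x v. v \<in> Z \<Longrightarrow> inner (x - P x) v = 0"
    using ex_orthogonal_projection[OF closed_csubspace_closed[OF Z(1)] closed_csubspace_subspace[OF Z(1)]]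
    by blast
  have P_A: "P (A x) = A (P x)" for x
    by (rule projection_commute[where S=Z])
       (use P Z A.symmetric bounded_linear.linear A.bounded_linear in auto)
  define Q where "Q x = x - P x" for x
  \<comment> \<open>Real orthogonality to \<open>Z\<close>, tested on \<open>\<phi>\<close> and on
    \<i> times \<open>\<phi>\<close>, yields the complex one; thus the perturbation vanishes on the
    range of \<open>Q\<close>.\<close>
  have "cinner \<phi> (Q x) = 0" for x
    using P(5)[OF Z(2), of x] P(5)[OF closed_csubspace_scaleC[OF Z(1,2)], of x \<i>]
    by (simp add: cinner_eq_Complex complex_eq_iff Q_def inner_commute)
  then have C_Q: "C (Q x) = Q (A x)" for x
    by (simp add: C_eq Q_def A.diff P_A)
  interpret Q: intertwining C E A F Q
  proof (intro intertwining.intro intertwining_axioms.intro C.resolved_operator_axioms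
      A.resolved_operator_axioms C_Q)
    show "bounded_linear Q" unfolding Q_def by (intro bounded_linear_sub bounded_linear_ident P)
    show "inner (Q x) y = inner x (Q y)" for x y
      by (simp add: Q_def inner_diff_left inner_diff_right P(2))
  qed

  \<comment> \<open>This map commutes with \<open>A\<close> but in general not with
    \<open>C\<close>, so spectral null sets pass from \<open>\<phi>\<close> to
    \<open>R \<phi>\<close> on the side of \<open>F\<close>.\<close>
  define R where "R x = (fst x, 0 :: 'b)" for x :: "'a \<times> 'b"
  interpret R: intertwining A F A F R
  proof (intro intertwining.intro intertwining_axioms.intro A.resolved_operator_axioms)
    show "bounded_linear R"
      unfolding R_def by (intro bounded_linear_Pair bounded_linear_fst bounded_linear_zero)
    have "A\<^sub>2 0 = 0"
      using assms(2) by (auto simp: bounded_selfadjoint_def linear_0 bounded_linear.linear)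
    then show "A (R x) = R (A x)" for x by (simp add: R_def A_def)
  qed (simp add: R_def inner_prod_def)

  define g where "g = Q (R \<phi>)"
  have full: "K = UNIV" if K: "closed_csubspace K" "\<And>x. x \<in> K \<Longrightarrow> C x \<in> K" "\<phi> \<in> K" "g \<in> K" for K
  proof -
    \<comment> \<open>The operators differ by multiples of \<open>\<phi>\<close>, which lies in
      \<open>K\<close>. So \<open>K\<close> contains \<open>Z\<close>, and adding
      \<open>P (R \<phi>)\<close> to \<open>g\<close> recovers \<open>R \<phi>\<close>.\<close>
    have K_A: "A x \<in> K" if "x \<in> K" for x
    proof -
      have "A x = C x - complex_of_real lam *\<^sub>C cinner \<phi> x *\<^sub>C \<phi>" by (simp add: C_eq)
      then show ?thesis using that K by (simp add: closed_csubspace_diff closed_csubspace_scaleC)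
    qed
    have "P (R \<phi>) \<in> K" using cyclic_space_minimal[where C=A, OF K(1) K_A K(3)] P(3)[of "R \<phi>"]
      unfolding Z_def by blast
    then have "g + P (R \<phi>) \<in> K" using K by (intro closed_csubspace_add)
    then have "(fst \<phi>, 0) \<in> K" by (simp add: g_def Q_def R_def)
    then show ?thesis
      using closed_csubspace_prod_full[OF assms(3,4) K(1) _ K(3)] K_A assms(1,2) by (simp add: A_def)
  qed

  \<comment> \<open>On Lebesgue null sets the measure of \<open>\<phi>\<close> lives on
    \<open>X\<close> with respect to \<open>F\<close> and on \<open>Y\<close> with respect to
    \<open>E\<close>.\<close>
  define X Y where "X = infinite_density (pvm_measure F \<phi>)" and "Y = infinite_density (pvm_measure E \<phi>)"
  have [measurable]: "X \<in> sets borel" "Y \<in> sets borel" by (auto simp: X_def Y_def)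
  have XY: "X \<inter> Y = {}"
    unfolding X_def Y_def
    by (rule infinite_density_rank_one_disjoint[OF A.resolved_operator_axioms C.resolved_operator_axioms
        assms(5) C_eq])
  have Y_\<phi>: "E (B - Y) \<phi> = 0" if "B \<in> sets borel" "emeasure lborel B = 0" for B
    using finite_density_null[OF C.finite_M C.sets_M that, of \<phi>] that
    by (simp add: C.emeasure_M flip: Y_def)
  \<comment> \<open>Vanishing on \<open>B - X\<close> passes through \<open>R\<close> within
    \<open>F\<close>, and then through \<open>Q\<close> from \<open>F\<close> to
    \<open>E\<close>.\<close>
  have X_g: "E (B - X) g = 0" if B: "B \<in> sets borel" "emeasure lborel B = 0" for B
  proof -
    have "F (B - X) \<phi> = 0"
      using finite_density_null[OF A.finite_M A.sets_M B, of \<phi>] B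
      by (simp add: A.emeasure_M flip: X_def)
    then have "F (B - X) (R \<phi>) = 0"
      using R.resolution_intertwine[of "B - X" \<phi>] B by (simp add: linear_0[OF R.linear_T])
    then show ?thesis
      using Q.resolution_intertwine[of "B - X" "R \<phi>"] B by (simp add: g_def linear_0[OF Q.linear_T])
  qed

  have "\<exists>N\<in>sets borel. emeasure lborel N = 0 \<and>
      (\<forall>B\<in>sets borel. emeasure lborel B = 0 \<longrightarrow> E (B - N) v = 0)" for v
    using ex_maximal_null_set[OF C.finite_M C.sets_M, of v] by (auto simp: C.emeasure_M)
  then obtain N' where N': "\<And>v. N' v \<in> sets borel" "\<And>v. emeasure lborel (N' v) = 0"
    "\<And>v B. B \<in> sets borel \<Longrightarrow> emeasure lborel B = 0 \<Longrightarrow> E (B - N' v) v = 0"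
    by metis
  define N where "N = N' \<phi> \<union> N' g"
  have N[measurable]: "N \<in> sets borel" using N' by (simp add: N_def)
  have N_null: "emeasure lborel N = 0"
    using N' unfolding N_def by (intro emeasure_Un_null_set[THEN trans]) (auto simp: null_sets_def)
  \<comment> \<open>The kernel of \<open>E (B - N)\<close> is closed, invariant under
    \<open>C\<close> and contains both generators, hence is everything: a null set chosen for two
    vectors serves all.\<close>
  have E_outside: "E (B - N) x = 0" if B: "B \<in> sets borel" "emeasure lborel B = 0" for B x
  proof -
    have "E (B - N) v = 0" if "N' v \<subseteq> N" for v
      by (rule C.E_zero_mono[OF _ _ _ N'(3)[OF B, of v]]) (use that B N'(1) in auto)
    then have "E (B - N) \<phi> = 0" "E (B - N) g = 0" by (auto simp: N_def)
    moreover have "closed_csubspace {x. E (B - N) x = 0}"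
      using B by (intro closed_csubspace_kernel C.E_selfadjoint) auto
    ultimately have "{x. E (B - N) x = 0} = UNIV"
      using B by (intro full) (auto simp: C.zero simp flip: C.C_E)
    then show ?thesis by auto
  qed
  have singular: "singular_subspace C = {x. E N x = x}"
  proof safe
    fix x assume "x \<in> singular_subspace C"
    then obtain B where B: "B \<in> sets borel" "emeasure lborel B = 0" "E B x = x"
      by (auto simp: singular_subspace_def spectral_measure_def C.lebesgue_singular_iff simp flip: E_def)
    have "E B x = E (B - B \<inter> N) x + E (B \<inter> N) x" using B by (intro C.E_Diff) auto
    also have "B - B \<inter> N = B - N" by auto
    finally have "x = E (B \<inter> N) x" using B E_outside by simp
    then show "E N x = x"
      using C.E_Int[of N "B \<inter> N" x] B by (metis N inf.right_idem inf_commute sets.Int)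
  next
    fix x assume "E N x = x"
    then show "x \<in> singular_subspace C"
      using N N_null
      by (auto simp: singular_subspace_def spectral_measure_def C.lebesgue_singular_iff simp flip: E_def)
  qed

  define \<eta> where "\<eta> = E N (\<phi> + g)"
  define S where "S = cyclic_space C \<eta>"
  have S: "closed_csubspace S" "\<eta> \<in> S" "\<And>x. x \<in> S \<Longrightarrow> C x \<in> S"
    unfolding S_def
    by (rule closed_csubspace_cyclic_space, rule cyclic_space_mem, rule cyclic_space_invariant[OF C_sa])
  have "S = {x. E N x = x}"
  proof
    show "S \<subseteq> {x. E N x = x}"
      unfolding S_def
      by (rule cyclic_space_minimal[OF C.closed_csubspace_range_E[OF N]])
         (simp_all add: \<eta>_def C.E_idem flip: C.C_E)
    \<comment> \<open>Inside \<open>N\<close>, the vector \<open>\<phi>\<close> lives on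
      \<open>Y\<close> and \<open>g\<close> off \<open>Y\<close>. The projection for
      \<open>N \<inter> Y\<close> therefore extracts \<open>E N \<phi>\<close> from
      \<open>\<eta>\<close>, and it does not leave the invariant subspace \<open>S\<close>.\<close>
    have "E (N \<inter> Y) g = 0"
      by (rule C.E_zero_mono[OF _ _ _ X_g[OF N N_null]]) (use XY in auto)
    moreover have "E (N \<inter> Y) \<phi> = E N \<phi>"
    proof -
      have "E N \<phi> = E (N - N \<inter> Y) \<phi> + E (N \<inter> Y) \<phi>" by (intro C.E_Diff) auto
      also have "N - N \<inter> Y = N - Y" by auto
      finally show ?thesis using Y_\<phi>[OF N N_null] by simp
    qed
    moreover have "E (N \<inter> Y) \<eta> = E (N \<inter> Y) (\<phi> + g)"
      unfolding \<eta>_def by (simp add: C.E_Int Int_assoc Int_commute Int_left_commute)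
    ultimately have "E (N \<inter> Y) \<eta> = E N \<phi>" by (simp add: C.E_add)
    moreover have "E (N \<inter> Y) \<eta> \<in> S" by (rule C.invariant_subspace_E[OF S(1,3)]) (auto simp: S)
    ultimately have 1: "E N \<phi> \<in> S" by simp
    then have "\<eta> - E N \<phi> \<in> S" using S by (intro closed_csubspace_diff)
    then have 2: "E N g \<in> S" by (simp add: \<eta>_def C.E_add)
    \<comment> \<open>This preimage of \<open>S\<close> is closed, invariant and contains
      \<open>\<phi>\<close> and \<open>g\<close>, so \<open>E N\<close> maps the whole space into
      \<open>S\<close>.\<close>
    have "closed_csubspace {x. E N x \<in> S}"
      by (intro closed_csubspace_vimage C.bounded_linear_E C.E_scaleC S N)
    then have "{x. E N x \<in> S} = UNIV"
      using 1 2 S(3) by (intro full) (auto simp flip: C.C_E)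
    then show "{x. E N x = x} \<subseteq> S" by (metis (mono_tags, lifting) UNIV_I mem_Collect_eq subsetI)
  qed
  then have "cyclic_vector_on (singular_subspace C) C \<eta>"
    unfolding cyclic_vector_on_def singular S_def cyclic_space_def .
  then show "simple_singular_spectrum C" unfolding simple_singular_spectrum_def by blast
qed

end
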